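(* Let $\mathbb{F}$ be an algebraically closed field of characteristic $p>2$, let $n\ge 2$ be an integer, let $\underline{t}=(t_1,\dots,t_n)$ be an $n$-tuple of positive integers, and let $SHO=SHO(n,n;\underline{t})$ be the special odd Hamiltonian superalgebra over $\mathbb{F}$. Then all skew-symmetric super-biderivations of $SHO$ are inner, i.e. $$\mathrm{BDer}(SHO)=\mathrm{IBDer}(SHO).$$
   Context: $\mathbb{Z}_2=\{\bar0,\bar1\}$; $\mathrm{d}(x)$ denotes the $\mathbb{Z}_2$-degree (parity) of a $\mathbb{Z}_2$-homogeneous element $x$. Whenever $\mathrm{d}(x)$ occurs, $x$ is assumed $\mathbb{Z}_2$-homogeneous, and formulas involving $\mathrm{d}$ are extended linearly. A Lie superalgebra is a vector superspace $L=L_{\bar0}\oplus L_{\bar1}$ with an even bilinear bracket satisfying $[x,y]=-(-1)^{\mathrm{d}(x)\mathrm{d}(y)}[y,x]$ and $[x,[y,z]]=[[x,y],z]+(-1)^{\mathrm{d}(x)\mathrm{d}(y)}[y,[x,z]]$. Super-biderivations. A bilinear map $\phi:L\times L\to L$ is $\mathbb{Z}_2$-homogeneous of degree $\gamma=\mathrm{d}(\phi)\in\mathbb{Z}_2$ if $\phi(L_\alpha,L_\beta)\subset L_{\alpha+\beta+\gamma}$ for all $\alpha,\beta\in\mathbb{Z}_2$; it is even if $\gamma=\bar0$. A ($\mathbb{Z}_2$-homogeneous) bilinear map $\phi$ is a skew-symmetric super-biderivation of $L$ if for all $x,y,z\in L$: $$\phi(x,[y,z])=[\phi(x,y),z]+(-1)^{(\mathrm{d}(\phi)+\mathrm{d}(x))\mathrm{d}(y)}[y,\phi(x,z)],$$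 $$\phi(x,y)=-(-1)^{\mathrm{d}(\phi)\mathrm{d}(x)+\mathrm{d}(\phi)\mathrm{d}(y)+\mathrm{d}(x)\mathrm{d}(y)}\phi(y,x).$$ $\mathrm{BDer}_{\gamma}(L)$ is the set of those of $\mathbb{Z}_2$-degree $\gamma$, and $\mathrm{BDer}(L)=\mathrm{BDer}_{\bar0}(L)\oplus\mathrm{BDer}_{\bar1}(L)$. For $\lambda\in\mathbb{F}$ the map $\phi_\lambda(x,y)=\lambda[x,y]$ is called an inner super-biderivation; $\mathrm{IBDer}(L)=\{\phi_\lambda\mid\lambda\in\mathbb{F}\}$. The superalgebra $SHO(n,n;\underline t)$. Put $Y_0=\{1,\dots,n\}$, $Y_1=\{n+1,\dots,2n\}$, $Y=Y_0\cup Y_1$; $\tau(i)=\bar0$ for $i\in Y_0$ and $\tau(i)=\bar1$ for $i\in Y_1$; $i'=i+n$ for $i\in Y_0$ and $i'=i-n$ for $i\in Y_1$. Let $\mathcal{U}(n)$ be the divided power algebra over $\mathbb{F}$ with basis $\{x^{(\alpha)}\mid\alpha\in\mathbb{N}^n\}$ and product $x^{(\alpha)}x^{(\beta)}=\binom{\alpha+\beta}{\alpha}x^{(\alpha+\beta)}$, where $\binom{\alpha}{\beta}=\prod_i\binom{\alpha_i}{\beta_i}$; write $x_i=x^{(\varepsilon_i)}$ for $i\in Y_0$, where $\varepsilon_i$ is the $i$-th standard unit vector. Let $\Lambda(n)$ be the Grassmann superalgebra in the odd variables $x_{n+1},\dots,x_{2n}$, and $\Lambda(n,n)=\mathcal{U}(n)\otimes\Lambda(n)$,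 with $\mathbb{Z}_2$-grading induced by that of $\Lambda(n)$ ($\mathcal U(n)$ being even). Let $B$ be the set of all strictly increasing tuples $u=\langle i_1,\dots,i_k\rangle$ in $Y_1$, $0\le k\le n$, with $x^u=x_{i_1}\cdots x_{i_k}$ ($x^\varnothing=1$); $i\in u$ means that $i$ is an entry of $u$. Let $A=\{\alpha\in\mathbb{N}^n\mid 0\le\alpha_i\le p^{t_i}-1,\ i\in Y_0\}$ and $\Lambda(n,n;\underline t)=\mathrm{span}_{\mathbb F}\{x^{(\alpha)}x^u\mid\alpha\in A,u\in B\}$, a subalgebra of $\Lambda(n,n)$. Let $D_i$ be the superderivations with $D_i(x^{(\alpha)}x^u)=x^{(\alpha-\varepsilon_i)}x^u$ for $i\in Y_0$ (zero if $\alpha_i=0$) and $D_i(x^{(\alpha)}x^u)=x^{(\alpha)}\partial_i(x^u)$ for $i\in Y_1$, where $\partial_i$ is the odd (left) superderivation of $\Lambda(n)$ with $\partial_i(x_j)=\delta_{ij}$; $\mathrm d(D_i)=\tau(i)$. The generalized Witt superalgebra is $W(n,n;\underline t)=\{\sum_{i=1}^{2n}f_iD_i\mid f_i\in\Lambda(n,n;\underline t)\}$ with bracket $[fD_i,gD_j]=fD_i(g)D_j-(-1)^{\mathrm d(fD_i)\mathrm d(gD_j)}gD_j(f)D_i$. Define the linear maps $T_H:\Lambda(n,n;\underline t)\to W(n,n;\underline t)$, $T_H(f)=\sum_{i=1}^{2n}(-1)^{\tau(i)\mathrm d(f)}D_i(f)D_{i'}$, and $\mathrm{div}:W(n,n;\underline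 t)\to\Lambda(n,n;\underline t)$, $\mathrm{div}(f_iD_i)=(-1)^{\tau(i)\mathrm d(f_i)}D_i(f_i)$. Let $HO=\mathrm{span}_{\mathbb F}\{T_H(f)\mid f\in\Lambda(n,n;\underline t)\}$, $SHO'=\{D\in HO\mid\mathrm{div}(D)=0\}$, $\overline{SHO}=[SHO',SHO']$, and $SHO=SHO(n,n;\underline t)=[\overline{SHO},\overline{SHO}]$. It is taken as a known background fact that $SHO$ is a finite-dimensional simple Lie superalgebra.
   Formalization: The background fact that SHO(n,n;t) is simple is an explicit hypothesis; it fails for n = 2, where the odd part is a proper graded ideal and a nonzero odd, non-inner skew-symmetric super-biderivation exists, so the claim as stated is false there. *)

theory Defs
  imports
    "HOL-Library.Z2"
    "HOL-Library.FuncSet"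
    "HOL-Library.Poly_Mapping"
    "HOL-Computational_Algebra.Polynomial"
begin

section \<open>Superalgebras and skew-symmetric super-biderivations\<close>

text \<open>
  The group \<open>\<int>\<^sub>2\<close> of parities is the type \<^typ>\<open>bit\<close>; \<open>sg \<theta>\<close> is \<open>(-1)\<close> to the power \<open>\<theta>\<close>.
\<close>

definition sg :: "bit \<Rightarrow> 'f::ring_1" where
  "sg \<theta> = (if \<theta> = 0 then 1 else - 1)"

text \<open>
  A superalgebra living inside an ambient additive group: \<open>sspace\<close> is the underlying vector space
  and \<open>spart \<theta>\<close> its homogeneous component of parity \<open>\<theta>\<close>.
\<close>

record ('f, 'v) superalgebra =
  sspace :: "'v set"
  spart :: "bit \<Rightarrow> 'v set"
  sscale :: "'f \<Rightarrow> 'v \<Rightarrow> 'v"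
  sbracket :: "'v \<Rightarrow> 'v \<Rightarrow> 'v"

definition graded_ideal :: "('f::field, 'v::ab_group_add) superalgebra \<Rightarrow> 'v set \<Rightarrow> bool" where
  "graded_ideal L I \<longleftrightarrow>
     I \<subseteq> sspace L \<and> module.subspace (sscale L) I \<and>
     (\<forall>x\<in>I. \<exists>y\<in>I \<inter> spart L 0. \<exists>z\<in>I \<inter> spart L 1. x = y + z) \<and>
     (\<forall>x\<in>sspace L. \<forall>y\<in>I. sbracket L x y \<in> I \<and> sbracket L y x \<in> I)"

text \<open>As usual for superalgebras, only \<open>\<int>\<^sub>2\<close>-graded two-sided ideals are considered.\<close>

definition simple_superalgebra :: "('f::field, 'v::ab_group_add) superalgebra \<Rightarrow> bool" where
  "simple_superalgebra L \<longleftrightarrow>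
     (\<exists>x\<in>sspace L. \<exists>y\<in>sspace L. sbracket L x y \<noteq> 0) \<and>
     (\<forall>I. graded_ideal L I \<longrightarrow> I = {0} \<or> I = sspace L)"

text \<open>
  Bilinear maps \<open>L \<times> L \<rightarrow> L\<close> are extensional functions on pairs, so that equality of functions
  is equality of maps on \<open>L \<times> L\<close>.
\<close>

definition bilinear_maps ::
    "('f::field, 'v::ab_group_add) superalgebra \<Rightarrow> ('v \<times> 'v \<Rightarrow> 'v) set" where
  "bilinear_maps L = {\<phi> \<in> sspace L \<times> sspace L \<rightarrow>\<^sub>E sspace L.
     (\<forall>x\<in>sspace L. \<forall>y\<in>sspace L. \<forall>z\<in>sspace L.
        \<phi> (x + y, z) = \<phi> (x, z) + \<phi> (y, z) \<and> \<phi> (x, y + z) = \<phi> (x, y) + \<phi> (x, z)) \<and>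
     (\<forall>c. \<forall>x\<in>sspace L. \<forall>y\<in>sspace L.
        \<phi> (sscale L c x, y) = sscale L c (\<phi> (x, y)) \<and> \<phi> (x, sscale L c y) = sscale L c (\<phi> (x, y)))}"

definition homogeneous_map ::
    "('f, 'v) superalgebra \<Rightarrow> bit \<Rightarrow> ('v \<times> 'v \<Rightarrow> 'v) \<Rightarrow> bool" where
  "homogeneous_map L \<gamma> \<phi> \<longleftrightarrow>
     (\<forall>\<alpha> \<beta>. \<forall>x\<in>spart L \<alpha>. \<forall>y\<in>spart L \<beta>. \<phi> (x, y) \<in> spart L (\<alpha> + \<beta> + \<gamma>))"

definition BDer_deg ::
    "('f::field, 'v::ab_group_add) superalgebra \<Rightarrow> bit \<Rightarrow> ('v \<times> 'v \<Rightarrow> 'v) set" where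
  "BDer_deg L \<gamma> = {\<phi> \<in> bilinear_maps L. homogeneous_map L \<gamma> \<phi> \<and>
     (\<forall>\<alpha> \<beta>. \<forall>x\<in>spart L \<alpha>. \<forall>y\<in>spart L \<beta>. \<forall>z\<in>sspace L.
        \<phi> (x, sbracket L y z) =
          sbracket L (\<phi> (x, y)) z + sscale L (sg ((\<gamma> + \<alpha>) * \<beta>)) (sbracket L y (\<phi> (x, z)))) \<and>
     (\<forall>\<alpha> \<beta>. \<forall>x\<in>spart L \<alpha>. \<forall>y\<in>spart L \<beta>.
        \<phi> (x, y) = - sscale L (sg (\<gamma> * \<alpha> + \<gamma> * \<beta> + \<alpha> * \<beta>)) (\<phi> (y, x)))}"

definition BDer ::
    "('f::field, 'v::ab_group_add) superalgebra \<Rightarrow> ('v \<times> 'v \<Rightarrow> 'v) set" where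
  "BDer L = {\<lambda>z\<in>sspace L \<times> sspace L. \<phi> z + \<psi> z |\<phi> \<psi>. \<phi> \<in> BDer_deg L 0 \<and> \<psi> \<in> BDer_deg L 1}"

definition inner_biderivation ::
    "('f, 'v) superalgebra \<Rightarrow> 'f \<Rightarrow> 'v \<times> 'v \<Rightarrow> 'v" where
  "inner_biderivation L c = (\<lambda>(x, y)\<in>sspace L \<times> sspace L. sscale L c (sbracket L x y))"

definition IBDer :: "('f, 'v) superalgebra \<Rightarrow> ('v \<times> 'v \<Rightarrow> 'v) set" where
  "IBDer L = range (inner_biderivation L)"


section \<open>The superalgebra \<open>\<Lambda>(n,n;t)\<close>\<close>

text \<open>
  The pair \<open>(\<alpha>, u)\<close> stands for the basis element \<open>x\<^sup>(\<^sup>\<alpha>\<^sup>) x\<^sup>u\<close>; a strictly increasing tuple \<open>u\<close> is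
  encoded by the finite set of its entries. Elements of \<open>\<Lambda>(n,n)\<close> are finitely supported
  coefficient functions on such pairs.
\<close>

type_synonym mono = "(nat \<Rightarrow>\<^sub>0 nat) \<times> nat set"
type_synonym 'f lam = "mono \<Rightarrow>\<^sub>0 'f"

definition lam_scale :: "'f::field \<Rightarrow> 'f lam \<Rightarrow> 'f lam" where
  "lam_scale c f = Poly_Mapping.map ((*) c) f"

definition tau :: "nat \<Rightarrow> nat \<Rightarrow> bit" where
  "tau n i = (if i \<le> n then 0 else 1)"

definition dual_index :: "nat \<Rightarrow> nat \<Rightarrow> nat" where
  "dual_index n i = (if i \<le> n then i + n else i - n)"

definition exponents :: "nat \<Rightarrow> nat \<Rightarrow> (nat \<Rightarrow> nat) \<Rightarrow> (nat \<Rightarrow>\<^sub>0 nat) set" where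
  "exponents p n t =
     {\<alpha>. Poly_Mapping.keys \<alpha> \<subseteq> {1..n} \<and> (\<forall>i\<in>{1..n}. Poly_Mapping.lookup \<alpha> i \<le> p ^ t i - 1)}"

definition Lam :: "nat \<Rightarrow> (nat \<Rightarrow> nat) \<Rightarrow> 'f::field lam set" where
  "Lam n t = {f. \<forall>(\<alpha>, u)\<in>Poly_Mapping.keys f. \<alpha> \<in> exponents CHAR('f) n t \<and> u \<subseteq> {n+1..2*n}}"

definition mono_parity :: "mono \<Rightarrow> bit" where
  "mono_parity m = of_nat (card (snd m))"

definition lam_homogeneous :: "bit \<Rightarrow> 'f::zero lam \<Rightarrow> bool" where
  "lam_homogeneous \<theta> f \<longleftrightarrow> (\<forall>m\<in>Poly_Mapping.keys f. mono_parity m = \<theta>)"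

definition lam_part :: "bit \<Rightarrow> 'f::field lam \<Rightarrow> 'f lam" where
  "lam_part \<theta> f =
     (\<Sum>m\<in>Poly_Mapping.keys f.
        if mono_parity m = \<theta> then Poly_Mapping.single m (Poly_Mapping.lookup f m) else 0)"

text \<open>
  The sign in \<open>x\<^sup>u x\<^sup>v\<close> counts the transpositions needed to sort the concatenation of \<open>u\<close> and \<open>v\<close>.
  In the binomial coefficient, indices outside the support of \<open>\<alpha>\<close> contribute a factor \<open>1\<close>.
\<close>

definition mono_mult :: "mono \<Rightarrow> mono \<Rightarrow> 'f::field lam" where
  "mono_mult = (\<lambda>(\<alpha>, u) (\<beta>, v).
     if u \<inter> v = {} then
       Poly_Mapping.single (\<alpha> + \<beta>, u \<union> v)
         (of_nat (\<Prod>i\<in>Poly_Mapping.keys \<alpha>.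
            Poly_Mapping.lookup (\<alpha> + \<beta>) i choose Poly_Mapping.lookup \<alpha> i) *
          (- 1) ^ card {(i, j). i \<in> u \<and> j \<in> v \<and> j < i})
     else 0)"

definition lam_mult :: "'f::field lam \<Rightarrow> 'f lam \<Rightarrow> 'f lam" where
  "lam_mult f g =
     (\<Sum>a\<in>Poly_Mapping.keys f. \<Sum>b\<in>Poly_Mapping.keys g.
        lam_scale (Poly_Mapping.lookup f a * Poly_Mapping.lookup g b) (mono_mult a b))"

text \<open>
  For odd \<open>x\<^sub>i\<close>, the left superderivation moves \<open>x\<^sub>i\<close> to the front of \<open>x\<^sup>u\<close> before deleting it.
\<close>

definition mono_der :: "nat \<Rightarrow> nat \<Rightarrow> mono \<Rightarrow> 'f::field lam" where
  "mono_der n i = (\<lambda>(\<alpha>, u).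
     if i \<le> n then
       if Poly_Mapping.lookup \<alpha> i = 0 then 0
       else Poly_Mapping.single (\<alpha> - Poly_Mapping.single i 1, u) 1
     else
       if i \<in> u then Poly_Mapping.single (\<alpha>, u - {i}) ((- 1) ^ card {j \<in> u. j < i})
       else 0)"

definition der :: "nat \<Rightarrow> nat \<Rightarrow> 'f::field lam \<Rightarrow> 'f lam" where
  "der n i f = (\<Sum>m\<in>Poly_Mapping.keys f. lam_scale (Poly_Mapping.lookup f m) (mono_der n i m))"


section \<open>The superalgebra \<open>SHO(n,n;t)\<close>\<close>

text \<open>
  The \<open>D\<^sub>i\<close> are free generators of the \<open>\<Lambda>(n,n;t)\<close>-module \<open>W(n,n;t)\<close>, so \<open>\<Sum>\<^sub>i f\<^sub>i D\<^sub>i\<close> is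
  represented by the family of its coefficients \<open>f\<^sub>i\<close>, and \<open>f D\<^sub>i\<close> is \<open>Poly_Mapping.single i f\<close>.
\<close>

type_synonym 'f wit = "nat \<Rightarrow>\<^sub>0 'f lam"

definition wit_scale :: "'f::field \<Rightarrow> 'f wit \<Rightarrow> 'f wit" where
  "wit_scale c X = Poly_Mapping.map (lam_scale c) X"

lemma lookup_lam_scale [simp]: "Poly_Mapping.lookup (lam_scale c f) m = c * Poly_Mapping.lookup f m"
  by (simp add: lam_scale_def Poly_Mapping.map.rep_eq when_def)

lemma lookup_wit_scale [simp]:
  "Poly_Mapping.lookup (wit_scale c X) i = lam_scale c (Poly_Mapping.lookup X i)"
  by (auto simp: wit_scale_def Poly_Mapping.map.rep_eq when_def intro!: poly_mapping_eqI)

global_interpretation wit: vector_space wit_scale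
  by unfold_locales
    (auto intro!: poly_mapping_eqI simp: lookup_add algebra_simps)

text \<open>
  In the bracket, in \<open>T\<^sub>H\<close> and in the divergence, coefficients are split into their homogeneous
  parts: this is the linear extension of the formulas involving parities.
\<close>

definition wit_homogeneous :: "nat \<Rightarrow> bit \<Rightarrow> 'f::field wit \<Rightarrow> bool" where
  "wit_homogeneous n \<theta> X \<longleftrightarrow> (\<forall>i\<in>{1..2*n}. lam_homogeneous (\<theta> + tau n i) (Poly_Mapping.lookup X i))"

definition bracket_term ::
    "nat \<Rightarrow> bit \<Rightarrow> 'f::field lam \<Rightarrow> nat \<Rightarrow> bit \<Rightarrow> 'f lam \<Rightarrow> nat \<Rightarrow> 'f wit" where
  "bracket_term n \<theta> f i \<eta> g j =
     Poly_Mapping.single j (lam_mult f (der n i g)) -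
     wit_scale (sg ((\<theta> + tau n i) * (\<eta> + tau n j)))
       (Poly_Mapping.single i (lam_mult g (der n j f)))"

definition bracket :: "nat \<Rightarrow> 'f::field wit \<Rightarrow> 'f wit \<Rightarrow> 'f wit" where
  "bracket n X Y =
     (\<Sum>i\<in>{1..2*n}. \<Sum>j\<in>{1..2*n}. \<Sum>\<theta>\<in>{0, 1}. \<Sum>\<eta>\<in>{0, 1}.
        bracket_term n \<theta> (lam_part \<theta> (Poly_Mapping.lookup X i)) i
          \<eta> (lam_part \<eta> (Poly_Mapping.lookup Y j)) j)"

definition T_H :: "nat \<Rightarrow> 'f::field lam \<Rightarrow> 'f wit" where
  "T_H n f =
     (\<Sum>i\<in>{1..2*n}. \<Sum>\<theta>\<in>{0, 1}.
        wit_scale (sg (tau n i * \<theta>)) (Poly_Mapping.single (dual_index n i) (der n i (lam_part \<theta> f))))"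

definition divergence :: "nat \<Rightarrow> 'f::field wit \<Rightarrow> 'f lam" where
  "divergence n X =
     (\<Sum>i\<in>{1..2*n}. \<Sum>\<theta>\<in>{0, 1}.
        lam_scale (sg (tau n i * \<theta>)) (der n i (lam_part \<theta> (Poly_Mapping.lookup X i))))"

definition bracket_span :: "nat \<Rightarrow> 'f::field wit set \<Rightarrow> 'f wit set" where
  "bracket_span n S = wit.span {bracket n X Y |X Y. X \<in> S \<and> Y \<in> S}"

definition HO :: "nat \<Rightarrow> (nat \<Rightarrow> nat) \<Rightarrow> 'f::field wit set" where
  "HO n t = wit.span (T_H n ` Lam n t)"

definition SHO' :: "nat \<Rightarrow> (nat \<Rightarrow> nat) \<Rightarrow> 'f::field wit set" where
  "SHO' n t = {X \<in> HO n t. divergence n X = 0}"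

definition SHO_bar :: "nat \<Rightarrow> (nat \<Rightarrow> nat) \<Rightarrow> 'f::field wit set" where
  "SHO_bar n t = bracket_span n (SHO' n t)"

definition SHO :: "nat \<Rightarrow> (nat \<Rightarrow> nat) \<Rightarrow> ('f::field, 'f wit) superalgebra" where
  "SHO n t =
     (let S = bracket_span n (SHO_bar n t) in
      \<lparr>sspace = S, spart = (\<lambda>\<theta>. {X \<in> S. wit_homogeneous n \<theta> X}),
       sscale = wit_scale, sbracket = bracket n\<rparr>)"

end

theory Submission
  imports Defs
begin

text \<open>
  The statement holds for every finite-dimensional simple Lie superalgebra \<open>L\<close> over an
  algebraically closed field of characteristic different from \<open>2\<close> (\<open>BDer_eq_IBDer\<close>), and \<open>SHO\<close>
  is one.
  
  For a skew-symmetric super-biderivation \<open>\<phi>\<close>, expanding \<open>\<phi>([x,u],[y,v])\<close> in the two possible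
  orders gives, up to signs, \<open>[\<phi>(x,y),[u,v]] = [[x,y],\<phi>(u,v)]\<close> (\<open>phi_bracket_commute\<close>). As \<open>L\<close> is
  perfect and has trivial center, the Jacobi identity then forces
  \<open>[\<phi>(x,y),z] + [\<phi>(y,z),x] + [\<phi>(z,x),y] = 0\<close> (\<open>phi_cyclic\<close>), which together with the derivation
  rule becomes \<open>\<phi>(x,[y,z]) = [x,\<phi>(y,z)]\<close>. Therefore \<open>\<phi>(x,w) = [x,\<gamma>(w)]\<close> for a linear map \<open>\<gamma>\<close>
  in the supercentroid of \<open>L\<close>. If \<open>\<phi>\<close> is even, \<open>\<gamma>\<close> has an eigenvector, its eigenspace is a graded
  ideal, and so \<open>\<gamma>\<close> is a scalar by simplicity. If \<open>\<phi>\<close> is odd, moving \<open>\<gamma>\<close> across the bracket in two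
  ways gives \<open>\<gamma>\<^sup>2[x,y] = - \<gamma>\<^sup>2[x,y]\<close>, so \<open>\<gamma>\<^sup>2 = 0\<close>; the kernel of \<open>\<gamma>\<close> is then a nonzero graded
  ideal and \<open>\<gamma> = 0\<close>.
  
  It remains to see that \<open>SHO\<close> is a Lie superalgebra of finite dimension. The product of
  \<open>\<Lambda>(n,n;t)\<close> is associative and supercommutative, and the \<open>D\<^sub>i\<close> are supercommuting superderivations;
  hence an element \<open>X = \<Sum>\<^sub>i f\<^sub>i D\<^sub>i\<close> acts as a superderivation (\<open>act\<close>), the bracket acts as the
  supercommutator (\<open>act_bracket\<close>), and the Jacobi identity follows. The formulas
  \<open>[T\<^sub>H(f), T\<^sub>H(g)] = T\<^sub>H(T\<^sub>H(f)(g))\<close> and \<open>div[X,Y] = X(div Y) \<plusminus> Y(div X)\<close> show that \<open>SHO'\<close> is closed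
  under the bracket, and derived subalgebras of a graded subalgebra are graded subalgebras again.
\<close>

section \<open>Parities and signs\<close>

text \<open>
  Identities between signs are polynomial identities over \<open>\<int>\<^sub>2\<close>. They are proved throughout by
  listing all values of the parities involved, which is what this case rule is for.
\<close>

lemma bit_cases: "a = 0 \<or> a = (1::bit)"
  by (cases a) auto

lemma sg_simps [simp]: "sg 0 = 1" "sg 1 = - 1"
  by (simp_all add: sg_def)

lemma bit_add_self: "(1::bit) + 1 = 0"
  by simp

lemma sg_mult: "sg a * sg b = sg (a + b)"
  by (cases a; cases b) (simp_all add: sg_def)

section \<open>Lie superalgebras and their graded ideals\<close>

locale lie_superalgebra = vector_space "sscale L"
  for L :: "('f::field, 'v::ab_group_add) superalgebra" +
  assumes subspace_sspace: "subspace (sspace L)"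
    and subspace_spart: "subspace (spart L \<theta>)"
    and spart_subset: "spart L \<theta> \<subseteq> sspace L"
    and homogeneous_decomposition: "x \<in> sspace L \<Longrightarrow> \<exists>y\<in>spart L 0. \<exists>z\<in>spart L 1. x = y + z"
    and spart_disjoint: "spart L 0 \<inter> spart L 1 \<subseteq> {0}"
    and bracket_add_left: "\<lbrakk>x \<in> sspace L; y \<in> sspace L; z \<in> sspace L\<rbrakk>
      \<Longrightarrow> sbracket L (x + y) z = sbracket L x z + sbracket L y z"
    and bracket_add_right: "\<lbrakk>x \<in> sspace L; y \<in> sspace L; z \<in> sspace L\<rbrakk>
      \<Longrightarrow> sbracket L x (y + z) = sbracket L x y + sbracket L x z"
    and bracket_scale_left: "\<lbrakk>x \<in> sspace L; y \<in> sspace L\<rbrakk>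
      \<Longrightarrow> sbracket L (sscale L k x) y = sscale L k (sbracket L x y)"
    and bracket_scale_right: "\<lbrakk>x \<in> sspace L; y \<in> sspace L\<rbrakk>
      \<Longrightarrow> sbracket L x (sscale L k y) = sscale L k (sbracket L x y)"
    and bracket_spart: "\<lbrakk>x \<in> spart L a; y \<in> spart L b\<rbrakk> \<Longrightarrow> sbracket L x y \<in> spart L (a + b)"
    and bracket_skew: "\<lbrakk>x \<in> spart L a; y \<in> spart L b\<rbrakk>
      \<Longrightarrow> sbracket L x y = - sscale L (sg (a * b)) (sbracket L y x)"
    and jacobi: "\<lbrakk>x \<in> spart L a; y \<in> spart L b; z \<in> spart L c\<rbrakk>
      \<Longrightarrow> sbracket L x (sbracket L y z) =
        sbracket L (sbracket L x y) z + sscale L (sg (a * b)) (sbracket L y (sbracket L x z))"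
begin

abbreviation br (infixl "\<bullet>" 70) where "x \<bullet> y \<equiv> sbracket L x y"

abbreviation S where "S \<equiv> sspace L"
abbreviation P where "P \<equiv> spart L"

lemma spart_sspace: "x \<in> P a \<Longrightarrow> x \<in> S"
  using spart_subset by blast

lemma sspace_closed [simp]:
  "0 \<in> S" "x \<in> S \<Longrightarrow> y \<in> S \<Longrightarrow> x + y \<in> S" "x \<in> S \<Longrightarrow> y \<in> S \<Longrightarrow> x - y \<in> S"
  "x \<in> S \<Longrightarrow> - x \<in> S" "x \<in> S \<Longrightarrow> sscale L c x \<in> S"
  using subspace_sspace by (auto simp: subspace_0 subspace_add subspace_diff subspace_neg subspace_scale)

lemma spart_closed [simp]:
  "0 \<in> P a" "x \<in> P a \<Longrightarrow> y \<in> P a \<Longrightarrow> x + y \<in> P a" "x \<in> P a \<Longrightarrow> y \<in> P a \<Longrightarrow> x - y \<in> P a"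
  "x \<in> P a \<Longrightarrow> - x \<in> P a" "x \<in> P a \<Longrightarrow> sscale L c x \<in> P a"
  using subspace_spart by (auto simp: subspace_0 subspace_add subspace_diff subspace_neg subspace_scale)

lemma decomposition_unique:
  assumes "x \<in> P 0" "y \<in> P 1" "x' \<in> P 0" "y' \<in> P 1" "x + y = x' + y'"
  shows "x = x'" "y = y'"
proof -
  have "x - x' = y' - y" using assms(5) by (simp add: algebra_simps)
  moreover have "x - x' \<in> P 0" "y' - y \<in> P 1" using assms by simp_all
  ultimately have "x - x' \<in> P 0 \<inter> P 1" by simp
  then have "x - x' = 0" using spart_disjoint by blast
  then show "x = x'" "y = y'" using assms(5) by simp_all
qed

lemma homogeneous_sum_zero:
  assumes "x \<in> P a" "y \<in> P (a + 1)" "x + y = 0"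
  shows "x = 0" "y = 0"
proof -
  have "x = 0 \<and> y = 0"
    using bit_cases[of a]
  proof
    assume "a = 0"
    then show ?thesis using decomposition_unique[of x y 0 0] assms by simp
  next
    assume "a = 1"
    then show ?thesis using decomposition_unique[of y x 0 0] assms by (simp add: add.commute)
  qed
  then show "x = 0" "y = 0" by simp_all
qed

lemma homogeneous_cases:
  assumes "x \<in> S"
  obtains y z where "y \<in> P 0" "z \<in> P 1" "x = y + z"
  using homogeneous_decomposition[OF assms] by blast

lemma homogeneous_induct [consumes 1, case_names homogeneous add]:
  assumes "x \<in> S" "\<And>a y. y \<in> P a \<Longrightarrow> Q y"
    "\<And>y z. y \<in> S \<Longrightarrow> z \<in> S \<Longrightarrow> Q y \<Longrightarrow> Q z \<Longrightarrow> Q (y + z)"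
  shows "Q x"
  using assms by (metis homogeneous_cases spart_sspace)

lemma bracket_sspace [simp]:
  assumes "x \<in> S" "y \<in> S" shows "x \<bullet> y \<in> S"
proof -
  have "x \<bullet> y \<in> S" if "x \<in> P a" for x a
    using assms(2) by (induction rule: homogeneous_induct)
      (use that in \<open>auto intro: spart_sspace bracket_spart simp: bracket_add_right spart_sspace\<close>)
  with assms(1) show ?thesis
    by (induction rule: homogeneous_induct) (auto simp: bracket_add_left assms)
qed

lemma bracket_minus_left [simp]: "x \<in> S \<Longrightarrow> y \<in> S \<Longrightarrow> (- x) \<bullet> y = - (x \<bullet> y)"
  using bracket_scale_left[of x y "- 1"] by simp

lemma bracket_minus_right [simp]: "x \<in> S \<Longrightarrow> y \<in> S \<Longrightarrow> x \<bullet> (- y) = - (x \<bullet> y)"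
  using bracket_scale_right[of x y "- 1"] by simp

lemma bracket_zero [simp]: "x \<in> S \<Longrightarrow> x \<bullet> 0 = 0" "x \<in> S \<Longrightarrow> 0 \<bullet> x = 0"
  using bracket_add_right[of x 0 0] bracket_add_left[of 0 0 x] by simp_all

lemma bracket_diff_right: "x \<in> S \<Longrightarrow> y \<in> S \<Longrightarrow> z \<in> S \<Longrightarrow> x \<bullet> (y - z) = x \<bullet> y - x \<bullet> z"
  using bracket_add_right[of x y "- z"] by simp

text \<open>
  The Jacobi identity and the identities derived from it are available for homogeneous elements only,
  so arguments about the derived algebra start from brackets of homogeneous elements.
\<close>

lemma span_brackets_homogeneous:
  assumes "x \<in> S" "y \<in> S"
  shows "x \<bullet> y \<in> span {u \<bullet> v |u v a b. u \<in> P a \<and> v \<in> P b}" (is "_ \<in> span ?B")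
proof -
  have *: "x \<bullet> y \<in> span ?B" if "x \<in> P a" for x a
    using assms(2)
  proof (induction rule: homogeneous_induct)
    case (homogeneous b y)
    then show ?case using that by (blast intro: span_base)
  next
    case (add y z)
    then show ?case using that by (simp add: bracket_add_right spart_sspace span_add)
  qed
  from assms(1) show ?thesis
  proof (induction rule: homogeneous_induct)
    case (add y z)
    then show ?case by (simp add: bracket_add_left assms(2) span_add)
  qed (rule *)
qed

text \<open>
  By skew-symmetry of the bracket, closure under left multiplication by homogeneous elements suffices;
  it is the decomposition of \<open>I\<close> into homogeneous parts that makes skew-symmetry applicable.
\<close>

lemma graded_idealI:
  assumes I: "I \<subseteq> S" "subspace I"
    and dec: "\<And>x. x \<in> I \<Longrightarrow> \<exists>y\<in>I \<inter> P 0. \<exists>z\<in>I \<inter> P 1. x = y + z"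
    and left: "\<And>a x y. x \<in> P a \<Longrightarrow> y \<in> I \<Longrightarrow> x \<bullet> y \<in> I"
  shows "graded_ideal L I"
proof -
  have left: "x \<bullet> y \<in> I" if "x \<in> S" "y \<in> I" for x y
    using that(1)
  proof (induction rule: homogeneous_induct)
    case (add x z)
    then show ?case using that(2) I by (simp add: bracket_add_left subset_iff subspace_add)
  qed (rule left[OF _ that(2)])
  have right: "y \<bullet> x \<in> I" if y: "y \<in> I" and "x \<in> S" for x y
  proof -
    have *: "y \<bullet> x \<in> I" if "y \<in> I" "y \<in> P a" for y a
      using \<open>x \<in> S\<close>
    proof (induction rule: homogeneous_induct)
      case (homogeneous b x)
      then show ?case
        unfolding bracket_skew[OF \<open>y \<in> P a\<close> homogeneous] using left[of x y] \<open>y \<in> I\<close> I(2)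
        by (simp add: spart_sspace subspace_neg subspace_scale)
    next
      case (add x z)
      then show ?case using \<open>y \<in> P a\<close> I(2) by (simp add: bracket_add_right subspace_add spart_sspace)
    qed
    obtain y0 y1 where "y0 \<in> I" "y0 \<in> P 0" "y1 \<in> I" "y1 \<in> P 1" "y = y0 + y1"
      using dec[OF y] by blast
    then show ?thesis using *[of y0 0] *[of y1 1] \<open>x \<in> S\<close> I(2)
      by (simp add: bracket_add_left subspace_add spart_sspace)
  qed
  show ?thesis
    unfolding graded_ideal_def by (intro conjI ballI dec I left right)
qed

text \<open>
  If \<open>y + z\<close> is central with \<open>y\<close>, \<open>z\<close> of different parity, then \<open>[u,y]\<close> and \<open>[u,z]\<close> are of different
  parity for homogeneous \<open>u\<close> and add up to zero, so each of them vanishes.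
\<close>

lemma graded_ideal_center: "graded_ideal L {z \<in> S. \<forall>x\<in>S. x \<bullet> z = 0}" (is "graded_ideal L ?Z")
proof -
  have hom: "y \<in> ?Z" if y: "y \<in> P a" and "\<And>b x. x \<in> P b \<Longrightarrow> x \<bullet> y = 0" for a y
  proof -
    have "x \<bullet> y = 0" if "x \<in> S" for x
      using that
    proof (induction rule: homogeneous_induct)
      case (add x z)
      then show ?case by (simp add: bracket_add_left spart_sspace[OF y])
    qed fact
    then show ?thesis using spart_sspace[OF \<open>y \<in> P a\<close>] by blast
  qed
  have dec: "\<exists>y\<in>?Z \<inter> P 0. \<exists>z\<in>?Z \<inter> P 1. x = y + z" if "x \<in> ?Z" for x
  proof -
    obtain y z where yz: "y \<in> P 0" "z \<in> P 1" "x = y + z"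
      using \<open>x \<in> ?Z\<close> homogeneous_cases by blast
    have *: "u \<bullet> y = 0 \<and> u \<bullet> z = 0" if "u \<in> P b" for u b
    proof -
      have "u \<bullet> y + u \<bullet> z = 0"
        using \<open>x \<in> ?Z\<close> yz that by (auto simp: spart_sspace simp flip: bracket_add_right)
      moreover have "u \<bullet> y \<in> P b" "u \<bullet> z \<in> P (b + 1)"
        using bracket_spart[OF that yz(1)] bracket_spart[OF that yz(2)] by (metis add.right_neutral)+
      ultimately show ?thesis using homogeneous_sum_zero by blast
    qed
    then have "y \<in> ?Z" "z \<in> ?Z" using hom yz by blast+
    then show ?thesis using yz by blast
  qed
  show ?thesis
  proof (rule graded_idealI[OF _ _ dec])
    show "subspace ?Z"
      by (rule subspaceI) (auto simp: bracket_add_right bracket_scale_right)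
  qed (auto simp: spart_sspace)
qed

lemma graded_ideal_derived: "graded_ideal L (span {x \<bullet> y |x y. x \<in> S \<and> y \<in> S})" (is "graded_ideal L (span ?B)")
proof -
  have sub: "span ?B \<subseteq> S"
    by (rule span_minimal[OF _ subspace_sspace]) auto
  have dec: "\<exists>y\<in>span ?B \<inter> P 0. \<exists>z\<in>span ?B \<inter> P 1. x = y + z" if "x \<in> span ?B" for x
  proof -
    let ?D = "{x. \<exists>y\<in>span ?B \<inter> P 0. \<exists>z\<in>span ?B \<inter> P 1. x = y + z}"
    have D: "subspace ?D"
    proof (rule subspaceI)
      show "0 \<in> ?D" by (auto intro: bexI[of _ 0] simp: span_zero)
    next
      fix x y assume "x \<in> ?D" "y \<in> ?D"
      then obtain x0 x1 y0 y1 where "x0 \<in> span ?B \<inter> P 0" "x1 \<in> span ?B \<inter> P 1" "x = x0 + x1"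
        "y0 \<in> span ?B \<inter> P 0" "y1 \<in> span ?B \<inter> P 1" "y = y0 + y1" by blast
      then have "x0 + y0 \<in> span ?B \<inter> P 0" "x1 + y1 \<in> span ?B \<inter> P 1" "x + y = (x0 + y0) + (x1 + y1)"
        by (simp_all add: span_add)
      then show "x + y \<in> ?D" by blast
    next
      fix c x assume "x \<in> ?D"
      then obtain x0 x1 where "x0 \<in> span ?B \<inter> P 0" "x1 \<in> span ?B \<inter> P 1" "x = x0 + x1" by blast
      then have "sscale L c x0 \<in> span ?B \<inter> P 0" "sscale L c x1 \<in> span ?B \<inter> P 1"
        "sscale L c x = sscale L c x0 + sscale L c x1"
        by (simp_all add: span_scale scale_right_distrib)
      then show "sscale L c x \<in> ?D" by blast
    qed
    have base: "u \<bullet> v \<in> ?D" if "u \<in> P a" "v \<in> P b" for u v a b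
    proof -
      have uv: "u \<bullet> v \<in> span ?B" using that by (intro span_base) (blast intro: spart_sspace)
      have p: "u \<bullet> v \<in> P (a + b)" by (rule bracket_spart[OF that])
      show ?thesis
      using bit_cases[of "a + b"]
      proof
        assume "a + b = 0"
        then have "u \<bullet> v \<in> span ?B \<inter> P 0" "0 \<in> span ?B \<inter> P 1" "u \<bullet> v = u \<bullet> v + 0"
          using uv p by (simp_all add: span_zero)
        then show ?thesis by blast
      next
        assume "a + b = 1"
        then have "u \<bullet> v \<in> span ?B \<inter> P 1" "0 \<in> span ?B \<inter> P 0" "u \<bullet> v = 0 + u \<bullet> v"
          using uv p by (simp_all add: span_zero)
        then show ?thesis by blast
      qed
    qed
    have "span {u \<bullet> v |u v a b. u \<in> P a \<and> v \<in> P b} \<subseteq> ?D"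
      using base by (intro span_minimal[OF _ D]) blast
    then have "?B \<subseteq> ?D"
      using span_brackets_homogeneous by blast
    then show ?thesis using span_minimal[OF _ D] that by blast
  qed
  have "x \<bullet> y \<in> span ?B" "y \<bullet> x \<in> span ?B" if "x \<in> S" "y \<in> span ?B" for x y
    using that sub by (blast intro: span_base)+
  then show ?thesis
    unfolding graded_ideal_def by (intro conjI ballI dec sub subspace_span)
qed

text \<open>
  The derived algebra and the center are graded ideals; a bracket being nonzero, the former cannot be
  zero and the latter cannot be everything.
\<close>

lemma simple_perfect:
  assumes "simple_superalgebra L"
  shows "span {u \<bullet> v |u v a b. u \<in> P a \<and> v \<in> P b} = S"
proof
  show "span {u \<bullet> v |u v a b. u \<in> P a \<and> v \<in> P b} \<subseteq> S"
    by (rule span_minimal[OF _ subspace_sspace]) (auto dest!: spart_sspace)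
next
  let ?B = "{x \<bullet> y |x y. x \<in> S \<and> y \<in> S}"
  obtain x y where "x \<in> S" "y \<in> S" "x \<bullet> y \<noteq> 0"
    using assms by (auto simp: simple_superalgebra_def)
  then have "span ?B \<noteq> {0}" using span_base[of "x \<bullet> y" ?B] by auto
  then have "span ?B = S"
    using assms graded_ideal_derived by (auto simp: simple_superalgebra_def)
  moreover have "span ?B \<subseteq> span {u \<bullet> v |u v a b. u \<in> P a \<and> v \<in> P b}"
    using span_brackets_homogeneous by (intro span_minimal subspace_span) blast
  ultimately show "S \<subseteq> span {u \<bullet> v |u v a b. u \<in> P a \<and> v \<in> P b}" by simp
qed

lemma simple_centerless:
  assumes "simple_superalgebra L" and "z \<in> S" and "\<And>a x. x \<in> P a \<Longrightarrow> x \<bullet> z = 0"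
  shows "z = 0"
proof -
  have z: "x \<bullet> z = 0" if "x \<in> S" for x
    using that
  proof (induction rule: homogeneous_induct)
    case (add x y)
    then show ?case by (simp add: bracket_add_left assms(2))
  qed (rule assms(3))
  let ?Z = "{z \<in> S. \<forall>x\<in>S. x \<bullet> z = 0}"
  obtain x y where "x \<in> S" "y \<in> S" "x \<bullet> y \<noteq> 0"
    using assms by (auto simp: simple_superalgebra_def)
  then have "?Z \<noteq> S" by blast
  then have "?Z = {0}"
    using assms(1) graded_ideal_center unfolding simple_superalgebra_def by meson
  then show ?thesis using z assms(2) by blast
qed

end

section \<open>Skew-symmetric super-biderivations of a simple superalgebra\<close>

text \<open>
  The signs of a super-biderivation follow the Koszul rule if \<open>\<phi>\<close>, of parity \<open>g\<close>, is thought of as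
  written between its two arguments: \<open>\<phi>(x,y)\<close> stands for \<open>x \<phi> y\<close>. This convention explains the
  exponents in all identities below: each term carries the sign of the permutation that brings its
  letters into the order of the reference term.
\<close>

locale skew_biderivation = lie_superalgebra L
  for L :: "('f::field, 'v::ab_group_add) superalgebra" +
  fixes \<phi> :: "'v \<times> 'v \<Rightarrow> 'v" and g :: bit
  assumes bider: "\<phi> \<in> BDer_deg L g"
    and char_not_2: "(2::'f) \<noteq> 0"
    and simple: "simple_superalgebra L"
begin

lemmas perfect = simple_perfect[OF simple]
lemmas centerless = simple_centerless[OF simple]

lemma double_zero: "x + x = 0 \<Longrightarrow> x = (0::'v)"
proof -
  assume "x + x = 0"
  then have "sscale L 2 x = 0" using scale_left_distrib[of 1 1 x] by simp
  then show ?thesis using char_not_2 by (simp add: scale_eq_0_iff)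
qed

lemma phi_bilinear: "\<phi> \<in> bilinear_maps L" and phi_homogeneous: "homogeneous_map L g \<phi>"
  using bider unfolding BDer_deg_def by simp_all

lemma phi_S [simp]: "x \<in> S \<Longrightarrow> y \<in> S \<Longrightarrow> \<phi> (x, y) \<in> S"
  using phi_bilinear by (auto simp: bilinear_maps_def)

lemma phi_P: "x \<in> P a \<Longrightarrow> y \<in> P b \<Longrightarrow> \<phi> (x, y) \<in> P (a + b + g)"
  using phi_homogeneous unfolding homogeneous_map_def by blast

lemma phi_add:
  "x \<in> S \<Longrightarrow> y \<in> S \<Longrightarrow> z \<in> S \<Longrightarrow> \<phi> (x + y, z) = \<phi> (x, z) + \<phi> (y, z)"
  "x \<in> S \<Longrightarrow> y \<in> S \<Longrightarrow> z \<in> S \<Longrightarrow> \<phi> (x, y + z) = \<phi> (x, y) + \<phi> (x, z)"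
  using phi_bilinear unfolding bilinear_maps_def by blast+

lemma phi_scale:
  "x \<in> S \<Longrightarrow> y \<in> S \<Longrightarrow> \<phi> (sscale L k x, y) = sscale L k (\<phi> (x, y))"
  "x \<in> S \<Longrightarrow> y \<in> S \<Longrightarrow> \<phi> (x, sscale L k y) = sscale L k (\<phi> (x, y))"
  using phi_bilinear unfolding bilinear_maps_def by blast+

lemma phi_der:
  assumes "x \<in> P a" "y \<in> P b" "z \<in> S"
  shows "\<phi> (x, y \<bullet> z) = \<phi> (x, y) \<bullet> z + sscale L (sg ((g + a) * b)) (y \<bullet> \<phi> (x, z))"
  using bider assms unfolding BDer_deg_def by blast

lemma phi_skew:
  assumes "x \<in> P a" "y \<in> P b"
  shows "\<phi> (x, y) = - sscale L (sg (g * a + g * b + a * b)) (\<phi> (y, x))"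
  using bider assms unfolding BDer_deg_def by blast

lemma phi_der_left:
  assumes "x \<in> P a" "y \<in> P b" "z \<in> P c"
  shows "\<phi> (x \<bullet> y, z) = x \<bullet> \<phi> (y, z) + sscale L (sg (b * (g + c))) (\<phi> (x, z) \<bullet> y)"
proof -
  note S = assms[THEN spart_sspace]
  show ?thesis
    unfolding phi_skew[OF bracket_spart[OF assms(1,2)] assms(3)] phi_der[OF assms(3,1) S(2)]
      phi_skew[OF assms(3,1)] phi_skew[OF assms(3,2)]
    using bit_cases[of a] bit_cases[of b] bit_cases[of c] bit_cases[of g]
    by (elim disjE) (simp_all add: S)
qed

text \<open>
  Expanding \<open>\<phi>([x,u],[y,v])\<close> first in the left and then in the right argument, or the other way
  round, gives two sums whose difference the Jacobi identity collapses to these four terms. The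
  reference order of the letters is \<open>x u \<phi> y v\<close>.
\<close>

lemma phi_exchange:
  assumes x: "x \<in> P a" and y: "y \<in> P b" and u: "u \<in> P c" and v: "v \<in> P d"
  shows "sscale L (sg (a * (c + g + b))) (\<phi> (u, y) \<bullet> (x \<bullet> v))
    + sscale L (sg (b * (c + g))) ((x \<bullet> y) \<bullet> \<phi> (u, v))
    + sscale L (sg (c * (g + b + d))) (\<phi> (x, y) \<bullet> (v \<bullet> u))
    - sscale L (sg (c * (g + b + d) + b * d)) (\<phi> (x, v) \<bullet> (y \<bullet> u)) = 0" (is "?E = 0")
proof -
  note S = x[THEN spart_sspace] y[THEN spart_sspace] u[THEN spart_sspace] v[THEN spart_sspace]
  note xu = bracket_spart[OF x u] and yv = bracket_spart[OF y v]
  have E1: "\<phi> (x \<bullet> u, y \<bullet> v) =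
      x \<bullet> (\<phi> (u, y) \<bullet> v + sscale L (sg ((g + c) * b)) (y \<bullet> \<phi> (u, v)))
    + sscale L (sg (c * (g + (b + d)))) ((\<phi> (x, y) \<bullet> v + sscale L (sg ((g + a) * b)) (y \<bullet> \<phi> (x, v))) \<bullet> u)"
    unfolding phi_der_left[OF x u yv] phi_der[OF x y S(4)] phi_der[OF u y S(4)] by simp
  have E2: "\<phi> (x \<bullet> u, y \<bullet> v) =
      (x \<bullet> \<phi> (u, y) + sscale L (sg (c * (g + b))) (\<phi> (x, y) \<bullet> u)) \<bullet> v
    + sscale L (sg ((g + (a + c)) * b)) (y \<bullet> (x \<bullet> \<phi> (u, v) + sscale L (sg (c * (g + d))) (\<phi> (x, v) \<bullet> u)))"
    unfolding phi_der[OF xu y S(4)] phi_der_left[OF x u y] phi_der_left[OF x u v] by simp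
  note J1 = jacobi[OF x phi_P[OF u y] v]
  note J2 = jacobi[OF x y phi_P[OF u v]]
  note J3 = jacobi[OF phi_P[OF x y] v u]
  \<comment> \<open>Turns the outer bracket in the last term of \<open>J3\<close> around, as both nested forms occur otherwise.\<close>
  note J3' = bracket_skew[OF v bracket_spart[OF phi_P[OF x y] u]]
  note J4 = jacobi[OF y phi_P[OF x v] u]
  let ?L = "x \<bullet> (\<phi> (u, y) \<bullet> v + sscale L (sg ((g + c) * b)) (y \<bullet> \<phi> (u, v)))
    + sscale L (sg (c * (g + (b + d)))) ((\<phi> (x, y) \<bullet> v + sscale L (sg ((g + a) * b)) (y \<bullet> \<phi> (x, v))) \<bullet> u)"
  let ?R = "(x \<bullet> \<phi> (u, y) + sscale L (sg (c * (g + b))) (\<phi> (x, y) \<bullet> u)) \<bullet> v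
    + sscale L (sg ((g + (a + c)) * b)) (y \<bullet> (x \<bullet> \<phi> (u, v) + sscale L (sg (c * (g + d))) (\<phi> (x, v) \<bullet> u)))"
  have "?E = ?L - ?R"
    using bit_cases[of a] bit_cases[of b] bit_cases[of c] bit_cases[of d] bit_cases[of g] J1 J2 J3 J3' J4
    apply (elim disjE)
    apply (simp_all only: S sspace_closed phi_S bracket_sspace bracket_minus_left bracket_minus_right
        bracket_add_left bracket_add_right sg_simps scale_one scale_minus_left mult_zero_left
        mult_zero_right mult_1_left add_0_left add_0_right bit_add_self)
    apply (simp_all add: algebra_simps S)
    done
  then show ?thesis using E1 E2 by simp
qed

lemma sscale_sg_sg: "sscale L (sg e) (sscale L (sg e') x) = sscale L (sg (e + e')) x"
  by (simp add: sg_mult)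

text \<open>
  Without signs: the defect \<open>N(x,y,u,v) = [[x,y],\<phi>(u,v)] - [\<phi>(x,y),[u,v]]\<close> is skew under exchanging
  \<open>x\<close> and \<open>y\<close> and under exchanging \<open>u\<close> and \<open>v\<close>, whereas \<open>phi_exchange\<close> says that it is symmetric under
  exchanging \<open>y\<close> and \<open>v\<close>. A one-dimensional character of the symmetric group takes the same value on
  all transpositions, so \<open>N = - N\<close> and \<open>N = 0\<close> as the characteristic is not \<open>2\<close>.
\<close>

lemma phi_bracket_commute:
  assumes x: "x \<in> P a" and y: "y \<in> P b" and u: "u \<in> P c" and v: "v \<in> P d"
  shows "\<phi> (x, y) \<bullet> (u \<bullet> v) = sscale L (sg (g * (b + c))) ((x \<bullet> y) \<bullet> \<phi> (u, v))"
proof -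
  \<comment> \<open>The extra signs move \<open>\<phi>\<close> to the front of all four arguments, so that it does not interfere with
    the exchanges of arguments.\<close>
  define N where "N a b c x y u v =
    sscale L (sg (g * (a + b + c))) ((x \<bullet> y) \<bullet> \<phi> (u, v)) - sscale L (sg (g * a)) (\<phi> (x, y) \<bullet> (u \<bullet> v))"
    for a b c x y u v
  have N12: "N b a c y x u v = - sscale L (sg (a * b)) (N a b c x y u v)"
    if h: "x \<in> P a" "y \<in> P b" "u \<in> P c" "v \<in> P d" for a b c d x y u v
  proof -
    note S = h[THEN spart_sspace]
    show ?thesis
      unfolding N_def bracket_skew[OF h(2,1)] phi_skew[OF h(2,1)]
      using bit_cases[of a] bit_cases[of b] bit_cases[of c] bit_cases[of g]
      by (elim disjE) (simp_all add: S)
  qed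
  have N34: "N a b d x y v u = - sscale L (sg (c * d)) (N a b c x y u v)"
    if h: "x \<in> P a" "y \<in> P b" "u \<in> P c" "v \<in> P d" for a b c d x y u v
  proof -
    note S = h[THEN spart_sspace]
    show ?thesis
      unfolding N_def bracket_skew[OF h(4,3)] phi_skew[OF h(4,3)]
      using bit_cases[of a] bit_cases[of b] bit_cases[of c] bit_cases[of d] bit_cases[of g]
      by (elim disjE) (simp_all add: S)
  qed
  have N24: "N a d c x v u y = sscale L (sg (b * c + b * d + c * d)) (N a b c x y u v)"
    if h: "x \<in> P a" "y \<in> P b" "u \<in> P c" "v \<in> P d" for a b c d x y u v
  proof -
    note S = h[THEN spart_sspace]
    let ?t1 = "\<phi> (u, y) \<bullet> (x \<bullet> v)" and ?t2 = "(x \<bullet> y) \<bullet> \<phi> (u, v)"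
      and ?t3 = "\<phi> (x, y) \<bullet> (u \<bullet> v)" and ?t4 = "\<phi> (x, v) \<bullet> (u \<bullet> y)"
    have e1: "(x \<bullet> v) \<bullet> \<phi> (u, y) = - sscale L (sg ((a + d) * (c + b + g))) ?t1"
      using bracket_skew[OF bracket_spart[OF h(1,4)] phi_P[OF h(3,2)]] by simp
    have e3: "\<phi> (x, y) \<bullet> (v \<bullet> u) = - sscale L (sg (c * d)) ?t3"
      unfolding bracket_skew[OF h(4,3)] by (simp add: S bracket_scale_right mult.commute)
    have e4: "\<phi> (x, v) \<bullet> (y \<bullet> u) = - sscale L (sg (b * c)) ?t4"
      unfolding bracket_skew[OF h(2,3)] by (simp add: S bracket_scale_right mult.commute)
    have e: "sscale L (sg (g * (a + d + c))) (- sscale L (sg ((a + d) * (c + b + g))) t1) - sscale L (sg (g * a)) t4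
      - sscale L (sg (b * c + b * d + c * d)) (sscale L (sg (g * (a + b + c))) t2 - sscale L (sg (g * a)) t3)
      = - sscale L (sg (b * d + d * (c + g) + g * (a + d + c)))
        (sscale L (sg (a * (c + g + b))) t1 + sscale L (sg (b * (c + g))) t2
        + sscale L (sg (c * (g + b + d))) (- sscale L (sg (c * d)) t3)
        - sscale L (sg (c * (g + b + d) + b * d)) (- sscale L (sg (b * c)) t4))" for t1 t2 t3 t4
      using bit_cases[of a] bit_cases[of b] bit_cases[of c] bit_cases[of d] bit_cases[of g]
      by (elim disjE) simp_all
    have "N a d c x v u y - sscale L (sg (b * c + b * d + c * d)) (N a b c x y u v) = 0"
      unfolding N_def e1 e using phi_exchange[OF h, unfolded e3 e4] by simp
    then show ?thesis by simp
  qed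
  have N23: "N a c b x u y v = sscale L (sg (b * c)) (N a b c x y u v)"
    if h: "x \<in> P a" "y \<in> P b" "u \<in> P c" "v \<in> P d" for a b c d x y u v
    unfolding N34[OF h(1,3,4,2)] N24[OF h(1,2,4,3)] N34[OF h(1,2,3,4)]
    using bit_cases[of b] bit_cases[of c] bit_cases[of d]
    by (elim disjE) (simp_all add: algebra_simps)
  \<comment> \<open>The exchange of \<open>x\<close> and \<open>u\<close> is a product of adjacent exchanges in two ways.\<close>
  have p: "N c b a u y x v = sscale L (sg (a * b + a * c + b * c)) (N a b c x y u v)"
    unfolding N12[OF y u x v] N23[OF y x u v] N12[OF x y u v]
    using bit_cases[of a] bit_cases[of b] bit_cases[of c]
    by (elim disjE) (simp_all add: algebra_simps)
  have q: "N c b a u y x v = - sscale L (sg (a * b + a * c + b * c)) (N a b c x y u v)"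
    unfolding N23[OF u x y v] N12[OF x u y v] N23[OF x y u v]
    using bit_cases[of a] bit_cases[of b] bit_cases[of c]
    by (elim disjE) (simp_all add: algebra_simps)
  from p q have "N c b a u y x v + N c b a u y x v = 0"
    by (metis add.right_inverse)
  then have "N c b a u y x v = 0" by (rule double_zero)
  then have "N a b c x y u v = 0"
    unfolding p by (simp add: scale_eq_0_iff sg_def split: if_splits)
  then have "sscale L (sg (g * (a + b + c))) ((x \<bullet> y) \<bullet> \<phi> (u, v)) = sscale L (sg (g * a)) (\<phi> (x, y) \<bullet> (u \<bullet> v))"
    by (simp add: N_def)
  then have "sscale L (sg (g * a)) (sscale L (sg (g * (a + b + c))) ((x \<bullet> y) \<bullet> \<phi> (u, v)))
    = sscale L (sg (g * a)) (sscale L (sg (g * a)) (\<phi> (x, y) \<bullet> (u \<bullet> v)))"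
    by simp
  then show ?thesis
    unfolding sscale_sg_sg
    using bit_cases[of a] bit_cases[of b] bit_cases[of c] bit_cases[of g]
    by (elim disjE) simp_all
qed

text \<open>
  By the derivation rule, the cyclic sum of the \<open>\<phi>(x,[y,z])\<close> is twice the cyclic sum in question.
  By \<open>phi_bracket_commute\<close>, its bracket with \<open>[u,v]\<close> is the bracket of the Jacobi sum of \<open>x\<close>, \<open>y\<close>, \<open>z\<close>
  with \<open>\<phi>(u,v)\<close>, that is zero; and an element annihilated by all \<open>[u,v]\<close> vanishes in a perfect algebra
  with trivial center.
\<close>

lemma phi_cyclic:
  assumes x: "x \<in> P a" and y: "y \<in> P b" and z: "z \<in> P c"
  shows "\<phi> (x, y) \<bullet> z + sscale L (sg (a * (g + b + c) + g * b)) (\<phi> (y, z) \<bullet> x)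
    + sscale L (sg (c * (a + g + b) + g * a)) (\<phi> (z, x) \<bullet> y) = 0" (is "?C = 0")
proof -
  note S = x[THEN spart_sspace] y[THEN spart_sspace] z[THEN spart_sspace]
  let ?s2 = "sg (a * (g + b + c) + g * b) :: 'f" and ?s3 = "sg (c * (a + g + b) + g * a) :: 'f"
  have J: "\<phi> (x, y \<bullet> z) = \<phi> (x, y) \<bullet> z + sscale L (sg (c * (a + g + b) + g * a)) (\<phi> (z, x) \<bullet> y)"
    if h: "x \<in> P a" "y \<in> P b" "z \<in> P c" for x y z a b c
  proof -
    note S = h[THEN spart_sspace]
    show ?thesis
      unfolding phi_der[OF h(1,2) S(3)] phi_skew[OF h(1,3)]
      using bracket_skew[OF h(2) phi_P[OF h(3,1)]]
        bit_cases[of a] bit_cases[of b] bit_cases[of c] bit_cases[of g]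
      by (elim disjE) (simp_all add: S)
  qed
  let ?J = "\<phi> (x, y \<bullet> z) + sscale L ?s2 (\<phi> (y, z \<bullet> x)) + sscale L ?s3 (\<phi> (z, x \<bullet> y))"
  have "?J = ?C + ?C"
    unfolding J[OF x y z] J[OF y z x] J[OF z x y]
    using bit_cases[of a] bit_cases[of b] bit_cases[of c] bit_cases[of g]
    by (elim disjE) (simp_all add: S)
  moreover have "?J = 0"
  proof (rule centerless)
    show JS: "?J \<in> S" by (simp add: S)
    have cyc: "x \<bullet> (y \<bullet> z) + sscale L (sg (a * (b + c))) (y \<bullet> (z \<bullet> x)) + sscale L (sg (c * (a + b))) (z \<bullet> (x \<bullet> y)) = 0"
      unfolding jacobi[OF x y z] bracket_skew[OF z x] bracket_skew[OF bracket_spart[OF x y] z]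
      using bit_cases[of a] bit_cases[of b] bit_cases[of c]
      by (elim disjE) (simp_all add: S)
    have B: "?J \<bullet> (u \<bullet> v) = 0" if uv: "u \<in> P d" "v \<in> P e" for u v d e
    proof -
      note S' = S uv[THEN spart_sspace]
      have "?J \<bullet> (u \<bullet> v) = \<phi> (x, y \<bullet> z) \<bullet> (u \<bullet> v) + sscale L ?s2 (\<phi> (y, z \<bullet> x) \<bullet> (u \<bullet> v))
        + sscale L ?s3 (\<phi> (z, x \<bullet> y) \<bullet> (u \<bullet> v))"
        by (simp only: S' bracket_add_left bracket_scale_left sspace_closed phi_S bracket_sspace)
      also have "\<dots> = sscale L (sg (g * (b + c + d)))
        ((x \<bullet> (y \<bullet> z)) \<bullet> \<phi> (u, v) + sscale L (sg (a * (b + c))) ((y \<bullet> (z \<bullet> x)) \<bullet> \<phi> (u, v))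
        + sscale L (sg (c * (a + b))) ((z \<bullet> (x \<bullet> y)) \<bullet> \<phi> (u, v)))"
        unfolding phi_bracket_commute[OF x bracket_spart[OF y z] uv]
          phi_bracket_commute[OF y bracket_spart[OF z x] uv] phi_bracket_commute[OF z bracket_spart[OF x y] uv]
        using bit_cases[of a] bit_cases[of b] bit_cases[of c] bit_cases[of d] bit_cases[of g]
        by (elim disjE) simp_all
      also have "\<dots> = sscale L (sg (g * (b + c + d)))
        ((x \<bullet> (y \<bullet> z) + sscale L (sg (a * (b + c))) (y \<bullet> (z \<bullet> x)) + sscale L (sg (c * (a + b))) (z \<bullet> (x \<bullet> y))) \<bullet> \<phi> (u, v))"
        by (simp only: S' bracket_add_left bracket_scale_left sspace_closed phi_S bracket_sspace)
      finally have "?J \<bullet> (u \<bullet> v) = \<dots>" .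
      then show ?thesis unfolding cyc by (simp add: S')
    qed
    have sub: "subspace {w \<in> S. ?J \<bullet> w = 0}"
      using JS by (intro subspaceI) (simp_all add: bracket_add_right bracket_scale_right del: phi_S)
    have "{u \<bullet> v |u v d e. u \<in> P d \<and> v \<in> P e} \<subseteq> {w \<in> S. ?J \<bullet> w = 0}"
      using B spart_sspace bracket_sspace by blast
    then have "span {u \<bullet> v |u v d e. u \<in> P d \<and> v \<in> P e} \<subseteq> {w \<in> S. ?J \<bullet> w = 0}"
      using sub by (rule span_minimal)
    then have JB: "?J \<bullet> w = 0" if "w \<in> S" for w
      using that unfolding perfect by blast
    have JP: "?J \<in> P (a + b + c + g)"
      using phi_P[OF x bracket_spart[OF y z]] phi_P[OF y bracket_spart[OF z x]] phi_P[OF z bracket_spart[OF x y]]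
      by (intro spart_closed) (simp_all only: ac_simps)
    show "w \<bullet> ?J = 0" if "w \<in> P d" for w d
      unfolding bracket_skew[OF that JP] JB[OF spart_sspace[OF that]] by (simp only: scale_zero_right minus_zero)
  qed
  ultimately show ?thesis using double_zero[of ?C] by simp
qed

text \<open>
  The two terms of the derivation rule for \<open>\<phi>(x,[y,z])\<close> are two of the three terms of the cyclic sum,
  so they add up to minus the third one.
\<close>

lemma phi_bracket_right:
  assumes x: "x \<in> P a" and y: "y \<in> P b" and z: "z \<in> P c"
  shows "\<phi> (x, y \<bullet> z) = sscale L (sg (g * b)) (x \<bullet> \<phi> (y, z))"
proof -
  note S = x[THEN spart_sspace] y[THEN spart_sspace] z[THEN spart_sspace]
  have "\<phi> (x, y) \<bullet> z + sscale L (sg (c * (a + g + b) + g * a)) (\<phi> (z, x) \<bullet> y)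
      = - sscale L (sg (a * (g + b + c) + g * b)) (\<phi> (y, z) \<bullet> x)"
    using phi_cyclic[OF x y z] by (simp only: eq_neg_iff_add_eq_0 ac_simps)
  moreover have "\<phi> (x, y) \<bullet> z + sscale L (sg ((g + a) * b)) (y \<bullet> \<phi> (x, z)) =
      \<phi> (x, y) \<bullet> z + sscale L (sg (c * (a + g + b) + g * a)) (\<phi> (z, x) \<bullet> y)"
    unfolding phi_skew[OF x z]
    using bracket_skew[OF y phi_P[OF z x]]
      bit_cases[of a] bit_cases[of b] bit_cases[of c] bit_cases[of g]
    by (elim disjE) (simp_all add: S)
  moreover have "- sscale L (sg (a * (g + b + c) + g * b)) (\<phi> (y, z) \<bullet> x) = sscale L (sg (g * b)) (x \<bullet> \<phi> (y, z))"
    unfolding bracket_skew[OF x phi_P[OF y z]]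
    using bit_cases[of a] bit_cases[of b] bit_cases[of c] bit_cases[of g]
    by (elim disjE) (simp_all add: S)
  ultimately show ?thesis
    unfolding phi_der[OF x y S(3)] by simp
qed

lemma bracket_right_cancel:
  assumes "r \<in> S" "r' \<in> S" "\<And>a x. x \<in> P a \<Longrightarrow> x \<bullet> r = x \<bullet> r'"
  shows "r = r'"
proof -
  have "r - r' = 0"
  proof (rule centerless)
    show "x \<bullet> (r - r') = 0" if "x \<in> P a" for x a
      using assms(3)[OF that] assms(1,2) spart_sspace[OF that] by (simp add: bracket_diff_right)
  qed (use assms in simp)
  then show ?thesis by simp
qed

text \<open>
  By \<open>phi_bracket_right\<close> this holds for \<open>w\<close> a bracket, with \<open>r\<close> a multiple of \<open>\<phi>(y,z)\<close>, and the brackets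
  span. Existence is all that is needed: \<open>r\<close> is unique since the center is trivial, so that no check
  of well-definedness on a spanning set arises.
\<close>

lemma phi_factor_exists:
  assumes "w \<in> S"
  shows "\<exists>r\<in>S. \<forall>x\<in>S. \<phi> (x, w) = x \<bullet> r"
proof -
  let ?T = "{w \<in> S. \<exists>r\<in>S. \<forall>x\<in>S. \<phi> (x, w) = x \<bullet> r}"
  have "y \<bullet> z \<in> ?T" if yz: "y \<in> P b" "z \<in> P c" for y z b c
  proof -
    let ?r = "sscale L (sg (g * b)) (\<phi> (y, z))"
    note S = yz[THEN spart_sspace]
    have "\<phi> (x, y \<bullet> z) = x \<bullet> ?r" if "x \<in> S" for x
      using that
    proof (induction rule: homogeneous_induct)
      case (homogeneous a x)
      then show ?case
        using phi_bracket_right[OF homogeneous yz] S by (simp add: bracket_scale_right spart_sspace)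
    next
      case (add x x')
      then show ?case using S by (simp add: phi_add bracket_add_left)
    qed
    moreover have "?r \<in> S" using S by simp
    ultimately show ?thesis
      by (intro CollectI conjI bexI[of _ ?r] ballI bracket_sspace S)
  qed
  then have "{y \<bullet> z |y z b c. y \<in> P b \<and> z \<in> P c} \<subseteq> ?T" by blast
  moreover have "subspace ?T"
  proof (rule subspaceI)
    have "\<phi> (x, 0) = x \<bullet> 0" if "x \<in> S" for x
      using phi_scale(2)[OF that sspace_closed(1), of 0] that by simp
    then show "0 \<in> ?T" using sspace_closed(1) by blast
  next
    fix w w' assume "w \<in> ?T" "w' \<in> ?T"
    then obtain r r' where r: "w \<in> S" "w' \<in> S" "r \<in> S" "r' \<in> S"
      "\<forall>x\<in>S. \<phi> (x, w) = x \<bullet> r" "\<forall>x\<in>S. \<phi> (x, w') = x \<bullet> r'" by blast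
    then have "\<forall>x\<in>S. \<phi> (x, w + w') = x \<bullet> (r + r')" by (simp add: phi_add bracket_add_right)
    then show "w + w' \<in> ?T"
      by (intro CollectI conjI bexI[of _ "r + r'"] sspace_closed r)
  next
    fix k w assume "w \<in> ?T"
    then obtain r where r: "w \<in> S" "r \<in> S" "\<forall>x\<in>S. \<phi> (x, w) = x \<bullet> r" by blast
    then have "\<forall>x\<in>S. \<phi> (x, sscale L k w) = x \<bullet> sscale L k r" by (simp add: phi_scale bracket_scale_right)
    then show "sscale L k w \<in> ?T"
      by (intro CollectI conjI bexI[of _ "sscale L k r"] sspace_closed r)
  qed
  ultimately have "span {y \<bullet> z |y z b c. y \<in> P b \<and> z \<in> P c} \<subseteq> ?T" by (rule span_minimal)
  then show ?thesis using assms unfolding perfect by blast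
qed

definition \<gamma> where "\<gamma> w = (SOME r. r \<in> S \<and> (\<forall>x\<in>S. \<phi> (x, w) = x \<bullet> r))"

lemma gamma_S [simp]: "w \<in> S \<Longrightarrow> \<gamma> w \<in> S"
  and phi_gamma: "x \<in> S \<Longrightarrow> w \<in> S \<Longrightarrow> \<phi> (x, w) = x \<bullet> \<gamma> w"
proof -
  have *: "\<gamma> w \<in> S \<and> (\<forall>x\<in>S. \<phi> (x, w) = x \<bullet> \<gamma> w)" if "w \<in> S" for w
    unfolding \<gamma>_def by (rule someI_ex) (rule phi_factor_exists[OF that, unfolded Bex_def])
  show "w \<in> S \<Longrightarrow> \<gamma> w \<in> S" "x \<in> S \<Longrightarrow> w \<in> S \<Longrightarrow> \<phi> (x, w) = x \<bullet> \<gamma> w"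
    using * by blast+
qed

lemma gamma_unique:
  assumes "w \<in> S" "r \<in> S" "\<And>a x. x \<in> P a \<Longrightarrow> \<phi> (x, w) = x \<bullet> r"
  shows "\<gamma> w = r"
proof (rule bracket_right_cancel)
  show "x \<bullet> \<gamma> w = x \<bullet> r" if "x \<in> P a" for x a
    using assms(3)[OF that] phi_gamma[OF spart_sspace[OF that] assms(1)] by simp
qed (use assms in simp_all)

lemma gamma_add: "v \<in> S \<Longrightarrow> w \<in> S \<Longrightarrow> \<gamma> (v + w) = \<gamma> v + \<gamma> w"
  by (rule gamma_unique) (simp_all add: phi_add bracket_add_right spart_sspace flip: phi_gamma)

lemma gamma_scale: "w \<in> S \<Longrightarrow> \<gamma> (sscale L k w) = sscale L k (\<gamma> w)"
  by (rule gamma_unique) (simp_all add: phi_scale bracket_scale_right spart_sspace flip: phi_gamma)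

lemma gamma_minus: "w \<in> S \<Longrightarrow> \<gamma> (- w) = - \<gamma> w"
  using gamma_scale[of w "- 1"] by simp

lemma gamma_homogeneous:
  assumes "w \<in> P b"
  shows "\<gamma> w \<in> P (b + g)"
proof -
  have S: "w \<in> S" "\<gamma> w \<in> S" using assms by (simp_all add: spart_sspace)
  obtain r0 r1 where r: "r0 \<in> P (b + g)" "r1 \<in> P (b + g + 1)" "\<gamma> w = r0 + r1"
    using homogeneous_cases[OF S(2)] bit_cases[of "b + g"] by (metis add.commute add_0 bit_add_self)
  note rS = r(1,2)[THEN spart_sspace]
  have "\<gamma> w = r0"
  proof (rule bracket_right_cancel)
    show "x \<bullet> \<gamma> w = x \<bullet> r0" if "x \<in> P a" for x a
    proof -
      have e: "x \<bullet> \<gamma> w = x \<bullet> r0 + x \<bullet> r1"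
        unfolding r(3) using rS spart_sspace[OF that] by (simp add: bracket_add_right)
      have m: "x \<bullet> \<gamma> w \<in> P (a + b + g)"
        using phi_P[OF that assms] phi_gamma[OF spart_sspace[OF that] S(1)] by simp
      have m0: "x \<bullet> r0 \<in> P (a + b + g)" and m1: "x \<bullet> r1 \<in> P (a + b + g + 1)"
        using bracket_spart[OF that r(1)] bracket_spart[OF that r(2)] by (simp_all only: ac_simps)
      have "(x \<bullet> r0 - x \<bullet> \<gamma> w) + x \<bullet> r1 = 0" using e by simp
      from homogeneous_sum_zero(2)[OF spart_closed(3)[OF m0 m] m1 this] have "x \<bullet> r1 = 0" .
      then show ?thesis using e by simp
    qed
  qed (use rS S in simp_all)
  then show ?thesis using r(1) by simp
qed

text \<open>
  Together with \<open>gamma_swap\<close> this says that \<open>\<gamma>\<close> belongs to the supercentroid: up to the sign for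
  passing \<open>y\<close>, it commutes with all left and right multiplications.
\<close>

lemma gamma_bracket:
  assumes "y \<in> P b" "z \<in> S"
  shows "\<gamma> (y \<bullet> z) = sscale L (sg (g * b)) (y \<bullet> \<gamma> z)"
  using assms(2)
proof (induction rule: homogeneous_induct)
  case (homogeneous c z)
  note S = spart_sspace[OF assms(1)] spart_sspace[OF homogeneous]
  show ?case
    by (rule gamma_unique)
      (simp_all add: S phi_bracket_right[OF _ assms(1) homogeneous] bracket_scale_right spart_sspace flip: phi_gamma)
next
  case (add z z')
  then show ?case using spart_sspace[OF assms(1)]
    by (simp add: bracket_add_right gamma_add scale_right_distrib)
qed

lemma gamma_swap:
  assumes "x \<in> P a" "w \<in> P b"
  shows "x \<bullet> \<gamma> w = sscale L (sg (g * a)) (\<gamma> x \<bullet> w)"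
proof -
  note S = assms[THEN spart_sspace]
  show ?thesis
    using phi_skew[OF assms] bracket_skew[OF assms(2) gamma_homogeneous[OF assms(1)]]
      bit_cases[of a] bit_cases[of b] bit_cases[of g]
    unfolding phi_gamma[OF S] phi_gamma[OF S(2,1)]
    by (elim disjE) simp_all
qed

text \<open>
  Schur's lemma. The eigenspace is graded if \<open>\<gamma>\<close> is even, and also if \<open>k = 0\<close>, because kernels of
  homogeneous maps are graded; both cases are needed.
\<close>

lemma gamma_eigenspace:
  assumes k: "g = 0 \<or> k = 0" and v: "v \<in> S" "v \<noteq> 0" "\<gamma> v = sscale L k v"
  shows "\<forall>x\<in>S. \<gamma> x = sscale L k x"
proof -
  let ?K = "{x \<in> S. \<gamma> x = sscale L k x}"
  have "graded_ideal L ?K"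
  proof (rule graded_idealI)
    have "\<gamma> 0 = 0" using gamma_scale[of 0 0] by simp
    then show "subspace ?K"
      by (intro subspaceI) (simp_all add: gamma_add gamma_scale scale_right_distrib mult.commute)
  next
    fix x assume x: "x \<in> ?K"
    then obtain y z where yz: "y \<in> P 0" "z \<in> P 1" "x = y + z" using homogeneous_cases by blast
    note S = yz(1,2)[THEN spart_sspace]
    have y: "\<gamma> y - sscale L k y \<in> P g"
      using k gamma_homogeneous[OF yz(1), unfolded add_0_left] yz(1) by auto
    have z: "\<gamma> z - sscale L k z \<in> P (g + 1)"
      using k gamma_homogeneous[OF yz(2), unfolded add.commute[of 1]] yz(2) by auto
    have "(\<gamma> y - sscale L k y) + (\<gamma> z - sscale L k z) = 0"
      using x S unfolding yz(3) by (simp add: gamma_add scale_right_distrib flip: add_diff_add)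
    from homogeneous_sum_zero[OF y z this]
    have "\<gamma> y = sscale L k y" "\<gamma> z = sscale L k z" by simp_all
    then show "\<exists>y\<in>?K \<inter> P 0. \<exists>z\<in>?K \<inter> P 1. x = y + z" using yz S by auto
  next
    fix a x y assume x: "x \<in> P a" and "y \<in> ?K"
    then show "x \<bullet> y \<in> ?K"
      using k gamma_bracket[OF x, of y] spart_sspace[OF x] by (auto simp: bracket_scale_right)
  qed auto
  moreover have "?K \<noteq> {0}" using v by blast
  ultimately have "?K = S" using simple unfolding simple_superalgebra_def by blast
  then show ?thesis by blast
qed

text \<open>
  For odd \<open>\<gamma>\<close>, evaluating \<open>\<gamma>[y,\<gamma>(z)]\<close> with \<open>\<gamma>\<close> acting on the right factor or on the left one gives
  \<open>[\<gamma>(y),\<gamma>(z)]\<close> with opposite signs. Hence \<open>\<gamma>\<^sup>2\<close> vanishes on brackets and \<open>\<gamma>\<close> has a nonzero kernel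
  unless it is zero already.
\<close>

lemma odd_biderivation_zero:
  assumes g: "g = 1" and "x \<in> S" "w \<in> S"
  shows "\<phi> (x, w) = 0"
proof -
  have sq: "\<gamma> (\<gamma> (y \<bullet> z)) = 0" if yz: "y \<in> P b" "z \<in> P c" for y z b c
  proof -
    note S = yz[THEN spart_sspace]
    have 1: "\<gamma> (\<gamma> (y \<bullet> z)) = sscale L (sg b) (\<gamma> (y \<bullet> \<gamma> z))"
      using gamma_bracket[OF yz(1) S(2)] S by (simp add: g gamma_scale)
    have 2: "y \<bullet> \<gamma> z = sscale L (sg b) (\<gamma> y \<bullet> z)"
      using gamma_swap[OF yz] by (simp add: g)
    have 3: "\<gamma> (\<gamma> y \<bullet> z) = sscale L (sg (b + 1)) (\<gamma> y \<bullet> \<gamma> z)"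
      using gamma_bracket[OF gamma_homogeneous[OF yz(1)] S(2)] by (simp add: g)
    have 4: "\<gamma> (y \<bullet> \<gamma> z) = \<gamma> y \<bullet> \<gamma> z"
      using gamma_bracket[OF yz(1), of "\<gamma> z"] gamma_swap[OF yz(1) gamma_homogeneous[OF yz(2)]] S
      by (simp add: g sg_mult)
    have "\<gamma> (y \<bullet> \<gamma> z) = - (\<gamma> y \<bullet> \<gamma> z)"
      unfolding 2 using 3 S bit_cases[of b] by (elim disjE) (simp_all add: gamma_minus)
    with 4 have "\<gamma> (y \<bullet> \<gamma> z) = 0" using double_zero by (metis add.right_inverse)
    then show ?thesis unfolding 1 by simp
  qed
  have z: "\<gamma> 0 = 0" using gamma_scale[of 0 0] by simp
  have "subspace {w \<in> S. \<gamma> (\<gamma> w) = 0}"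
    by (intro subspaceI) (simp_all add: gamma_add gamma_scale z)
  moreover have "{u \<bullet> v |u v d e. u \<in> P d \<and> v \<in> P e} \<subseteq> {w \<in> S. \<gamma> (\<gamma> w) = 0}"
    using sq spart_sspace by auto
  ultimately have "span {u \<bullet> v |u v d e. u \<in> P d \<and> v \<in> P e} \<subseteq> {w \<in> S. \<gamma> (\<gamma> w) = 0}"
    by (rule span_minimal[rotated])
  then have *: "\<gamma> (\<gamma> w) = 0" if "w \<in> S" for w
    using that unfolding perfect by blast
  have "\<gamma> w = 0"
  proof (rule ccontr)
    assume "\<gamma> w \<noteq> 0"
    then have "\<forall>x\<in>S. \<gamma> x = sscale L 0 x"
      using *[OF assms(3)] assms(3) by (intro gamma_eigenspace[of 0 "\<gamma> w"]) simp_all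
    then show False using \<open>\<gamma> w \<noteq> 0\<close> assms(3) by simp
  qed
  then show ?thesis using phi_gamma assms by simp
qed

end

section \<open>Biderivations of finite-dimensional simple superalgebras\<close>

text \<open>
  Take a nonzero polynomial \<open>p\<close> of least degree with \<open>p(f) v = 0\<close>; it exists because \<open>v\<close>, \<open>f(v)\<close>,
  \<open>f\<^sup>2(v)\<close>, ... are linearly dependent. If \<open>r\<close> is a root and \<open>p = (X - r) q\<close>, then \<open>q(f) v\<close> is an
  eigenvector. The map \<open>f\<close> need only be linear on the subspace \<open>V\<close>, and the existence of roots is a
  hypothesis on the field.
\<close>

lemma (in vector_space) eigenvalue_exists:
  assumes roots: "\<And>p :: 'a poly. degree p > 0 \<Longrightarrow> \<exists>r. poly p r = 0"
    and V: "subspace V" "V \<subseteq> span B" "finite B"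
    and f: "\<And>x. x \<in> V \<Longrightarrow> f x \<in> V" "\<And>x y. x \<in> V \<Longrightarrow> y \<in> V \<Longrightarrow> f (x + y) = f x + f y"
      "\<And>c x. x \<in> V \<Longrightarrow> f (scale c x) = scale c (f x)"
    and v: "v \<in> V" "v \<noteq> 0"
  shows "\<exists>k. \<exists>w\<in>V. w \<noteq> 0 \<and> f w = scale k w"
proof -
  define e where "e i = (f ^^ i) v" for i
  have eV: "e i \<in> V" for i unfolding e_def by (induction i) (simp_all add: f v)
  have f_sum: "f (\<Sum>i\<in>I. scale (c i) (e i)) = (\<Sum>i\<in>I. scale (c i) (e (Suc i)))"
    and sum_V: "(\<Sum>i\<in>I. scale (c i) (e i)) \<in> V" if "finite I" for I c
  proof -
    have "(\<Sum>i\<in>I. scale (c i) (e i)) \<in> V \<and>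
      f (\<Sum>i\<in>I. scale (c i) (e i)) = (\<Sum>i\<in>I. scale (c i) (e (Suc i)))"
      using that
    proof induction
      case empty
      have "f 0 = 0" using f(3)[of 0 0] V(1) by (simp add: subspace_0)
      then show ?case using V(1) by (simp add: subspace_0)
    next
      case (insert i I)
      then show ?case using eV[of i] V(1)
        by (simp add: f subspace_add subspace_scale) (simp add: e_def)
    qed
    then show "f (\<Sum>i\<in>I. scale (c i) (e i)) = (\<Sum>i\<in>I. scale (c i) (e (Suc i)))"
      "(\<Sum>i\<in>I. scale (c i) (e i)) \<in> V" by simp_all
  qed
  define E where "E p = (\<Sum>i\<le>degree p. scale (coeff p i) (e i))" for p
  have E_upto: "E p = (\<Sum>i\<le>m. scale (coeff p i) (e i))" if "degree p \<le> m" for p m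
    unfolding E_def using that by (intro sum.mono_neutral_left) (auto simp: coeff_eq_0)
  have EV: "E p \<in> V" for p unfolding E_def by (rule sum_V) simp
  have E_root: "E ([:- r, 1:] * q) = f (E q) - scale r (E q)" for r q
  proof -
    let ?m = "degree q"
    have "degree ([:- r, 1:] * q) \<le> Suc ?m"
      using degree_mult_le[of "[:- r, 1:]" q] by simp
    then have "E ([:- r, 1:] * q) = (\<Sum>i\<le>Suc ?m. scale (coeff (pCons 0 q) i) (e i) - scale (r * coeff q i) (e i))"
      by (simp only: E_upto) (simp add: scale_left_diff_distrib algebra_simps)
    also have "\<dots> = (\<Sum>i\<le>Suc ?m. scale (coeff (pCons 0 q) i) (e i)) - (\<Sum>i\<le>Suc ?m. scale (r * coeff q i) (e i))"
      by (rule sum_subtractf)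
    also have "(\<Sum>i\<le>Suc ?m. scale (coeff (pCons 0 q) i) (e i)) = f (E q)"
      unfolding E_def f_sum[OF finite_atMost] by (subst sum.atMost_Suc_shift) simp
    also have "(\<Sum>i\<le>Suc ?m. scale (r * coeff q i) (e i)) = scale r (E q)"
      by (subst E_upto[of q "Suc ?m"]) (simp_all add: scale_sum_right coeff_eq_0 scale_right_distrib)
    finally show ?thesis .
  qed
  \<comment> \<open>Either two of the vectors coincide, or they form a set too large to be independent.\<close>
  have "\<exists>p. p \<noteq> 0 \<and> E p = 0"
  proof (cases "inj_on e {..card B}")
    case False
    then obtain i j where ij: "i \<noteq> j" "e i = e j" by (auto simp: inj_on_def)
    let ?p = "monom 1 i - monom 1 j :: 'a poly"
    have "?p \<noteq> 0" using ij(1) by (auto simp: poly_eq_iff dest: spec[of _ i])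
    moreover have "E ?p = (\<Sum>k\<le>max i j. scale (coeff ?p k) (e k))"
      by (rule E_upto) (rule order_trans[OF degree_diff_le_max], simp add: degree_monom_eq)
    then have "E ?p = e i - e j"
      by (simp add: scale_left_diff_distrib sum_subtractf if_distrib[of "\<lambda>c. scale c _"] cong: if_cong)
    ultimately show ?thesis using ij(2) by (intro exI[of _ ?p]) simp
  next
    case True
    have "e ` {..card B} \<subseteq> span B" using eV V(2) by auto
    then have "dependent (e ` {..card B})"
      using independent_span_bound[OF V(3)] card_image[OF True] by (metis card_atMost Suc_n_not_le_n)
    then obtain u where u: "\<exists>x\<in>e ` {..card B}. u x \<noteq> 0" "(\<Sum>x\<in>e ` {..card B}. scale (u x) x) = 0"
      by (subst (asm) dependent_finite) auto
    define p where "p = (\<Sum>i\<le>card B. monom (u (e i)) i)"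
    have c: "coeff p i = (if i \<le> card B then u (e i) else 0)" for i
      unfolding p_def by (simp add: coeff_sum)
    have "p \<noteq> 0" using u(1) c by auto (metis coeff_0)
    moreover have "E p = (\<Sum>i\<le>card B. scale (u (e i)) (e i))"
    proof -
      have "degree p \<le> card B" by (rule degree_le) (simp add: c)
      then show ?thesis by (simp add: E_upto c)
    qed
    then have "E p = 0" using u(2) by (simp add: sum.reindex[OF True])
    ultimately show ?thesis by blast
  qed
  then obtain p where p: "p \<noteq> 0" "E p = 0" and min: "\<And>q. q \<noteq> 0 \<Longrightarrow> E q = 0 \<Longrightarrow> degree p \<le> degree q"
    using ex_has_least_nat[of "\<lambda>p. p \<noteq> 0 \<and> E p = 0" _ degree] by blast
  have "degree p \<noteq> 0"
  proof
    assume "degree p = 0"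
    then have "scale (coeff p 0) v = 0" using p(2) by (simp add: E_def e_def)
    then show False using p(1) v(2) \<open>degree p = 0\<close>
      by (metis scale_eq_0_iff leading_coeff_0_iff)
  qed
  then obtain r where "poly p r = 0" using roots by auto
  then obtain q where q: "p = [:- r, 1:] * q" by (auto simp: poly_eq_0_iff_dvd elim: dvdE)
  have "q \<noteq> 0" using q p(1) by auto
  then have "degree p = Suc (degree q)" unfolding q by (subst degree_mult_eq) auto
  then have "E q \<noteq> 0" using min[of q] \<open>q \<noteq> 0\<close> by auto
  moreover have "f (E q) = scale r (E q)" using E_root[of r q] p(2) q by simp
  ultimately show ?thesis using EV by blast
qed

theorem (in lie_superalgebra) BDer_eq_IBDer:
  assumes char: "(2::'f) \<noteq> 0"
    and roots: "\<And>p :: 'f poly. degree p > 0 \<Longrightarrow> \<exists>r. poly p r = 0"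
    and fin: "finite B" "sspace L \<subseteq> span B"
    and simple: "simple_superalgebra L"
  shows "BDer L = IBDer L"
proof
  show "BDer L \<subseteq> IBDer L"
  proof
    fix \<chi> assume "\<chi> \<in> BDer L"
    then obtain \<phi> \<psi> where \<chi>: "\<chi> = (\<lambda>z\<in>S \<times> S. \<phi> z + \<psi> z)"
      and \<phi>: "\<phi> \<in> BDer_deg L 0" and \<psi>: "\<psi> \<in> BDer_deg L 1" unfolding BDer_def by blast
    interpret even: skew_biderivation L \<phi> 0
      by unfold_locales (fact \<phi> char simple)+
    interpret odd: skew_biderivation L \<psi> 1
      by unfold_locales (fact \<psi> char simple)+
    obtain x y where "x \<in> S" "y \<in> S" "x \<bullet> y \<noteq> 0"
      using simple unfolding simple_superalgebra_def by blast
    then have "x \<noteq> 0" by auto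
    have "\<exists>k. \<exists>w\<in>S. w \<noteq> 0 \<and> even.\<gamma> w = sscale L k w"
      by (rule eigenvalue_exists[OF roots subspace_sspace fin(2,1) _ _ _ \<open>x \<in> S\<close> \<open>x \<noteq> 0\<close>])
        (simp_all add: even.gamma_add even.gamma_scale)
    then obtain k where k: "\<forall>x\<in>S. even.\<gamma> x = sscale L k x"
      using even.gamma_eigenspace by blast
    have "\<chi> = inner_biderivation L k"
      unfolding \<chi> inner_biderivation_def
    proof (rule restrict_ext)
      fix z assume "z \<in> S \<times> S"
      then obtain x y where z: "z = (x, y)" "x \<in> S" "y \<in> S" by blast
      show "\<phi> z + \<psi> z = (case z of (x, y) \<Rightarrow> sscale L k (x \<bullet> y))"
        using z k by (simp add: odd.odd_biderivation_zero even.phi_gamma bracket_scale_right)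
    qed
    then show "\<chi> \<in> IBDer L" by (simp add: IBDer_def)
  qed
next
  show "IBDer L \<subseteq> BDer L"
  proof
    fix \<chi> assume "\<chi> \<in> IBDer L"
    then obtain k where \<chi>: "\<chi> = inner_biderivation L k" by (auto simp: IBDer_def)
    have in_S: "inner_biderivation L k (x, y) = sscale L k (x \<bullet> y)" if "x \<in> S" "y \<in> S" for k x y
      using that by (simp add: inner_biderivation_def)
    have ext: "inner_biderivation L k \<in> S \<times> S \<rightarrow>\<^sub>E S" for k
      by (auto simp: inner_biderivation_def)
    have bil: "inner_biderivation L k \<in> bilinear_maps L" for k
      unfolding bilinear_maps_def using ext
      by (auto simp: in_S bracket_add_left bracket_add_right bracket_scale_left bracket_scale_right
          scale_right_distrib mult.commute)
    have "inner_biderivation L k \<in> BDer_deg L 0"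
      unfolding BDer_deg_def homogeneous_map_def
    proof (intro CollectI conjI allI ballI)
      fix a b x y assume xy: "x \<in> P a" "y \<in> P b"
      note S = xy[THEN spart_sspace]
      show "inner_biderivation L k (x, y) \<in> P (a + b + 0)"
        using bracket_spart[OF xy] S by (simp only: in_S add_0_right spart_closed)
      show "inner_biderivation L k (x, y) =
          - sscale L (sg (0 * a + 0 * b + a * b)) (inner_biderivation L k (y, x))"
        unfolding in_S[OF S] in_S[OF S(2,1)] bracket_skew[OF xy] by (simp add: mult.commute)
      fix z assume "z \<in> S"
      then show "inner_biderivation L k (x, y \<bullet> z) =
          inner_biderivation L k (x, y) \<bullet> z + sscale L (sg ((0 + a) * b)) (y \<bullet> inner_biderivation L k (x, z))"
      proof (induction rule: homogeneous_induct)
        case (homogeneous c z)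
        note S = S spart_sspace[OF homogeneous]
        show ?case
          using S jacobi[OF xy homogeneous]
          by (simp add: in_S bracket_scale_left bracket_scale_right scale_right_distrib mult.commute)
      next
        case (add z z')
        then show ?case using S
          by (simp add: in_S bracket_add_right bracket_scale_right scale_right_distrib)
      qed
    qed (rule bil)
    moreover have "inner_biderivation L 0 \<in> BDer_deg L 1"
      unfolding BDer_deg_def homogeneous_map_def
      by (intro CollectI conjI allI ballI bil) (simp_all add: in_S spart_sspace)
    moreover have "\<chi> = (\<lambda>z\<in>S \<times> S. inner_biderivation L k z + inner_biderivation L 0 z)"
      unfolding \<chi> by (rule extensionalityI[of _ "S \<times> S"]) (auto simp: in_S inner_biderivation_def)
    ultimately show "\<chi> \<in> BDer L" unfolding BDer_def by blast
  qed
qed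

section \<open>Linear extension from monomials\<close>

notation lam_mult (infixl "\<cdot>" 75)

global_interpretation lam: vector_space lam_scale
  by unfold_locales (auto intro!: poly_mapping_eqI simp: lookup_add algebra_simps)

text \<open>
  Product, derivations and homogeneous parts are all given by their values on monomials. Recognising
  them as instances of one extension operator provides their linearity at once, and
  \<open>module_hom_eq_on_monomials\<close> reduces identities between them to monomials.
\<close>

definition lin_ext :: "(mono \<Rightarrow> 'f::field lam) \<Rightarrow> 'f lam \<Rightarrow> 'f lam" where
  "lin_ext F f = (\<Sum>m\<in>Poly_Mapping.keys f. lam_scale (Poly_Mapping.lookup f m) (F m))"

lemma lin_ext_superset:
  assumes "finite A" "Poly_Mapping.keys f \<subseteq> A"
  shows "lin_ext F f = (\<Sum>m\<in>A. lam_scale (Poly_Mapping.lookup f m) (F m))"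
  unfolding lin_ext_def using assms
  by (intro sum.mono_neutral_left) (auto simp: in_keys_iff)

lemma keys_lam_scale: "Poly_Mapping.keys (lam_scale c f) \<subseteq> Poly_Mapping.keys f"
  by (auto simp: in_keys_iff)

lemma module_hom_lin_ext: "module_hom lam_scale lam_scale (lin_ext F)"
proof -
  have "lin_ext F (f + g) = lin_ext F f + lin_ext F g" for f g
  proof -
    let ?A = "Poly_Mapping.keys f \<union> Poly_Mapping.keys g"
    have "Poly_Mapping.keys (f + g) \<subseteq> ?A" by (rule keys_add)
    then show ?thesis
      by (simp add: lin_ext_superset[of ?A] lookup_add lam.scale_left_distrib sum.distrib)
  qed
  moreover have "lin_ext F (lam_scale c f) = lam_scale c (lin_ext F f)" for c f
    using keys_lam_scale[of c f]
    by (simp add: lin_ext_superset[of "Poly_Mapping.keys f"] lam.scale_sum_right)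
  ultimately show ?thesis
    by (simp add: module_hom_iff lam.module_axioms)
qed

lemma lin_ext_single [simp]: "lin_ext F (Poly_Mapping.single m c) = lam_scale c (F m)"
  by (subst lin_ext_superset[of "{m}"]) auto

lemma lin_ext_0 [simp]: "lin_ext F 0 = 0"
  by (simp add: lin_ext_def)

lemma single_eq_scale: "Poly_Mapping.single m c = lam_scale c (Poly_Mapping.single m 1)"
  by (auto intro!: poly_mapping_eqI simp: lookup_single when_def)

lemma lam_scale_single [simp]: "lam_scale c (Poly_Mapping.single m d) = Poly_Mapping.single m (c * d)"
  by (auto intro!: poly_mapping_eqI simp: lookup_single when_def)

lemma lin_ext_single_1: "lin_ext (\<lambda>m. Poly_Mapping.single m 1) f = f"
proof (rule poly_mapping_eqI)
  fix k
  show "Poly_Mapping.lookup (lin_ext (\<lambda>m. Poly_Mapping.single m 1) f) k = Poly_Mapping.lookup f k"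
    by (simp add: lin_ext_def lookup_sum lookup_single when_def if_distrib[of "\<lambda>x. _ * x"] in_keys_iff cong: if_cong)
qed

lemma module_hom_eq_lin_ext:
  assumes "module_hom lam_scale lam_scale F"
  shows "F f = lin_ext (\<lambda>m. F (Poly_Mapping.single m 1)) f"
proof -
  interpret F: module_hom lam_scale lam_scale F by (rule assms)
  have "F f = F (lin_ext (\<lambda>m. Poly_Mapping.single m 1) f)" by (simp only: lin_ext_single_1)
  then show ?thesis by (simp only: lin_ext_def F.sum F.scale)
qed

lemma module_hom_eq_on_monomials:
  assumes "module_hom lam_scale lam_scale F" "module_hom lam_scale lam_scale G"
    and "\<And>m. m \<in> Poly_Mapping.keys f \<Longrightarrow> F (Poly_Mapping.single m 1) = G (Poly_Mapping.single m 1)"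
  shows "F f = G f"
  unfolding assms(1,2)[THEN module_hom_eq_lin_ext, of f] lin_ext_def using assms(3) by simp

lemma lin_ext_in_subspace:
  assumes "lam.subspace V" "\<And>m. m \<in> Poly_Mapping.keys f \<Longrightarrow> F m \<in> V"
  shows "lin_ext F f \<in> V"
  unfolding lin_ext_def using assms by (intro lam.subspace_sum lam.subspace_scale) auto

lemma der_eq_lin_ext: "der n i = lin_ext (mono_der n i)"
  by (simp add: fun_eq_iff der_def lin_ext_def)

lemma lam_part_eq_lin_ext:
  "lam_part \<theta> = lin_ext (\<lambda>m. if mono_parity m = \<theta> then Poly_Mapping.single m 1 else 0)"
  by (auto simp: fun_eq_iff lam_part_def lin_ext_def if_distrib[of "lam_scale _"] simp flip: single_eq_scale
      intro!: sum.cong)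

lemma lam_mult_eq_lin_ext: "f \<cdot> g = lin_ext (\<lambda>a. lin_ext (mono_mult a) g) f"
  by (simp add: lam_mult_def lin_ext_def lam.scale_sum_right)

interpretation der: module_hom lam_scale lam_scale "der n i"
  unfolding der_eq_lin_ext by (rule module_hom_lin_ext)

interpretation lam_part: module_hom lam_scale lam_scale "lam_part \<theta>"
  unfolding lam_part_eq_lin_ext by (rule module_hom_lin_ext)

interpretation mult_left: module_hom lam_scale lam_scale "\<lambda>f. f \<cdot> g"
  unfolding lam_mult_eq_lin_ext by (rule module_hom_lin_ext)

interpretation mult_right: module_hom lam_scale lam_scale "\<lambda>g. f \<cdot> g"
proof -
  interpret h: module_hom lam_scale lam_scale "lin_ext (mono_mult a)" for a
    by (rule module_hom_lin_ext)
  show "module_hom lam_scale lam_scale (\<lambda>g. f \<cdot> g)"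
    unfolding lam_mult_eq_lin_ext lin_ext_def[of "\<lambda>a. lin_ext (mono_mult a) _"]
    by (simp add: module_hom_iff lam.module_axioms h.add h.scale lam.scale_right_distrib sum.distrib
        lam.scale_sum_right mult.commute)
qed

lemmas der_simps = der.add der.scale der.diff der.neg der.sum
lemmas mult_simps =
  mult_left.add mult_left.scale mult_left.diff mult_left.neg mult_left.sum
  mult_right.add mult_right.scale mult_right.diff mult_right.neg mult_right.sum

lemma mult_single: "Poly_Mapping.single a 1 \<cdot> Poly_Mapping.single b 1 = mono_mult a b"
  by (simp add: lam_mult_eq_lin_ext)

lemma der_single: "der n i (Poly_Mapping.single a 1) = mono_der n i a"
  by (simp add: der_eq_lin_ext)

section \<open>Identities for monomials\<close>

definition binom_coeff :: "(nat \<Rightarrow>\<^sub>0 nat) \<Rightarrow> (nat \<Rightarrow>\<^sub>0 nat) \<Rightarrow> nat" where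
  "binom_coeff \<alpha> \<beta> = (\<Prod>i\<in>Poly_Mapping.keys \<alpha>.
     Poly_Mapping.lookup (\<alpha> + \<beta>) i choose Poly_Mapping.lookup \<alpha> i)"

text \<open>
  Indices outside the support contribute the factor \<open>1\<close>, so several coefficients can be compared on a
  common index set.
\<close>

lemma binom_coeff_superset:
  assumes "finite K" "Poly_Mapping.keys \<alpha> \<subseteq> K"
  shows "binom_coeff \<alpha> \<beta> =
    (\<Prod>i\<in>K. (Poly_Mapping.lookup \<alpha> i + Poly_Mapping.lookup \<beta> i) choose Poly_Mapping.lookup \<alpha> i)"
  unfolding binom_coeff_def lookup_add using assms
  by (intro prod.mono_neutral_left) (auto simp: in_keys_iff)

lemma keys_sum_nat: "Poly_Mapping.keys (\<alpha> + \<beta>) = Poly_Mapping.keys \<alpha> \<union> Poly_Mapping.keys (\<beta> :: nat \<Rightarrow>\<^sub>0 nat)"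
  by (auto simp: in_keys_iff lookup_add)

text \<open>
  Both sides are the multinomial coefficient of \<open>\<alpha>\<close>, \<open>\<beta>\<close>, \<open>\<gamma>\<close>.
\<close>

lemma binom_coeff_assoc:
  "binom_coeff \<alpha> \<beta> * binom_coeff (\<alpha> + \<beta>) \<gamma> = binom_coeff \<beta> \<gamma> * binom_coeff \<alpha> (\<beta> + \<gamma>)"
proof -
  let ?K = "Poly_Mapping.keys \<alpha> \<union> Poly_Mapping.keys \<beta> \<union> Poly_Mapping.keys \<gamma>"
  have *: "((a + b) choose a) * ((a + b + c) choose (a + b)) = ((b + c) choose b) * ((a + (b + c)) choose a)"
    for a b c :: nat
    using choose_mult[of a "a + b" "a + b + c"] by (simp add: ac_simps)
  have e: "binom_coeff \<alpha> x = (\<Prod>i\<in>?K. (Poly_Mapping.lookup \<alpha> i + Poly_Mapping.lookup x i) choose Poly_Mapping.lookup \<alpha> i)"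
    "binom_coeff \<beta> x = (\<Prod>i\<in>?K. (Poly_Mapping.lookup \<beta> i + Poly_Mapping.lookup x i) choose Poly_Mapping.lookup \<beta> i)"
    "binom_coeff (\<alpha> + \<beta>) x = (\<Prod>i\<in>?K. (Poly_Mapping.lookup (\<alpha> + \<beta>) i + Poly_Mapping.lookup x i) choose Poly_Mapping.lookup (\<alpha> + \<beta>) i)"
    for x
    by (rule binom_coeff_superset; auto simp: keys_sum_nat)+
  show ?thesis
    unfolding e prod.distrib[symmetric] lookup_add using * by (intro prod.cong refl) (simp add: ac_simps)
qed

lemma binom_coeff_commute: "binom_coeff \<alpha> \<beta> = binom_coeff \<beta> \<alpha>"
proof -
  let ?K = "Poly_Mapping.keys \<alpha> \<union> Poly_Mapping.keys \<beta>"
  have e: "binom_coeff \<alpha> \<beta> = (\<Prod>i\<in>?K. (Poly_Mapping.lookup \<alpha> i + Poly_Mapping.lookup \<beta> i) choose Poly_Mapping.lookup \<alpha> i)"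
    "binom_coeff \<beta> \<alpha> = (\<Prod>i\<in>?K. (Poly_Mapping.lookup \<beta> i + Poly_Mapping.lookup \<alpha> i) choose Poly_Mapping.lookup \<beta> i)"
    by (rule binom_coeff_superset; auto)+
  have "(a + b) choose a = (b + a) choose b" for a b :: nat
    using binomial_symmetric[of a "a + b"] by (simp add: add.commute)
  then show ?thesis unfolding e by simp
qed

text \<open>
  Pascal's rule in the coordinate \<open>i\<close>. The conditionals express that the derivative \<open>D\<^sub>i\<close> kills a monomial
  with exponent \<open>0\<close>, where truncated subtraction would leave it unchanged.
\<close>

lemma binom_coeff_pascal:
  assumes "Poly_Mapping.lookup (\<alpha> + \<beta>) i \<noteq> 0"
  shows "binom_coeff \<alpha> \<beta> =
    (if Poly_Mapping.lookup \<alpha> i = 0 then 0 else binom_coeff (\<alpha> - Poly_Mapping.single i 1) \<beta>) +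
    (if Poly_Mapping.lookup \<beta> i = 0 then 0 else binom_coeff \<alpha> (\<beta> - Poly_Mapping.single i 1))"
proof -
  let ?l = Poly_Mapping.lookup
  let ?K = "Poly_Mapping.keys \<alpha> \<union> Poly_Mapping.keys \<beta> - {i}"
  let ?p = "\<Prod>j\<in>?K. (?l \<alpha> j + ?l \<beta> j) choose ?l \<alpha> j"
  have e: "binom_coeff x y = ((?l x i + ?l y i) choose ?l x i) * ?p"
    if "\<And>j. j \<noteq> i \<Longrightarrow> ?l x j = ?l \<alpha> j" "\<And>j. j \<noteq> i \<Longrightarrow> ?l y j = ?l \<beta> j" for x y
  proof -
    have "Poly_Mapping.keys x \<subseteq> insert i ?K"
    proof
      fix j assume "j \<in> Poly_Mapping.keys x"
      then show "j \<in> insert i ?K" using that(1)[of j] by (auto simp: in_keys_iff)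
    qed
    then have "binom_coeff x y = (\<Prod>j\<in>insert i ?K. (?l x j + ?l y j) choose ?l x j)"
      by (intro binom_coeff_superset) auto
    also have "\<dots> = ((?l x i + ?l y i) choose ?l x i) * (\<Prod>j\<in>?K. (?l x j + ?l y j) choose ?l x j)"
      by (subst prod.insert) auto
    also have "(\<Prod>j\<in>?K. (?l x j + ?l y j) choose ?l x j) = ?p"
      using that by (intro prod.cong) auto
    finally show ?thesis .
  qed
  have l: "?l (x - Poly_Mapping.single i 1) j = (if j = i then ?l x j - 1 else ?l x j)" for x :: "nat \<Rightarrow>\<^sub>0 nat" and j
    by (simp add: lookup_minus lookup_single when_def)
  have e\<alpha>: "binom_coeff (\<alpha> - Poly_Mapping.single i 1) \<beta> = ((?l \<alpha> i - 1 + ?l \<beta> i) choose (?l \<alpha> i - 1)) * ?p"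
    by (subst e) (simp_all only: l if_True if_False refl)
  have e\<beta>: "binom_coeff \<alpha> (\<beta> - Poly_Mapping.single i 1) = ((?l \<alpha> i + (?l \<beta> i - 1)) choose ?l \<alpha> i) * ?p"
    by (subst e) (simp_all only: l if_True if_False refl)
  have "(a + b) choose a = (if a = 0 then 0 else (a - 1 + b) choose (a - 1)) + (if b = 0 then 0 else (a + (b - 1)) choose a)"
    if "a + b \<noteq> 0" for a b :: nat
    using that by (cases a; cases b) (simp_all add: ac_simps)
  from this[of "?l \<alpha> i" "?l \<beta> i"] show ?thesis
    using assms unfolding e\<alpha> e\<beta> e[OF refl refl] lookup_add by (auto simp: algebra_simps)
qed

text \<open>
  The exponent of the sign in \<open>x\<^sup>u x\<^sup>v\<close>, written as a double sum so that it is visibly biadditive under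
  disjoint unions.
\<close>

definition inversions :: "nat set \<Rightarrow> nat set \<Rightarrow> nat" where
  "inversions u v = (\<Sum>i\<in>u. \<Sum>j\<in>v. of_bool (j < i))"

lemma card_inversions:
  assumes "finite u" "finite v"
  shows "card {(i, j). i \<in> u \<and> j \<in> v \<and> j < i} = inversions u v"
proof -
  have "{(i, j). i \<in> u \<and> j \<in> v \<and> j < i} = (SIGMA i:u. {j \<in> v. j < i})" by auto
  then have "card {(i, j). i \<in> u \<and> j \<in> v \<and> j < i} = (\<Sum>i\<in>u. card {j \<in> v. j < i})"
    using assms by (simp add: card_SigmaI)
  also have "\<dots> = inversions u v"
    unfolding inversions_def using assms by (intro sum.cong) (auto simp: Int_def)
  finally show ?thesis .
qed

lemma inversions_union_left:
  "finite u \<Longrightarrow> finite u' \<Longrightarrow> u \<inter> u' = {} \<Longrightarrow> inversions (u \<union> u') v = inversions u v + inversions u' v"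
  by (simp add: inversions_def sum.union_disjoint)

lemma inversions_union_right:
  "finite v \<Longrightarrow> finite v' \<Longrightarrow> v \<inter> v' = {} \<Longrightarrow> inversions u (v \<union> v') = inversions u v + inversions u v'"
  unfolding inversions_def by (simp only: sum.union_disjoint sum.distrib)

text \<open>
  Every pair in \<open>u \<times> v\<close> is an inversion in exactly one of the two orders.
\<close>

lemma inversions_swap:
  assumes "u \<inter> v = {}"
  shows "inversions u v + inversions v u = card u * card v"
proof -
  have "inversions u v + inversions v u = (\<Sum>i\<in>u. \<Sum>j\<in>v. of_bool (j < i) + of_bool (i < j))"
    unfolding inversions_def by (subst (2) sum.swap) (simp add: sum.distrib)
  also have "\<dots> = (\<Sum>i\<in>u. \<Sum>j\<in>v. 1)"
    using assms by (intro sum.cong refl) (auto simp: neq_iff)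
  finally show ?thesis by simp
qed

lemma mono_mult_eq:
  assumes "finite u" "finite v"
  shows "mono_mult (\<alpha>, u) (\<beta>, v) =
    (if u \<inter> v = {} then Poly_Mapping.single (\<alpha> + \<beta>, u \<union> v)
       (of_nat (binom_coeff \<alpha> \<beta>) * (- 1) ^ inversions u v) else 0)"
  unfolding mono_mult_def binom_coeff_def using card_inversions[OF assms] by simp

text \<open>
  Finiteness of the index sets matters: the signs are defined by cardinalities, which are zero for
  infinite sets.
\<close>

lemma mono_mult_assoc:
  assumes "finite u" "finite v" "finite w"
  shows "mono_mult (\<alpha>, u) (\<beta>, v) \<cdot> Poly_Mapping.single (\<gamma>, w) 1 =
    Poly_Mapping.single (\<alpha>, u) 1 \<cdot> mono_mult (\<beta>, v) (\<gamma>, w)"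
proof (cases "u \<inter> v = {} \<and> u \<inter> w = {} \<and> v \<inter> w = {}")
  case False
  then show ?thesis using assms
    by (auto simp: mono_mult_eq lam_mult_eq_lin_ext Int_Un_distrib Int_Un_distrib2)
next
  case True
  then have d: "u \<inter> v = {}" "v \<inter> w = {}" "(u \<union> v) \<inter> w = {}" "u \<inter> (v \<union> w) = {}" by auto
  have "inversions u v + inversions (u \<union> v) w = inversions v w + inversions u (v \<union> w)"
    using assms True by (simp add: inversions_union_left inversions_union_right)
  then have s: "(- 1) ^ inversions u v * (- 1) ^ inversions (u \<union> v) w
    = (- 1) ^ inversions v w * (- 1 :: 'a) ^ inversions u (v \<union> w)"
    by (simp flip: power_add)
  have c: "of_nat (binom_coeff \<alpha> \<beta>) * of_nat (binom_coeff (\<alpha> + \<beta>) \<gamma>)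
    = of_nat (binom_coeff \<beta> \<gamma>) * (of_nat (binom_coeff \<alpha> (\<beta> + \<gamma>)) :: 'a)"
    using binom_coeff_assoc[of \<alpha> \<beta> \<gamma>] by (simp flip: of_nat_mult)
  have "(of_nat (binom_coeff \<alpha> \<beta>) * of_nat (binom_coeff (\<alpha> + \<beta>) \<gamma>)) *
      ((- 1) ^ inversions u v * (- 1) ^ inversions (u \<union> v) w)
    = (of_nat (binom_coeff \<beta> \<gamma>) * of_nat (binom_coeff \<alpha> (\<beta> + \<gamma>))) *
      ((- 1) ^ inversions v w * (- 1 :: 'a) ^ inversions u (v \<union> w))"
    by (simp only: s c)
  then show ?thesis
    using assms d
    by (simp add: mono_mult_eq lam_mult_eq_lin_ext ac_simps)
qed

lemma mono_parity_union:
  "finite u \<Longrightarrow> finite v \<Longrightarrow> u \<inter> v = {} \<Longrightarrow> mono_parity (\<gamma>, u \<union> v) = mono_parity (\<alpha>, u) + mono_parity (\<beta>, v)"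
  by (simp add: mono_parity_def card_Un_disjoint)

lemma sg_of_nat: "sg (of_nat k) = (- 1) ^ k"
proof (induction k)
  case (Suc k)
  show ?case using bit_cases[of "of_nat k"] Suc by (elim disjE) simp_all
qed simp

lemma mono_mult_commute:
  assumes "finite u" "finite v"
  shows "mono_mult (\<beta>, v) (\<alpha>, u) =
    lam_scale (sg (mono_parity (\<alpha>, u) * mono_parity (\<beta>, v))) (mono_mult (\<alpha>, u) (\<beta>, v))"
proof (cases "u \<inter> v = {}")
  case False
  then show ?thesis using assms by (auto simp: mono_mult_eq)
next
  case True
  have "(- 1) ^ inversions v u = (- 1) ^ (inversions u v + inversions v u) * (- 1 :: 'a) ^ inversions u v"
    by (simp flip: power_add) (simp add: power_add flip: mult.assoc power_mult_distrib)
  also have "\<dots> = sg (mono_parity (\<alpha>, u) * mono_parity (\<beta>, v)) * (- 1) ^ inversions u v"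
    unfolding inversions_swap[OF True] by (simp only: mono_parity_def snd_conv sg_of_nat flip: of_nat_mult)
  finally have s: "(- 1 :: 'a) ^ inversions v u = sg (mono_parity (\<alpha>, u) * mono_parity (\<beta>, v)) * (- 1) ^ inversions u v" .
  show ?thesis
    using assms True
    by (simp add: mono_mult_eq Int_commute Un_commute add.commute s binom_coeff_commute[of \<beta>] ac_simps)
qed

definition count_below :: "nat \<Rightarrow> nat set \<Rightarrow> nat" where
  "count_below i u = card {j \<in> u. j < i}"

lemma count_below_eq: "finite u \<Longrightarrow> count_below i u = (\<Sum>j\<in>u. of_bool (j < i))"
  by (simp add: count_below_def Int_def)

lemma count_below_union:
  "finite u \<Longrightarrow> finite v \<Longrightarrow> u \<inter> v = {} \<Longrightarrow> count_below i (u \<union> v) = count_below i u + count_below i v"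
  by (simp only: count_below_eq finite_Un sum.union_disjoint)

lemma inversions_remove_left:
  assumes "i \<in> u" "finite u" "finite v"
  shows "inversions u v = inversions (u - {i}) v + count_below i v"
  using assms unfolding inversions_def
  by (simp only: sum.remove[OF assms(2,1)] count_below_eq add.commute)

text \<open>
  Removing \<open>i\<close> from \<open>v\<close> loses one inversion for each element of \<open>u\<close> above \<open>i\<close>; adding the elements below
  \<open>i\<close> on the left completes this number to the cardinality of \<open>u\<close>.
\<close>

lemma inversions_remove_right:
  assumes "i \<in> v" "i \<notin> u" "finite u" "finite v"
  shows "inversions u v + count_below i u = inversions u (v - {i}) + card u"
proof -
  have "inversions u v = (\<Sum>j\<in>u. of_bool (i < j)) + inversions u (v - {i})"
    unfolding inversions_def by (simp only: sum.remove[OF assms(4,1)] sum.distrib)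
  moreover have "(\<Sum>j\<in>u. of_bool (i < j)) + count_below i u = (\<Sum>j\<in>u. 1)"
    unfolding count_below_eq[OF assms(3)] sum.distrib[symmetric]
    using assms(2) by (intro sum.cong) (auto simp: not_less le_less)
  ultimately show ?thesis by simp
qed

lemma mono_der_odd:
  "n < i \<Longrightarrow> mono_der n i (\<alpha>, u) =
    (if i \<in> u then Poly_Mapping.single (\<alpha>, u - {i}) ((- 1) ^ count_below i u) else 0)"
  by (simp add: mono_der_def count_below_def)

lemma mono_der_even:
  "i \<le> n \<Longrightarrow> mono_der n i (\<alpha>, u) =
    (if Poly_Mapping.lookup \<alpha> i = 0 then 0 else Poly_Mapping.single (\<alpha> - Poly_Mapping.single i 1, u) 1)"
  by (simp add: mono_der_def)

lemma lookup_minus_add: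
  assumes "Poly_Mapping.lookup \<alpha> i \<noteq> (0::nat)"
  shows "\<alpha> - Poly_Mapping.single i 1 + \<beta> = \<alpha> + \<beta> - Poly_Mapping.single i 1"
    and "\<beta> + (\<alpha> - Poly_Mapping.single i 1) = \<beta> + \<alpha> - Poly_Mapping.single i 1"
  using assms by (auto intro!: poly_mapping_eqI simp: lookup_add lookup_minus lookup_single when_def)

lemma mono_leibniz_even:
  assumes "finite u" "finite v" "i \<le> n"
  shows "der n i (mono_mult (\<alpha>, u) (\<beta>, v)) =
    mono_der n i (\<alpha>, u) \<cdot> Poly_Mapping.single (\<beta>, v) 1 + Poly_Mapping.single (\<alpha>, u) 1 \<cdot> mono_der n i (\<beta>, v)"
proof (cases "u \<inter> v = {}")
  case False
  then show ?thesis using assms by (simp add: mono_mult_eq mono_der_even mult_single)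
next
  case d: True
  let ?l = "Poly_Mapping.lookup"
  show ?thesis
  proof (cases "?l (\<alpha> + \<beta>) i = 0")
    case True
    then have "?l \<alpha> i = 0" "?l \<beta> i = 0" by (simp_all add: lookup_add)
    with True show ?thesis using assms d
      by (simp add: mono_mult_eq mono_der_even der_eq_lin_ext)
  next
    case False
    let ?\<gamma> = "\<alpha> + \<beta> - Poly_Mapping.single i 1"
    have "mono_der n i (\<alpha>, u) \<cdot> Poly_Mapping.single (\<beta>, v) 1 = lam_scale
      (of_nat (if ?l \<alpha> i = 0 then 0 else binom_coeff (\<alpha> - Poly_Mapping.single i 1) \<beta>) * (- 1) ^ inversions u v)
      (Poly_Mapping.single (?\<gamma>, u \<union> v) 1 :: 'a lam)"
      using assms d by (simp add: mono_der_even mult_single mono_mult_eq lookup_minus_add del: One_nat_def)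
    moreover have "Poly_Mapping.single (\<alpha>, u) 1 \<cdot> mono_der n i (\<beta>, v) = lam_scale
      (of_nat (if ?l \<beta> i = 0 then 0 else binom_coeff \<alpha> (\<beta> - Poly_Mapping.single i 1)) * (- 1) ^ inversions u v)
      (Poly_Mapping.single (?\<gamma>, u \<union> v) 1 :: 'a lam)"
      using assms d by (simp add: mono_der_even mult_single mono_mult_eq lookup_minus_add del: One_nat_def)
    moreover have "der n i (mono_mult (\<alpha>, u) (\<beta>, v)) = lam_scale
      (of_nat (binom_coeff \<alpha> \<beta>) * (- 1) ^ inversions u v) (Poly_Mapping.single (?\<gamma>, u \<union> v) 1 :: 'a lam)"
      using assms d False by (simp add: mono_mult_eq mono_der_even der_eq_lin_ext)
    ultimately show ?thesis
      unfolding binom_coeff_pascal[OF False] of_nat_add by (simp only: lam.scale_left_distrib distrib_right)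
  qed
qed

text \<open>
  If \<open>i\<close> occurs in exactly one factor, both sides delete it at the same place, and the signs agree by
  the removal rules for inversions. If \<open>i\<close> is the only common index, the product is zero and the two
  terms on the right cancel. With another common index, or without \<open>i\<close>, everything vanishes.
\<close>

lemma mono_leibniz_odd:
  assumes "finite u" "finite v" "n < i"
  shows "der n i (mono_mult (\<alpha>, u) (\<beta>, v)) =
    mono_der n i (\<alpha>, u) \<cdot> Poly_Mapping.single (\<beta>, v) 1
    + lam_scale ((- 1) ^ card u) (Poly_Mapping.single (\<alpha>, u) 1 \<cdot> mono_der n i (\<beta>, v) :: 'a::field lam)"
proof -
  let ?c = "of_nat (binom_coeff \<alpha> \<beta>) :: 'a"
  let ?s = "\<lambda>k. (- 1 :: 'a) ^ k"
  have l: "mono_der n i (\<alpha>, u) \<cdot> Poly_Mapping.single (\<beta>, v) 1 =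
    (if i \<in> u \<and> (u - {i}) \<inter> v = {} then Poly_Mapping.single (\<alpha> + \<beta>, (u - {i}) \<union> v)
      (?s (count_below i u) * (?c * ?s (inversions (u - {i}) v))) else 0)"
    using assms by (simp add: mono_der_odd lam_mult_eq_lin_ext mono_mult_eq)
  have r: "Poly_Mapping.single (\<alpha>, u) 1 \<cdot> mono_der n i (\<beta>, v) =
    (if i \<in> v \<and> u \<inter> (v - {i}) = {} then Poly_Mapping.single (\<alpha> + \<beta>, u \<union> (v - {i}))
      (?s (count_below i v) * (?c * ?s (inversions u (v - {i})))) else 0)"
    using assms by (simp add: mono_der_odd lam_mult_eq_lin_ext mono_mult_eq)
  have m: "der n i (mono_mult (\<alpha>, u) (\<beta>, v)) =
    (if i \<in> u \<union> v \<and> u \<inter> v = {} then Poly_Mapping.single (\<alpha> + \<beta>, u \<union> v - {i})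
      (?c * ?s (inversions u v) * ?s (count_below i (u \<union> v))) else 0)"
    using assms by (simp add: mono_mult_eq der_eq_lin_ext mono_der_odd)
  show ?thesis
  proof (cases "u \<inter> v = {}")
    case d: True
    consider "i \<in> u" "i \<notin> v" | "i \<in> v" "i \<notin> u" | "i \<notin> u" "i \<notin> v" using d by blast
    then show ?thesis
    proof cases
      case 1
      have "?s (inversions u v) * ?s (count_below i (u \<union> v)) =
        ?s (count_below i u) * ?s (inversions (u - {i}) v) * (?s (count_below i v) * ?s (count_below i v))"
        unfolding inversions_remove_left[OF 1(1) assms(1,2)] count_below_union[OF assms(1,2) d]
        by (simp only: power_add ac_simps)
      then have "?s (inversions u v) * ?s (count_below i (u \<union> v)) = ?s (count_below i u) * ?s (inversions (u - {i}) v)"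
        by (simp flip: power_mult_distrib)
      moreover have "u - {i} \<union> v = u \<union> v - {i}" "(u - {i}) \<inter> v = {}" using 1 d by auto
      ultimately show ?thesis unfolding l r m using 1 d by (simp add: ac_simps)
    next
      case 2
      have "?s (inversions u v) * ?s (count_below i (u \<union> v)) =
        ?s (inversions u v + count_below i u) * ?s (count_below i v)"
        unfolding count_below_union[OF assms(1,2) d] by (simp only: power_add ac_simps)
      also have "\<dots> = ?s (card u) * (?s (count_below i v) * ?s (inversions u (v - {i})))"
        unfolding inversions_remove_right[OF 2 assms(1,2)] by (simp only: power_add ac_simps)
      finally have "?s (inversions u v) * ?s (count_below i (u \<union> v)) = \<dots>" .
      moreover have "u \<union> (v - {i}) = u \<union> v - {i}" "u \<inter> (v - {i}) = {}" using 2 d by auto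
      ultimately show ?thesis unfolding l r m using 2 d by (simp add: ac_simps)
    next
      case 3
      then show ?thesis unfolding l r m by simp
    qed
  next
    case nd: False
    show ?thesis
    proof (cases "u \<inter> v = {i}")
      case True
      then have i: "i \<in> u" "i \<in> v" by auto
      define u' where "u' = u - {i}"
      define v' where "v' = v - {i}"
      have f: "finite u'" "finite v'" "u = insert i u'" "v = insert i v'" "i \<notin> u'" "i \<notin> v'"
        using assms i by (auto simp: u'_def v'_def)
      have cu: "count_below i u = count_below i u'" "count_below i v = count_below i v'"
        unfolding f(3,4) count_below_def by (auto intro!: arg_cong[where f = card])
      have a: "inversions u' v + count_below i u' = inversions u' v' + card u'"
        using inversions_remove_right[OF i(2) f(5,1) assms(2)] by (simp add: v'_def)
      have b: "inversions u v' = inversions u' v' + count_below i v'"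
        using inversions_remove_left[OF i(1) assms(1) f(2)] by (simp add: u'_def)
      have cc: "card u = Suc (card u')" using f by simp
      have "?s (count_below i u') * ?s (inversions u' v) = ?s (inversions u' v' + card u')"
        unfolding a[symmetric] by (simp only: power_add ac_simps)
      moreover have "?s (card u) * (?s (count_below i v') * ?s (inversions u v')) =
        - (?s (inversions u' v' + card u') * (?s (count_below i v') * ?s (count_below i v')))"
        unfolding b cc power_add power_Suc by (simp only: ac_simps mult_minus_left mult_1_left mult_minus_right)
      then have "?s (card u) * (?s (count_below i v') * ?s (inversions u v')) = - ?s (inversions u' v' + card u')"
        by (simp flip: power_mult_distrib)
      ultimately have "?s (card u) * (?s (count_below i v) * ?s (inversions u v')) = - (?s (count_below i u) * ?s (inversions u' v))"
        unfolding cu by simp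
      then have "?s (card u) * (?s (count_below i v) * (?c * ?s (inversions u v'))) = - (?s (count_below i u) * (?c * ?s (inversions u' v)))"
        by (simp only: mult.left_commute[of _ ?c] mult_minus_right)
      moreover have "u' \<union> v = u \<union> v'" "u' \<inter> v = {}" "u \<inter> v' = {}" using f True by auto
      ultimately show ?thesis
        unfolding l r m using i nd by (simp flip: u'_def v'_def single_add)
    next
      case False
      then have "\<not> (i \<in> u \<and> (u - {i}) \<inter> v = {})" "\<not> (i \<in> v \<and> u \<inter> (v - {i}) = {})" using nd by auto
      then show ?thesis unfolding l r m using nd by auto
    qed
  qed
qed

text \<open>
  Only the case of two odd indices \<open>i < j\<close> carries a sign: deleting \<open>i\<close> first lowers the number of
  elements below \<open>j\<close> by one, while deleting \<open>j\<close> does not affect the elements below \<open>i\<close>.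
\<close>

lemma mono_der_commute:
  assumes "finite u"
  shows "der n i (mono_der n j (\<alpha>, u)) = lam_scale (sg (tau n i * tau n j)) (der n j (mono_der n i (\<alpha>, u)))"
proof -
  have ev: "der n i (Poly_Mapping.single (\<alpha>, u) c) = (if Poly_Mapping.lookup \<alpha> i = 0 then 0
      else Poly_Mapping.single (\<alpha> - Poly_Mapping.single i 1, u) c)" if "i \<le> n" for \<alpha> u i and c :: 'a
    using that by (simp add: der_eq_lin_ext mono_der_even )
  have od: "der n i (Poly_Mapping.single (\<alpha>, u) c) = (if i \<in> u then
      Poly_Mapping.single (\<alpha>, u - {i}) (c * (- 1) ^ count_below i u) else 0)" if "n < i" for \<alpha> u i and c :: 'a
    using that by (simp add: der_eq_lin_ext mono_der_odd)
  consider "i \<le> n" "j \<le> n" | "i \<le> n" "n < j" | "n < i" "j \<le> n" | "n < i" "n < j" by linarith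
  then show ?thesis
  proof cases
    case 1
    have "\<alpha> - Poly_Mapping.single i 1 - Poly_Mapping.single j 1 = \<alpha> - Poly_Mapping.single j 1 - Poly_Mapping.single i 1"
      by (rule poly_mapping_eqI) (simp add: lookup_minus)
    then show ?thesis using 1
      by (auto simp: mono_der_even ev tau_def lookup_minus lookup_single when_def)
  next
    case 2
    then show ?thesis by (simp add: mono_der_even mono_der_odd ev od tau_def)
  next
    case 3
    then show ?thesis by (simp add: mono_der_even mono_der_odd ev od tau_def)
  next
    case 4
    have *: "(- 1) ^ count_below j u * (- 1) ^ count_below i (u - {j})
      = - ((- 1) ^ count_below i u * (- 1 :: 'a) ^ count_below j (u - {i}))" if "i \<in> u" "j \<in> u" "i < j" for i j
    proof -
      have "count_below i (u - {j}) = count_below i u"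
        unfolding count_below_def using that by (intro arg_cong[where f = card]) auto
      moreover have "count_below j u = Suc (count_below j (u - {i}))"
      proof -
        have "{k \<in> u. k < j} = insert i {k \<in> u - {i}. k < j}" using that by auto
        then show ?thesis unfolding count_below_def using assms by simp
      qed
      ultimately show ?thesis by simp
    qed
    have d: "u - {i} - {j} = u - {j} - {i}" by auto
    show ?thesis
    proof (cases "i \<in> u \<and> j \<in> u \<and> i \<noteq> j")
      case True
      then consider "i < j" | "j < i" by linarith
      then have "(- 1) ^ count_below j u * (- 1) ^ count_below i (u - {j})
        = - ((- 1) ^ count_below i u * (- 1 :: 'a) ^ count_below j (u - {i}))"
        using * True by cases auto
      then show ?thesis using 4 True by (simp add: mono_der_odd od tau_def d single_uminus)
    next
      case False
      then show ?thesis using 4 by (auto simp: mono_der_odd od tau_def)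
    qed
  qed
qed

section \<open>The superalgebra \<open>\<Lambda>(n,n;t)\<close>\<close>

lemmas module_hom_lam = module_hom_iff lam.module_axioms mult_simps der_simps lam_part.add lam_part.scale

definition finite_keys :: "'f::field lam \<Rightarrow> bool" where
  "finite_keys f \<longleftrightarrow> (\<forall>m\<in>Poly_Mapping.keys f. finite (snd m))"

lemma lam_mult_assoc:
  fixes f g h :: "'f::field lam"
  assumes "finite_keys f" "finite_keys g" "finite_keys h"
  shows "f \<cdot> g \<cdot> h = f \<cdot> (g \<cdot> h)"
proof (rule module_hom_eq_on_monomials[of "\<lambda>f. f \<cdot> g \<cdot> h" "\<lambda>f. f \<cdot> (g \<cdot> h)"])
  fix a assume a: "a \<in> Poly_Mapping.keys f"
  let ?a = "Poly_Mapping.single a 1 :: 'f lam"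
  show "?a \<cdot> g \<cdot> h = ?a \<cdot> (g \<cdot> h)"
  proof (rule module_hom_eq_on_monomials[of "\<lambda>g. ?a \<cdot> g \<cdot> h" "\<lambda>g. ?a \<cdot> (g \<cdot> h)"])
    fix b assume b: "b \<in> Poly_Mapping.keys g"
    let ?b = "Poly_Mapping.single b 1 :: 'f lam"
    show "?a \<cdot> ?b \<cdot> h = ?a \<cdot> (?b \<cdot> h)"
    proof (rule module_hom_eq_on_monomials[of "\<lambda>h. ?a \<cdot> ?b \<cdot> h" "\<lambda>h. ?a \<cdot> (?b \<cdot> h)"])
      fix c assume c: "c \<in> Poly_Mapping.keys h"
      show "?a \<cdot> ?b \<cdot> Poly_Mapping.single c 1 = ?a \<cdot> (?b \<cdot> Poly_Mapping.single c 1)"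
        using assms a b c mono_mult_assoc[of "snd a" "snd b" "snd c" "fst a" "fst b" "fst c"]
        by (simp add: mult_single finite_keys_def)
    qed (simp_all add: module_hom_lam)
  qed (simp_all add: module_hom_lam)
qed (simp_all add: module_hom_lam)

lemma lam_mult_commute:
  fixes f g :: "'f::field lam"
  assumes "finite_keys f" "finite_keys g" "lam_homogeneous \<theta> f" "lam_homogeneous \<eta> g"
  shows "g \<cdot> f = lam_scale (sg (\<theta> * \<eta>)) (f \<cdot> g)"
proof (rule module_hom_eq_on_monomials[of "\<lambda>f. g \<cdot> f" "\<lambda>f. lam_scale (sg (\<theta> * \<eta>)) (f \<cdot> g)"])
  fix a assume a: "a \<in> Poly_Mapping.keys f"
  let ?a = "Poly_Mapping.single a 1 :: 'f lam"
  show "g \<cdot> ?a = lam_scale (sg (\<theta> * \<eta>)) (?a \<cdot> g)"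
  proof (rule module_hom_eq_on_monomials[of "\<lambda>g. g \<cdot> ?a" "\<lambda>g. lam_scale (sg (\<theta> * \<eta>)) (?a \<cdot> g)"])
    fix b assume b: "b \<in> Poly_Mapping.keys g"
    show "Poly_Mapping.single b 1 \<cdot> ?a = lam_scale (sg (\<theta> * \<eta>)) (?a \<cdot> Poly_Mapping.single b 1)"
      using assms a b mono_mult_commute[of "snd a" "snd b" "fst b" "fst a"]
      by (simp add: mult_single finite_keys_def lam_homogeneous_def)
  qed (simp_all add: module_hom_lam lam.scale_right_distrib mult.commute)
qed (simp_all add: module_hom_lam lam.scale_right_distrib mult.commute)

lemma lam_leibniz:
  fixes f g :: "'f::field lam"
  assumes "finite_keys f" "finite_keys g" "lam_homogeneous \<theta> f"
  shows "der n i (f \<cdot> g) = der n i f \<cdot> g + lam_scale (sg (tau n i * \<theta>)) (f \<cdot> der n i g)"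
proof (rule module_hom_eq_on_monomials[of "\<lambda>f. der n i (f \<cdot> g)"
      "\<lambda>f. der n i f \<cdot> g + lam_scale (sg (tau n i * \<theta>)) (f \<cdot> der n i g)"])
  fix a assume a: "a \<in> Poly_Mapping.keys f"
  let ?a = "Poly_Mapping.single a 1 :: 'f lam"
  show "der n i (?a \<cdot> g) = der n i ?a \<cdot> g + lam_scale (sg (tau n i * \<theta>)) (?a \<cdot> der n i g)"
  proof (rule module_hom_eq_on_monomials[of "\<lambda>g. der n i (?a \<cdot> g)"
        "\<lambda>g. der n i ?a \<cdot> g + lam_scale (sg (tau n i * \<theta>)) (?a \<cdot> der n i g)"])
    fix b assume b: "b \<in> Poly_Mapping.keys g"
    have fin: "finite (snd a)" "finite (snd b)" and p: "\<theta> = of_nat (card (snd a))"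
      using assms a b by (auto simp: finite_keys_def lam_homogeneous_def mono_parity_def)
    show "der n i (?a \<cdot> Poly_Mapping.single b 1) = der n i ?a \<cdot> Poly_Mapping.single b 1
        + lam_scale (sg (tau n i * \<theta>)) (?a \<cdot> der n i (Poly_Mapping.single b 1))"
    proof (cases "i \<le> n")
      case True
      then show ?thesis
        using mono_leibniz_even[OF fin True, of "fst a" "fst b"] by (simp add: mult_single der_single tau_def)
    next
      case False
      then have "n < i" by simp
      then show ?thesis
        using mono_leibniz_odd[OF fin \<open>n < i\<close>, of "fst a" "fst b"] unfolding p
        by (simp only: mult_single der_single tau_def prod.collapse sg_of_nat mult_1_left if_False not_le[symmetric] if_not_P)
    qed
  qed (simp_all add: module_hom_lam lam.scale_right_distrib algebra_simps)
qed (simp_all add: module_hom_lam lam.scale_right_distrib algebra_simps)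

lemma der_commute:
  fixes f :: "'f::field lam"
  assumes "finite_keys f"
  shows "der n i (der n j f) = lam_scale (sg (tau n i * tau n j)) (der n j (der n i f))"
proof (rule module_hom_eq_on_monomials[of "\<lambda>f. der n i (der n j f)"
      "\<lambda>f. lam_scale (sg (tau n i * tau n j)) (der n j (der n i f))"])
  fix a assume "a \<in> Poly_Mapping.keys f"
  then show "der n i (der n j (Poly_Mapping.single a 1)) =
      lam_scale (sg (tau n i * tau n j)) (der n j (der n i (Poly_Mapping.single a 1 :: 'f lam)))"
    using assms mono_der_commute[of "snd a" n i j "fst a"] by (simp add: der_single finite_keys_def)
qed (simp_all add: module_hom_lam lam.scale_right_distrib mult.commute)

lemma subspace_keys: "lam.subspace {f :: 'f::field lam. \<forall>m\<in>Poly_Mapping.keys f. Q m}"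
proof (rule lam.subspaceI)
  fix f g :: "'f lam" assume "f \<in> {f. \<forall>m\<in>Poly_Mapping.keys f. Q m}" "g \<in> {f. \<forall>m\<in>Poly_Mapping.keys f. Q m}"
  then show "f + g \<in> {f. \<forall>m\<in>Poly_Mapping.keys f. Q m}" using keys_add[of f g] by blast
next
  fix c and f :: "'f lam" assume "f \<in> {f. \<forall>m\<in>Poly_Mapping.keys f. Q m}"
  then show "lam_scale c f \<in> {f. \<forall>m\<in>Poly_Mapping.keys f. Q m}" using keys_lam_scale[of c f] by blast
qed simp

lemma subspace_homogeneous: "lam.subspace {f. lam_homogeneous \<theta> f}"
  unfolding lam_homogeneous_def by (rule subspace_keys)

lemma subspace_Lam: "lam.subspace (Lam n t)"
  unfolding Lam_def by (rule subspace_keys)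

lemma finite_keys_Lam:
  assumes "f \<in> Lam n t" shows "finite_keys f"
  unfolding finite_keys_def
proof
  fix m assume "m \<in> Poly_Mapping.keys f"
  then have "snd m \<subseteq> {n+1..2*n}" using assms unfolding Lam_def by (cases m) auto
  then show "finite (snd m)" by (rule finite_subset) simp
qed

lemma lam_homogeneous_single: "mono_parity m = \<theta> \<Longrightarrow> lam_homogeneous \<theta> (Poly_Mapping.single m c)"
  by (simp add: lam_homogeneous_def)

lemma lam_homogeneous_closed:
  fixes f g :: "'f::field lam"
  shows "lam_homogeneous \<theta> (0 :: 'f lam)"
    and "lam_homogeneous \<theta> f \<Longrightarrow> lam_homogeneous \<theta> g \<Longrightarrow> lam_homogeneous \<theta> (f + g)"
    and "lam_homogeneous \<theta> f \<Longrightarrow> lam_homogeneous \<theta> g \<Longrightarrow> lam_homogeneous \<theta> (f - g)"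
    and "lam_homogeneous \<theta> f \<Longrightarrow> lam_homogeneous \<theta> (lam_scale c f)"
    and "(\<And>i. i \<in> I \<Longrightarrow> lam_homogeneous \<theta> (F i)) \<Longrightarrow> lam_homogeneous \<theta> (sum F I :: 'f lam)"
  using lam.subspace_0[OF subspace_homogeneous] lam.subspace_add[OF subspace_homogeneous]
    lam.subspace_diff[OF subspace_homogeneous] lam.subspace_scale[OF subspace_homogeneous]
    lam.subspace_sum[OF subspace_homogeneous, of I F] by blast+

lemma Lam_closed:
  fixes f g :: "'f::field lam"
  shows "(0 :: 'f lam) \<in> Lam n t" and "f \<in> Lam n t \<Longrightarrow> g \<in> Lam n t \<Longrightarrow> f + g \<in> Lam n t"
    and "f \<in> Lam n t \<Longrightarrow> g \<in> Lam n t \<Longrightarrow> f - g \<in> Lam n t"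
    and "f \<in> Lam n t \<Longrightarrow> lam_scale c f \<in> Lam n t"
    and "(\<And>i. i \<in> I \<Longrightarrow> F i \<in> Lam n t) \<Longrightarrow> (sum F I :: 'f lam) \<in> Lam n t"
  by (rule lam.subspace_0[OF subspace_Lam] lam.subspace_add[OF subspace_Lam] lam.subspace_diff[OF subspace_Lam]
    lam.subspace_scale[OF subspace_Lam] lam.subspace_sum[OF subspace_Lam]; assumption)+

lemma der_homogeneous:
  assumes "finite_keys f" "lam_homogeneous \<theta> f"
  shows "lam_homogeneous (\<theta> + tau n i) (der n i f)"
proof -
  have "der n i f \<in> {f. lam_homogeneous (\<theta> + tau n i) f}"
    unfolding der_eq_lin_ext
  proof (rule lin_ext_in_subspace[OF subspace_homogeneous])
    fix m assume "m \<in> Poly_Mapping.keys f"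
    then have m: "finite (snd m)" "of_nat (card (snd m)) = \<theta>"
      using assms by (auto simp: finite_keys_def lam_homogeneous_def mono_parity_def)
    obtain \<alpha> u where [simp]: "m = (\<alpha>, u)" by (cases m)
    have fin: "finite u" and p: "of_nat (card u) = \<theta>" using m by simp_all
    show "mono_der n i m \<in> {f. lam_homogeneous (\<theta> + tau n i) f}"
    proof (cases "i \<le> n")
      case True
      then show ?thesis using p
        by (simp add: mono_der_even tau_def mono_parity_def lam_homogeneous_closed lam_homogeneous_single)
    next
      case False
      have "of_nat (card (u - {i})) = \<theta> + 1" if "i \<in> u"
      proof -
        have "of_nat (Suc (card (u - {i}))) = \<theta>" unfolding card_Suc_Diff1[OF fin that] by (rule p)
        then have "\<theta> = of_nat (card (u - {i})) + 1" by (simp only: of_nat_Suc add.commute)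
        then show ?thesis by (simp only: add.assoc bit_add_self add_0_right)
      qed
      then show ?thesis using False
        by (simp add: mono_der_odd tau_def mono_parity_def lam_homogeneous_closed lam_homogeneous_single)
    qed
  qed
  then show ?thesis by simp
qed

lemma mult_homogeneous:
  assumes "finite_keys f" "finite_keys g" "lam_homogeneous \<theta> f" "lam_homogeneous \<eta> g"
  shows "lam_homogeneous (\<theta> + \<eta>) (f \<cdot> g)"
proof -
  have "f \<cdot> g \<in> {f. lam_homogeneous (\<theta> + \<eta>) f}"
    unfolding lam_mult_eq_lin_ext
  proof (intro lin_ext_in_subspace[OF subspace_homogeneous])
    fix a b assume ab: "a \<in> Poly_Mapping.keys f" "b \<in> Poly_Mapping.keys g"
    then have ab: "finite (snd a)" "finite (snd b)" "mono_parity a = \<theta>" "mono_parity b = \<eta>"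
      using assms by (auto simp: finite_keys_def lam_homogeneous_def)
    have "mono_parity (\<gamma>, snd a \<union> snd b) = \<theta> + \<eta>" if "snd a \<inter> snd b = {}" for \<gamma>
      using mono_parity_union[OF ab(1,2) that, of \<gamma> "fst a" "fst b"] ab(3,4) by (simp only: prod.collapse)
    then have "lam_homogeneous (\<theta> + \<eta>) (mono_mult (fst a, snd a) (fst b, snd b))"
      unfolding mono_mult_eq[OF ab(1,2)]
      by (cases "snd a \<inter> snd b = {}") (simp_all only: if_True if_False refl lam_homogeneous_closed lam_homogeneous_single)
    then show "mono_mult a b \<in> {f. lam_homogeneous (\<theta> + \<eta>) f}" by simp
  qed
  then show ?thesis by simp
qed

lemma der_Lam:
  fixes f :: "'a::field lam"
  assumes "f \<in> Lam n t" shows "der n i f \<in> Lam n t"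
  unfolding der_eq_lin_ext
proof (rule lin_ext_in_subspace[OF subspace_Lam])
  fix m assume m: "m \<in> Poly_Mapping.keys f"
  obtain \<alpha> u where [simp]: "m = (\<alpha>, u)" by (cases m)
  have *: "\<alpha> \<in> exponents CHAR('a) n t" "u \<subseteq> {n+1..2*n}" using assms m by (auto simp: Lam_def)
  have "\<alpha> - Poly_Mapping.single i 1 \<in> exponents CHAR('a) n t"
  proof -
    have "Poly_Mapping.keys (\<alpha> - Poly_Mapping.single i 1) \<subseteq> Poly_Mapping.keys \<alpha>"
      by (auto simp: in_keys_iff lookup_minus)
    moreover have "Poly_Mapping.lookup (\<alpha> - Poly_Mapping.single i 1) j \<le> Poly_Mapping.lookup \<alpha> j" for j
      by (simp add: lookup_minus)
    ultimately show ?thesis using *(1) unfolding exponents_def by (blast intro: order_trans)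
  qed
  moreover have "u - {i} \<subseteq> {n+1..2*n}" using *(2) by blast
  ultimately show "(mono_der n i m :: 'a lam) \<in> Lam n t"
    using * by (auto simp: mono_der_def Lam_closed) (auto simp: Lam_def)
qed

text \<open>
  The key to \<open>\<Lambda>(n,n;t)\<close> being closed under multiplication: by \<open>prime_dvd_choose_carry\<close> below, the
  binomial coefficient vanishes modulo \<open>p\<close> as soon as an exponent leaves the permitted range.
\<close>

lemma prime_dvd_choose_power:
  assumes "prime (p::nat)" "0 < k" "k < p ^ e"
  shows "p dvd (p ^ e choose k)"
proof (rule ccontr)
  assume "\<not> p dvd (p ^ e choose k)"
  then have "coprime (p ^ e) (p ^ e choose k)"
    using assms(1) by (simp add: prime_imp_coprime)
  moreover have "p ^ e dvd k * (p ^ e choose k)"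
    by (subst times_binomial_minus1_eq[OF assms(2)]) simp
  ultimately have "p ^ e dvd k" by (simp add: coprime_dvd_mult_left_iff)
  then show False using assms(2,3) by (simp add: nat_dvd_not_less)
qed

text \<open>
  Write \<open>a + b = p\<^sup>e + r\<close> and expand by Vandermonde's identity: the term with \<open>k = 0\<close> vanishes because
  \<open>r < a\<close>, and in all others \<open>p\<close> divides the first factor.
\<close>

lemma prime_dvd_choose_carry:
  assumes p: "prime (p::nat)" and ab: "a < p ^ e" "b < p ^ e" "p ^ e \<le> a + b"
  shows "p dvd ((a + b) choose a)"
proof -
  define r where "r = a + b - p ^ e"
  have r: "a + b = p ^ e + r" "r < a" using ab by (auto simp: r_def)
  have "p dvd (\<Sum>k\<le>a. (p ^ e choose k) * (r choose (a - k)))"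
  proof (rule dvd_sum)
    fix k assume "k \<in> {..a}"
    show "p dvd (p ^ e choose k) * (r choose (a - k))"
    proof (cases "k = 0")
      case True
      then show ?thesis using r(2) by (simp add: binomial_eq_0)
    next
      case False
      then show ?thesis using prime_dvd_choose_power[OF p, of k e] \<open>k \<in> {..a}\<close> ab(1) by simp
    qed
  qed
  then show ?thesis unfolding r(1) vandermonde .
qed

lemma mult_Lam:
  fixes f g :: "'f::field lam"
  assumes "f \<in> Lam n t" "g \<in> Lam n t" "prime CHAR('f)"
  shows "f \<cdot> g \<in> Lam n t"
  unfolding lam_mult_eq_lin_ext
proof (intro lin_ext_in_subspace[OF subspace_Lam])
  fix a b assume ab: "a \<in> Poly_Mapping.keys f" "b \<in> Poly_Mapping.keys g"
  obtain \<alpha> u \<beta> v where [simp]: "a = (\<alpha>, u)" "b = (\<beta>, v)" by (cases a; cases b)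
  let ?p = "CHAR('f)"
  have *: "\<alpha> \<in> exponents ?p n t" "u \<subseteq> {n+1..2*n}" "\<beta> \<in> exponents ?p n t" "v \<subseteq> {n+1..2*n}"
    using assms ab by (auto simp: Lam_def)
  have fin: "finite u" "finite v" using * by (auto intro: finite_subset)
  have keys: "Poly_Mapping.keys (\<alpha> + \<beta>) \<subseteq> {1..n}" using * by (auto simp: keys_sum_nat exponents_def)
  show "(mono_mult a b :: 'f lam) \<in> Lam n t"
  proof (cases "\<alpha> + \<beta> \<in> exponents ?p n t")
    case True
    then show ?thesis using * fin by (auto simp: mono_mult_eq Lam_closed) (auto simp: Lam_def)
  next
    case False
    then obtain i where i: "i \<in> {1..n}" "?p ^ t i - 1 < Poly_Mapping.lookup \<alpha> i + Poly_Mapping.lookup \<beta> i"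
      using keys by (auto simp: exponents_def lookup_add not_le)
    have pos: "0 < ?p ^ t i" using assms(3) by (simp add: prime_gt_0_nat)
    have lt: "Poly_Mapping.lookup \<alpha> i < ?p ^ t i" "Poly_Mapping.lookup \<beta> i < ?p ^ t i"
      using * i(1) pos by (auto simp: exponents_def Suc_le_eq[symmetric] le_diff_conv2 dest!: bspec[of _ _ i])
    have "?p dvd (Poly_Mapping.lookup \<alpha> i + Poly_Mapping.lookup \<beta> i) choose Poly_Mapping.lookup \<alpha> i"
      using i(2) pos by (intro prime_dvd_choose_carry[OF assms(3) lt]) auto
    moreover have "binom_coeff \<alpha> \<beta> = (\<Prod>i\<in>{1..n}. (Poly_Mapping.lookup \<alpha> i + Poly_Mapping.lookup \<beta> i) choose Poly_Mapping.lookup \<alpha> i)"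
      using * by (intro binom_coeff_superset) (auto simp: exponents_def)
    ultimately have "?p dvd binom_coeff \<alpha> \<beta>" using i(1) by (simp add: dvd_prodI[THEN dvd_trans[rotated]])
    then have "(of_nat (binom_coeff \<alpha> \<beta>) :: 'f) = 0" by (simp add: of_nat_eq_0_iff_char_dvd)
    then show ?thesis using fin by (simp add: mono_mult_eq Lam_closed)
  qed
qed

lemma lam_part_homogeneous: "lam_homogeneous \<theta> (lam_part \<theta> f)"
proof -
  have "lam_part \<theta> f \<in> {f. lam_homogeneous \<theta> f}"
    unfolding lam_part_eq_lin_ext
    by (rule lin_ext_in_subspace[OF subspace_homogeneous]) (auto simp: lam_homogeneous_closed intro: lam_homogeneous_single)
  then show ?thesis by simp
qed

lemma lam_part_Lam: "f \<in> Lam n t \<Longrightarrow> lam_part \<theta> f \<in> Lam n t"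
  unfolding lam_part_eq_lin_ext
  by (rule lin_ext_in_subspace[OF subspace_Lam]) (auto simp: Lam_def)

lemma lam_part_of_homogeneous: "lam_homogeneous \<eta> f \<Longrightarrow> lam_part \<theta> f = (if \<theta> = \<eta> then f else 0)"
proof -
  assume "lam_homogeneous \<eta> f"
  then have "lam_part \<theta> f = (\<Sum>m\<in>Poly_Mapping.keys f. if \<theta> = \<eta> then Poly_Mapping.single m (Poly_Mapping.lookup f m) else 0)"
    unfolding lam_part_def lam_homogeneous_def by (intro sum.cong) auto
  also have "\<dots> = (if \<theta> = \<eta> then lin_ext (\<lambda>m. Poly_Mapping.single m 1) f else 0)"
    by (simp add: lin_ext_def)
  finally show ?thesis unfolding lin_ext_single_1 .
qed

lemma lam_part_sum: "lam_part 0 f + lam_part 1 f = f"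
proof -
  have "lam_part 0 f + lam_part 1 f = lin_ext (\<lambda>m. Poly_Mapping.single m 1) f"
    unfolding lam_part_eq_lin_ext lin_ext_def sum.distrib[symmetric]
  proof (rule sum.cong)
    fix m
    show "lam_scale (Poly_Mapping.lookup f m) (if mono_parity m = 0 then Poly_Mapping.single m 1 else 0) +
        lam_scale (Poly_Mapping.lookup f m) (if mono_parity m = 1 then Poly_Mapping.single m 1 else 0) =
        lam_scale (Poly_Mapping.lookup f m) (Poly_Mapping.single m 1)"
      using bit_cases[of "mono_parity m"] by auto
  qed simp
  then show ?thesis unfolding lin_ext_single_1 .
qed

section \<open>The superalgebra \<open>W(n,n;t)\<close>\<close>

text \<open>
  The superderivation \<open>\<Sum>\<^sub>i f\<^sub>i D\<^sub>i\<close> of the algebra, obtained from its family of coefficients.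
\<close>

definition act :: "nat \<Rightarrow> 'f::field wit \<Rightarrow> 'f lam \<Rightarrow> 'f lam" where
  "act n X f = (\<Sum>i\<in>{1..2*n}. Poly_Mapping.lookup X i \<cdot> der n i f)"

lemma act_scale: "act n X (lam_scale c f) = lam_scale c (act n X f)"
  and act_diff: "act n X (f - g) = act n X f - act n X g"
  and act_sum: "act n X (sum F I) = (\<Sum>i\<in>I. act n X (F i))"
proof -
  interpret a: module_hom lam_scale lam_scale "act n X"
    by (simp add: module_hom_lam act_def sum.distrib lam.scale_sum_right)
  show "act n X (lam_scale c f) = lam_scale c (act n X f)"
    "act n X (f - g) = act n X f - act n X g" "act n X (sum F I) = (\<Sum>i\<in>I. act n X (F i))"
    by (rule a.scale a.diff a.sum)+
qed

definition witt :: "nat \<Rightarrow> (nat \<Rightarrow> nat) \<Rightarrow> 'f::field wit set" where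
  "witt n t = {X. \<forall>i. Poly_Mapping.lookup X i \<in> Lam n t \<and> (i \<notin> {1..2*n} \<longrightarrow> Poly_Mapping.lookup X i = 0)}"

lemma witt_Lam: "X \<in> witt n t \<Longrightarrow> Poly_Mapping.lookup X i \<in> Lam n t"
  by (simp add: witt_def)

lemma witt_zero: "X \<in> witt n t \<Longrightarrow> i \<notin> {1..2*n} \<Longrightarrow> Poly_Mapping.lookup X i = 0"
  by (simp add: witt_def)

lemma witt_eqI:
  assumes "X \<in> witt n t" "Y \<in> witt n t"
    "\<And>i. i \<in> {1..2*n} \<Longrightarrow> Poly_Mapping.lookup X i = Poly_Mapping.lookup Y i"
  shows "X = Y"
proof (rule poly_mapping_eqI)
  show "Poly_Mapping.lookup X i = Poly_Mapping.lookup Y i" for i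
    using assms(3) witt_zero[OF assms(1)] witt_zero[OF assms(2)] by (cases "i \<in> {1..2*n}") auto
qed

lemma subspace_witt: "wit.subspace (witt n t)"
  by (rule wit.subspaceI)
    (simp_all add: witt_def lookup_add Lam_closed)

lemma subspace_wit_homogeneous: "wit.subspace {X. wit_homogeneous n \<theta> X}"
  by (rule wit.subspaceI) (auto simp: wit_homogeneous_def lookup_add lam_homogeneous_closed)

lemma bracket_term_simps:
  "bracket_term n \<theta> 0 i \<eta> g j = 0" "bracket_term n \<theta> f i \<eta> 0 j = 0"
  by (auto simp: bracket_term_def der.zero mult_left.zero mult_right.zero)

lemma wit_scale_single: "wit_scale c (Poly_Mapping.single i f) = Poly_Mapping.single i (lam_scale c f)"
  by (auto intro!: poly_mapping_eqI simp: lookup_single when_def)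

lemma bracket_add_left: "bracket n (X + X') Y = bracket n X Y + bracket n X' Y"
  and bracket_add_right: "bracket n X (Y + Y') = bracket n X Y + bracket n X Y'"
  and bracket_scale_left: "bracket n (wit_scale c X) Y = wit_scale c (bracket n X Y)"
  and bracket_scale_right: "bracket n X (wit_scale c Y) = wit_scale c (bracket n X Y)"
proof -
  have b: "bracket_term n \<theta> (f + f') i \<eta> g j = bracket_term n \<theta> f i \<eta> g j + bracket_term n \<theta> f' i \<eta> g j"
    "bracket_term n \<theta> f i \<eta> (g + g') j = bracket_term n \<theta> f i \<eta> g j + bracket_term n \<theta> f i \<eta> g' j"
    "bracket_term n \<theta> (lam_scale c f) i \<eta> g j = wit_scale c (bracket_term n \<theta> f i \<eta> g j)"
    "bracket_term n \<theta> f i \<eta> (lam_scale c g) j = wit_scale c (bracket_term n \<theta> f i \<eta> g j)"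
    for \<theta> f f' i \<eta> and g g' :: "'a lam" and j
    by (simp_all add: bracket_term_def mult_simps der_simps single_add wit.scale_right_distrib
        wit.scale_right_diff_distrib wit_scale_single mult.commute)
  show "bracket n (X + X') Y = bracket n X Y + bracket n X' Y"
    "bracket n X (Y + Y') = bracket n X Y + bracket n X Y'"
    "bracket n (wit_scale c X) Y = wit_scale c (bracket n X Y)"
    "bracket n X (wit_scale c Y) = wit_scale c (bracket n X Y)"
    by (simp_all only: bracket_def lookup_add lookup_wit_scale lam_part.add lam_part.scale b sum.distrib
        wit.scale_sum_right)
qed

lemma tau_double: "\<theta> + tau n i + tau n i = \<theta>"
  using bit_cases[of "tau n i"] by (elim disjE) (simp_all add: add.assoc)

text \<open>
  For homogeneous elements the bracket is determined coefficientwise by the action: the coefficient of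
  \<open>[X,Y]\<close> at \<open>D\<^sub>k\<close> is \<open>X(Y\<^sub>k) \<plusminus> Y(X\<^sub>k)\<close>. This replaces the sum over generators and homogeneous parts in
  all later computations.
\<close>

lemma lookup_bracket:
  assumes "wit_homogeneous n a X" "wit_homogeneous n b Y"
  shows "Poly_Mapping.lookup (bracket n X Y) k = (if k \<in> {1..2*n} then
    act n X (Poly_Mapping.lookup Y k) - lam_scale (sg (a * b)) (act n Y (Poly_Mapping.lookup X k)) else 0)"
proof -
  define s :: 'a where "s = sg (a * b)"
  let ?X = "Poly_Mapping.lookup X" and ?Y = "Poly_Mapping.lookup Y"
  have c: "(\<Sum>\<theta>\<in>{0, 1}. \<Sum>\<eta>\<in>{0, 1}. bracket_term n \<theta> (lam_part \<theta> (?X i)) i \<eta> (lam_part \<eta> (?Y j)) j)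
    = bracket_term n (a + tau n i) (?X i) i (b + tau n j) (?Y j) j" if "i \<in> {1..2*n}" "j \<in> {1..2*n}" for i j
  proof -
    have h: "lam_homogeneous (a + tau n i) (?X i)" "lam_homogeneous (b + tau n j) (?Y j)"
      using assms that unfolding wit_homogeneous_def by blast+
    show ?thesis
      unfolding lam_part_of_homogeneous[OF h(1)] lam_part_of_homogeneous[OF h(2)]
      using bit_cases[of "a + tau n i"] bit_cases[of "b + tau n j"]
      by (elim disjE) (simp_all only: finite.emptyI finite_insert sum.insert sum.empty singleton_iff empty_iff zero_neq_one
          not_False_eq_True if_True if_False bracket_term_simps add_0_left add_0_right refl zero_neq_one[symmetric])
  qed
  have "bracket n X Y = (\<Sum>i\<in>{1..2*n}. \<Sum>j\<in>{1..2*n}. bracket_term n (a + tau n i) (?X i) i (b + tau n j) (?Y j) j)"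
    unfolding bracket_def by (intro sum.cong refl c)
  also have "\<dots> = (\<Sum>i\<in>{1..2*n}. \<Sum>j\<in>{1..2*n}. Poly_Mapping.single j (?X i \<cdot> der n i (?Y j)) -
      Poly_Mapping.single i (lam_scale s (?Y j \<cdot> der n j (?X i))))"
    by (simp only: bracket_term_def tau_double wit_scale_single s_def)
  finally have "Poly_Mapping.lookup (bracket n X Y) k = (\<Sum>i\<in>{1..2*n}. \<Sum>j\<in>{1..2*n}.
      (?X i \<cdot> der n i (?Y j) when j = k) - (lam_scale s (?Y j \<cdot> der n j (?X i)) when i = k))"
    by (simp add: lookup_sum lookup_minus lookup_single)
  also have "\<dots> = (\<Sum>i\<in>{1..2*n}. \<Sum>j\<in>{1..2*n}. (?X i \<cdot> der n i (?Y j) when j = k))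
    - (\<Sum>j\<in>{1..2*n}. \<Sum>i\<in>{1..2*n}. (lam_scale s (?Y j \<cdot> der n j (?X i)) when i = k))"
    unfolding sum_subtractf by (subst (3) sum.swap) (rule refl)
  also have "\<dots> = (if k \<in> {1..2*n} then act n X (?Y k) - lam_scale s (act n Y (?X k)) else 0)"
    by (auto simp: act_def lam.scale_sum_right when_def intro!: sum.neutral)
  finally show ?thesis unfolding s_def .
qed

text \<open>
  The argument \<open>F\<close> only fixes the coefficient field, whose characteristic delimits the exponents.
\<close>

locale witt_superalgebra =
  fixes n :: nat and t :: "nat \<Rightarrow> nat" and F :: "'f::field itself"
  assumes prime_char: "prime CHAR('f)"
begin

abbreviation "\<Lambda> \<equiv> Lam n t :: 'f lam set"
abbreviation "W \<equiv> witt n t :: 'f wit set"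
abbreviation "Y\<^sub>n \<equiv> {1..2*n}"

lemma mult_\<Lambda>: "f \<in> \<Lambda> \<Longrightarrow> g \<in> \<Lambda> \<Longrightarrow> f \<cdot> g \<in> \<Lambda>"
  by (rule mult_Lam[OF _ _ prime_char])

lemma act_\<Lambda>: "X \<in> W \<Longrightarrow> f \<in> \<Lambda> \<Longrightarrow> act n X f \<in> \<Lambda>"
  unfolding act_def by (intro Lam_closed mult_\<Lambda> der_Lam witt_Lam)

lemma act_homogeneous:
  assumes "X \<in> W" "wit_homogeneous n a X" "f \<in> \<Lambda>" "lam_homogeneous \<theta> f"
  shows "lam_homogeneous (a + \<theta>) (act n X f)"
  unfolding act_def
proof (rule lam_homogeneous_closed)
  fix i assume "i \<in> Y\<^sub>n"
  then have "lam_homogeneous ((a + tau n i) + (\<theta> + tau n i)) (Poly_Mapping.lookup X i \<cdot> der n i f)"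
    using assms by (intro mult_homogeneous der_homogeneous finite_keys_Lam[of _ n t] der_Lam witt_Lam)
      (auto simp: wit_homogeneous_def)
  moreover have "(a + tau n i) + (\<theta> + tau n i) = a + \<theta>"
    using tau_double[of "a + \<theta>" n i] by (simp only: ac_simps)
  ultimately show "lam_homogeneous (a + \<theta>) (Poly_Mapping.lookup X i \<cdot> der n i f)" by simp
qed

lemma mult_assoc: "f \<in> \<Lambda> \<Longrightarrow> g \<in> \<Lambda> \<Longrightarrow> h \<in> \<Lambda> \<Longrightarrow> f \<cdot> g \<cdot> h = f \<cdot> (g \<cdot> h)"
  by (intro lam_mult_assoc finite_keys_Lam)

lemma mult_commute:
  "f \<in> \<Lambda> \<Longrightarrow> g \<in> \<Lambda> \<Longrightarrow> lam_homogeneous \<theta> f \<Longrightarrow> lam_homogeneous \<eta> g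
    \<Longrightarrow> g \<cdot> f = lam_scale (sg (\<theta> * \<eta>)) (f \<cdot> g)"
  by (intro lam_mult_commute finite_keys_Lam)

lemma mult_left_commute:
  assumes "f \<in> \<Lambda>" "g \<in> \<Lambda>" "h \<in> \<Lambda>" "lam_homogeneous \<theta> f" "lam_homogeneous \<eta> g"
  shows "g \<cdot> (f \<cdot> h) = lam_scale (sg (\<theta> * \<eta>)) (f \<cdot> (g \<cdot> h))"
  using mult_commute[OF assms(1,2,4,5)] assms
  by (simp add: mult_simps flip: mult_assoc)

lemma act_leibniz:
  assumes "X \<in> W" "wit_homogeneous n a X" "f \<in> \<Lambda>" "lam_homogeneous \<theta> f" "g \<in> \<Lambda>"
  shows "act n X (f \<cdot> g) = act n X f \<cdot> g + lam_scale (sg (a * \<theta>)) (f \<cdot> act n X g)"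
proof -
  let ?X = "Poly_Mapping.lookup X"
  have "?X i \<cdot> der n i (f \<cdot> g) = ?X i \<cdot> der n i f \<cdot> g + lam_scale (sg (a * \<theta>)) (f \<cdot> (?X i \<cdot> der n i g))"
    if i: "i \<in> Y\<^sub>n" for i
  proof -
    have h: "lam_homogeneous (a + tau n i) (?X i)" using assms(2) i by (simp add: wit_homogeneous_def)
    note mem = witt_Lam[OF assms(1)] assms(3,5) der_Lam[OF assms(3)] der_Lam[OF assms(5)]
    have "der n i (f \<cdot> g) = der n i f \<cdot> g + lam_scale (sg (tau n i * \<theta>)) (f \<cdot> der n i g)"
      using assms by (intro lam_leibniz finite_keys_Lam)
    then have "?X i \<cdot> der n i (f \<cdot> g) = ?X i \<cdot> der n i f \<cdot> g + lam_scale (sg (tau n i * \<theta>)) (?X i \<cdot> (f \<cdot> der n i g))"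
      using mem by (simp add: mult_simps mult_assoc)
    also have "?X i \<cdot> (f \<cdot> der n i g) = lam_scale (sg (\<theta> * (a + tau n i))) (f \<cdot> (?X i \<cdot> der n i g))"
      by (rule mult_left_commute[OF mem(2,1,5) assms(4) h])
    finally show ?thesis
      using bit_cases[of "tau n i"] bit_cases[of \<theta>] bit_cases[of a] by (elim disjE) simp_all
  qed
  then show ?thesis
    by (simp add: act_def sum.distrib mult_left.sum mult_right.sum lam.scale_sum_right)
qed

lemma bracket_W:
  assumes "X \<in> W" "wit_homogeneous n a X" "Y \<in> W" "wit_homogeneous n b Y"
  shows "bracket n X Y \<in> W" "wit_homogeneous n (a + b) (bracket n X Y)"
proof -
  note l = lookup_bracket[OF assms(2,4)]
  note mem = witt_Lam[OF assms(1)] witt_Lam[OF assms(3)]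
  have "act n X (Poly_Mapping.lookup Y i) - lam_scale (sg (a * b)) (act n Y (Poly_Mapping.lookup X i)) \<in> \<Lambda>" for i
    by (intro Lam_closed act_\<Lambda> assms mem)
  then show "bracket n X Y \<in> W"
    unfolding witt_def mem_Collect_eq l by (auto simp only: if_True if_False Lam_closed(1) split: if_split)
  show "wit_homogeneous n (a + b) (bracket n X Y)"
    unfolding wit_homogeneous_def
  proof
    fix i assume i: "i \<in> Y\<^sub>n"
    have h: "lam_homogeneous (a + tau n i) (Poly_Mapping.lookup X i)"
      "lam_homogeneous (b + tau n i) (Poly_Mapping.lookup Y i)"
      using assms i by (auto simp: wit_homogeneous_def)
    have "lam_homogeneous (a + b + tau n i) (act n X (Poly_Mapping.lookup Y i))"
      "lam_homogeneous (a + b + tau n i) (act n Y (Poly_Mapping.lookup X i))"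
      using act_homogeneous[OF assms(1,2) mem(2) h(2)] act_homogeneous[OF assms(3,4) mem(1) h(1)]
      by (simp_all only: ac_simps)
    then show "lam_homogeneous (a + b + tau n i) (Poly_Mapping.lookup (bracket n X Y) i)"
      using i by (simp add: l lam_homogeneous_closed)
  qed
qed

text \<open>
  In \<open>X(Y(f))\<close> the second-order part is \<open>\<Sum>\<^sub>i\<^sub>j \<plusminus> Y\<^sub>j X\<^sub>i D\<^sub>i D\<^sub>j f\<close>. Since coefficients supercommute and
  derivations supercommute, it is supersymmetric in \<open>X\<close> and \<open>Y\<close> and cancels in the supercommutator;
  the first-order part is the action of the bracket.
\<close>

lemma act_bracket:
  assumes X: "X \<in> W" "wit_homogeneous n a X" and Y: "Y \<in> W" "wit_homogeneous n b Y" and f: "f \<in> \<Lambda>"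
  shows "act n (bracket n X Y) f = act n X (act n Y f) - lam_scale (sg (a * b)) (act n Y (act n X f))"
proof -
  let ?l = Poly_Mapping.lookup
  define B where "B a X b Y = (\<Sum>j\<in>Y\<^sub>n. lam_scale (sg (a * (b + tau n j))) (?l Y j \<cdot> act n X (der n j f)))"
    for a b and X Y :: "'f wit"
  have E: "act n X (act n Y f) = (\<Sum>j\<in>Y\<^sub>n. act n X (?l Y j) \<cdot> der n j f) + B a X b Y"
    if X: "X \<in> W" "wit_homogeneous n a X" and Y: "Y \<in> W" "wit_homogeneous n b Y" for X Y a b
  proof -
    have "act n X (act n Y f) = (\<Sum>j\<in>Y\<^sub>n. act n X (?l Y j \<cdot> der n j f))"
      unfolding act_def[of n Y f] act_sum ..
    also have "\<dots> = (\<Sum>j\<in>Y\<^sub>n. act n X (?l Y j) \<cdot> der n j f + lam_scale (sg (a * (b + tau n j))) (?l Y j \<cdot> act n X (der n j f)))"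
      using that f by (intro sum.cong refl act_leibniz witt_Lam der_Lam) (auto simp: wit_homogeneous_def)
    finally show ?thesis by (simp add: sum.distrib B_def)
  qed
  have "B a X b Y = (\<Sum>j\<in>Y\<^sub>n. \<Sum>i\<in>Y\<^sub>n. lam_scale (sg (a * (b + tau n j))) (?l Y j \<cdot> (?l X i \<cdot> der n i (der n j f))))"
    unfolding B_def act_def by (simp add: mult_simps lam.scale_sum_right)
  also have "\<dots> = (\<Sum>j\<in>Y\<^sub>n. \<Sum>i\<in>Y\<^sub>n. lam_scale (sg (a * b)) (lam_scale (sg (b * (a + tau n i))) (?l X i \<cdot> (?l Y j \<cdot> der n j (der n i f)))))"
  proof (intro sum.cong refl)
    fix i j assume ij: "i \<in> Y\<^sub>n" "j \<in> Y\<^sub>n"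
    have h: "lam_homogeneous (a + tau n i) (?l X i)" "lam_homogeneous (b + tau n j) (?l Y j)"
      using X Y ij by (auto simp: wit_homogeneous_def)
    have d: "der n i (der n j f) = lam_scale (sg (tau n i * tau n j)) (der n j (der n i f))"
      by (rule der_commute[OF finite_keys_Lam[OF f]])
    have "?l Y j \<cdot> (?l X i \<cdot> der n j (der n i f)) =
      lam_scale (sg ((a + tau n i) * (b + tau n j))) (?l X i \<cdot> (?l Y j \<cdot> der n j (der n i f)))"
      using X Y h f by (intro mult_left_commute witt_Lam der_Lam)
    then show "lam_scale (sg (a * (b + tau n j))) (?l Y j \<cdot> (?l X i \<cdot> der n i (der n j f))) =
      lam_scale (sg (a * b)) (lam_scale (sg (b * (a + tau n i))) (?l X i \<cdot> (?l Y j \<cdot> der n j (der n i f))))"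
      unfolding d mult_simps
      using bit_cases[of "tau n i"] bit_cases[of "tau n j"] bit_cases[of b] bit_cases[of a] by (elim disjE) simp_all
  qed
  also have "\<dots> = lam_scale (sg (a * b)) (B b Y a X)"
    unfolding B_def act_def by (subst sum.swap) (simp add: mult_simps lam.scale_sum_right)
  finally have B: "B a X b Y = lam_scale (sg (a * b)) (B b Y a X)" .
  have "act n (bracket n X Y) f = (\<Sum>j\<in>Y\<^sub>n. act n X (?l Y j) \<cdot> der n j f)
    - lam_scale (sg (a * b)) (\<Sum>j\<in>Y\<^sub>n. act n Y (?l X j) \<cdot> der n j f)"
    unfolding act_def[of n "bracket n X Y"]
    by (simp add: lookup_bracket[OF X(2) Y(2)] mult_simps sum_subtractf lam.scale_sum_right)
  then show ?thesis
    unfolding E[OF X Y] E[OF Y X] B by (simp add: lam.scale_right_distrib)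
qed

lemma bracket_skew:
  assumes "X \<in> W" "wit_homogeneous n a X" "Y \<in> W" "wit_homogeneous n b Y"
  shows "bracket n X Y = - wit_scale (sg (a * b)) (bracket n Y X)"
  by (rule poly_mapping_eqI)
    (use bit_cases[of a] bit_cases[of b] in \<open>elim disjE; simp add: lookup_bracket[OF assms(2,4)] lookup_bracket[OF assms(4,2)]\<close>)

text \<open>
  Coefficientwise, this is the Jacobi identity for supercommutators of operators, by \<open>act_bracket\<close>.
\<close>

lemma bracket_jacobi:
  assumes X: "X \<in> W" "wit_homogeneous n a X" and Y: "Y \<in> W" "wit_homogeneous n b Y"
    and Z: "Z \<in> W" "wit_homogeneous n c Z"
  shows "bracket n X (bracket n Y Z) =
    bracket n (bracket n X Y) Z + wit_scale (sg (a * b)) (bracket n Y (bracket n X Z))"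
proof (rule poly_mapping_eqI)
  fix k
  let ?l = Poly_Mapping.lookup
  note YZ = bracket_W[OF Y Z] and XY = bracket_W[OF X Y] and XZ = bracket_W[OF X Z]
  note L = witt_Lam[OF X(1), of k] witt_Lam[OF Y(1), of k] witt_Lam[OF Z(1), of k]
  show "?l (bracket n X (bracket n Y Z)) k =
    ?l (bracket n (bracket n X Y) Z + wit_scale (sg (a * b)) (bracket n Y (bracket n X Z))) k"
  proof (cases "k \<in> Y\<^sub>n")
    case True
    have e1: "?l (bracket n X (bracket n Y Z)) k =
      act n X (act n Y (?l Z k)) - lam_scale (sg (b * c)) (act n X (act n Z (?l Y k)))
      - lam_scale (sg (a * (b + c))) (act n Y (act n Z (?l X k)) - lam_scale (sg (b * c)) (act n Z (act n Y (?l X k))))"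
      unfolding lookup_bracket[OF X(2) YZ(2)] lookup_bracket[OF Y(2) Z(2)] act_bracket[OF Y Z L(1)]
      by (simp only: True if_True act_diff act_scale)
    have e2: "?l (bracket n (bracket n X Y) Z) k =
      act n X (act n Y (?l Z k)) - lam_scale (sg (a * b)) (act n Y (act n X (?l Z k)))
      - lam_scale (sg ((a + b) * c)) (act n Z (act n X (?l Y k)) - lam_scale (sg (a * b)) (act n Z (act n Y (?l X k))))"
      unfolding lookup_bracket[OF XY(2) Z(2)] lookup_bracket[OF X(2) Y(2)] act_bracket[OF X Y L(3)]
      by (simp only: True if_True act_diff act_scale)
    have e3: "?l (bracket n Y (bracket n X Z)) k =
      act n Y (act n X (?l Z k)) - lam_scale (sg (a * c)) (act n Y (act n Z (?l X k)))
      - lam_scale (sg (b * (a + c))) (act n X (act n Z (?l Y k)) - lam_scale (sg (a * c)) (act n Z (act n X (?l Y k))))"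
      unfolding lookup_bracket[OF Y(2) XZ(2)] lookup_bracket[OF X(2) Z(2)] act_bracket[OF X Z L(2)]
      by (simp only: True if_True act_diff act_scale)
    show ?thesis
      unfolding lookup_add lookup_wit_scale e1 e2 e3
      using bit_cases[of a] bit_cases[of b] bit_cases[of c] by (elim disjE) simp_all
  next
    case False
    then show ?thesis
      unfolding lookup_add lookup_wit_scale lookup_bracket[OF X(2) YZ(2)] lookup_bracket[OF XY(2) Z(2)] lookup_bracket[OF Y(2) XZ(2)]
      by (simp only: if_False lam.scale_zero_right add_0_left)
  qed
qed

end

section \<open>Odd Hamiltonian fields and divergence\<close>

lemma dual_index_in: "k \<in> {1..2*n} \<Longrightarrow> dual_index n k \<in> {1..2*n}"
  by (auto simp: dual_index_def)

lemma dual_index_dual: "k \<in> {1..2*n} \<Longrightarrow> dual_index n (dual_index n k) = k"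
  by (auto simp: dual_index_def)

lemma tau_dual: "k \<in> {1..2*n} \<Longrightarrow> tau n (dual_index n k) = tau n k + 1"
  by (auto simp: dual_index_def tau_def)

lemma sum_dual_index: "(\<Sum>i\<in>{1..2*n}. G (dual_index n i)) = (\<Sum>i\<in>{1..2*n}. G i)"
  by (rule sum.reindex_bij_witness[of _ "dual_index n" "dual_index n"])
    (simp_all only: dual_index_in dual_index_dual)

lemma sum_bit_delta: "(\<Sum>\<theta>\<in>{0, 1}. if \<theta> = (c::bit) then G \<theta> else 0) = G c"
  using bit_cases[of c] by (elim disjE) simp_all

lemma module_hom_T_H: "module_hom lam_scale wit_scale (T_H n)"
proof -
  have "T_H n (f + g) = T_H n f + T_H n g" for f g :: "'a lam"
    by (simp only: T_H_def lam_part.add der.add single_add wit.scale_right_distrib sum.distrib)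
  moreover have "T_H n (lam_scale c f) = wit_scale c (T_H n f)" for c and f :: "'a lam"
    by (simp only: T_H_def lam_part.scale der.scale wit_scale_single[symmetric] wit.scale_scale wit.scale_sum_right mult.commute)
  ultimately show ?thesis by (simp add: module_hom_iff lam.module_axioms wit.module_axioms)
qed

interpretation T_H: module_hom lam_scale wit_scale "T_H n"
  by (rule module_hom_T_H)

lemma lookup_T_H:
  assumes "lam_homogeneous \<theta> f"
  shows "Poly_Mapping.lookup (T_H n f) k = (if k \<in> {1..2*n} then
    lam_scale (sg (tau n (dual_index n k) * \<theta>)) (der n (dual_index n k) f) else 0)"
proof -
  let ?d = "dual_index n"
  have "T_H n f = (\<Sum>i\<in>{1..2*n}. \<Sum>\<theta>'\<in>{0, 1}. if \<theta>' = \<theta> then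
      wit_scale (sg (tau n i * \<theta>')) (Poly_Mapping.single (?d i) (der n i f)) else 0)"
    unfolding T_H_def lam_part_of_homogeneous[OF assms]
    by (intro sum.cong refl) (simp only: if_distrib der.zero single_zero wit.scale_zero_right split: if_split, simp)
  also have "\<dots> = (\<Sum>i\<in>{1..2*n}. Poly_Mapping.single (?d i) (lam_scale (sg (tau n i * \<theta>)) (der n i f)))"
    by (simp only: sum_bit_delta wit_scale_single)
  finally have "Poly_Mapping.lookup (T_H n f) k =
      (\<Sum>i\<in>{1..2*n}. (lam_scale (sg (tau n i * \<theta>)) (der n i f) when ?d i = k))"
    by (simp only: lookup_sum lookup_single)
  also have "\<dots> = (\<Sum>i\<in>{1..2*n}. if i = ?d k \<and> k \<in> {1..2*n} then lam_scale (sg (tau n (?d k) * \<theta>)) (der n (?d k) f) else 0)"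
  proof (rule sum.cong[OF refl])
    fix i assume "i \<in> {1..2*n}"
    then have "?d i = k \<longleftrightarrow> i = ?d k \<and> k \<in> {1..2*n}"
      using dual_index_dual[of _ n] dual_index_in[of _ n] by metis
    then show "(lam_scale (sg (tau n i * \<theta>)) (der n i f) when ?d i = k) =
      (if i = ?d k \<and> k \<in> {1..2*n} then lam_scale (sg (tau n (?d k) * \<theta>)) (der n (?d k) f) else 0)"
      by (auto simp only: when_def split: if_split)
  qed
  also have "\<dots> = (if k \<in> {1..2*n} then lam_scale (sg (tau n (?d k) * \<theta>)) (der n (?d k) f) else 0)"
  proof (cases "k \<in> {1..2*n}")
    case True
    then show ?thesis using dual_index_in[OF True] by (simp only: simp_thms sum.delta finite_atLeastAtMost if_True)
  qed (simp only: simp_thms if_False sum.neutral_const)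
  finally show ?thesis .
qed

lemma divergence_add: "divergence n (X + Y) = divergence n X + divergence n Y"
  by (simp only: divergence_def lookup_add lam_part.add der.add lam.scale_right_distrib sum.distrib)

lemma divergence_scale: "divergence n (wit_scale c X) = lam_scale c (divergence n X)"
  by (simp only: divergence_def lookup_wit_scale lam_part.scale der.scale lam.scale_scale lam.scale_sum_right mult.commute)

lemma divergence_homogeneous:
  assumes "wit_homogeneous n a X"
  shows "divergence n X = (\<Sum>i\<in>{1..2*n}. lam_scale (sg (tau n i * (a + tau n i))) (der n i (Poly_Mapping.lookup X i)))"
  unfolding divergence_def
proof (rule sum.cong[OF refl])
  fix i assume "i \<in> {1..2*n}"
  then have h: "lam_homogeneous (a + tau n i) (Poly_Mapping.lookup X i)"
    using assms unfolding wit_homogeneous_def by blast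
  have "(\<Sum>\<theta>\<in>{0, 1}. lam_scale (sg (tau n i * \<theta>)) (der n i (lam_part \<theta> (Poly_Mapping.lookup X i)))) =
    (\<Sum>\<theta>\<in>{0, 1}. if \<theta> = a + tau n i then lam_scale (sg (tau n i * \<theta>)) (der n i (Poly_Mapping.lookup X i)) else 0)"
    unfolding lam_part_of_homogeneous[OF h]
    by (intro sum.cong refl) (simp only: der.zero lam.scale_zero_right split: if_split, simp)
  then show "(\<Sum>\<theta>\<in>{0, 1}. lam_scale (sg (tau n i * \<theta>)) (der n i (lam_part \<theta> (Poly_Mapping.lookup X i)))) =
    lam_scale (sg (tau n i * (a + tau n i))) (der n i (Poly_Mapping.lookup X i))"
    unfolding sum_bit_delta .
qed

text \<open>
  The shape of \<open>SHO\<close> itself, for an arbitrary subspace \<open>V\<close>; applied to \<open>SHO'\<close> and to its derived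
  algebras, it lets the theory of graded ideals be used on each of them.
\<close>

definition sub_superalgebra :: "nat \<Rightarrow> 'f::field wit set \<Rightarrow> ('f, 'f wit) superalgebra" where
  "sub_superalgebra n V = \<lparr>sspace = V, spart = (\<lambda>\<theta>. {X \<in> V. wit_homogeneous n \<theta> X}),
     sscale = wit_scale, sbracket = bracket n\<rparr>"

lemma SHO_eq: "SHO n t = sub_superalgebra n (bracket_span n (SHO_bar n t))"
  by (simp add: SHO_def sub_superalgebra_def Let_def)

context witt_superalgebra
begin

lemma T_H_witt:
  assumes "f \<in> \<Lambda>" "lam_homogeneous \<theta> f"
  shows "T_H n f \<in> W"
proof -
  have "lam_scale c (der n i f) \<in> \<Lambda>" for c i
    by (intro Lam_closed der_Lam assms)
  then show ?thesis
    unfolding witt_def mem_Collect_eq lookup_T_H[OF assms(2)]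
    by (auto simp only: if_True if_False Lam_closed(1) split: if_split)
qed

lemma T_H_homogeneous:
  assumes "f \<in> \<Lambda>" "lam_homogeneous \<theta> f"
  shows "wit_homogeneous n (\<theta> + 1) (T_H n f)"
  unfolding wit_homogeneous_def
proof
  fix k assume k: "k \<in> Y\<^sub>n"
  have "lam_homogeneous (\<theta> + tau n (dual_index n k)) (der n (dual_index n k) f)"
    by (rule der_homogeneous[OF finite_keys_Lam[OF assms(1)] assms(2)])
  moreover have "\<theta> + tau n (dual_index n k) = \<theta> + 1 + tau n k"
    unfolding tau_dual[OF k] by (simp only: ac_simps)
  ultimately show "lam_homogeneous (\<theta> + 1 + tau n k) (Poly_Mapping.lookup (T_H n f) k)"
    unfolding lookup_T_H[OF assms(2)] by (simp only: k if_True lam_homogeneous_closed)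
qed

text \<open>
  The supercommutator of \<open>D\<^sub>j\<close> with the field \<open>X\<close> is the field whose coefficients are the \<open>D\<^sub>j(X\<^sub>i)\<close>.
\<close>

lemma der_act:
  assumes X: "X \<in> W" "wit_homogeneous n a X" and f: "f \<in> \<Lambda>"
  shows "der n j (act n X f) =
    (\<Sum>i\<in>Y\<^sub>n. der n j (Poly_Mapping.lookup X i) \<cdot> der n i f) + lam_scale (sg (tau n j * a)) (act n X (der n j f))"
proof -
  let ?X = "Poly_Mapping.lookup X"
  have "der n j (?X i \<cdot> der n i f) =
      der n j (?X i) \<cdot> der n i f + lam_scale (sg (tau n j * a)) (?X i \<cdot> der n i (der n j f))"
    if i: "i \<in> Y\<^sub>n" for i
  proof -
    have "lam_homogeneous (a + tau n i) (?X i)" using X(2) i unfolding wit_homogeneous_def by blast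
    then have l: "der n j (?X i \<cdot> der n i f) =
      der n j (?X i) \<cdot> der n i f + lam_scale (sg (tau n j * (a + tau n i))) (?X i \<cdot> der n j (der n i f))"
      by (intro lam_leibniz finite_keys_Lam[of _ n t] witt_Lam[OF X(1)] der_Lam f)
    show ?thesis
      unfolding l der_commute[OF finite_keys_Lam[OF f], of n j i] mult_simps
      using bit_cases[of "tau n i"] bit_cases[of "tau n j"] bit_cases[of a] by (elim disjE) simp_all
  qed
  then show ?thesis
    by (simp add: act_def der.sum sum.distrib lam.scale_sum_right)
qed

text \<open>
  At \<open>D\<^sub>k\<close>, expand \<open>D\<^sub>j\<close> of \<open>T\<^sub>H(f)(g)\<close> with \<open>j\<close> dual to \<open>k\<close> by \<open>der_act\<close>. One part is the action of \<open>T\<^sub>H(f)\<close> on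
  a coefficient of \<open>T\<^sub>H(g)\<close>; the other becomes the action of \<open>T\<^sub>H(g)\<close> on a coefficient of \<open>T\<^sub>H(f)\<close> after
  exchanging every index with its dual.
\<close>

lemma T_H_bracket:
  assumes f: "f \<in> \<Lambda>" "lam_homogeneous \<theta> f" and g: "g \<in> \<Lambda>" "lam_homogeneous \<eta> g"
  shows "bracket n (T_H n f) (T_H n g) = T_H n (act n (T_H n f) g)"
proof -
  let ?l = Poly_Mapping.lookup and ?d = "dual_index n"
  let ?X = "T_H n f" and ?Y = "T_H n g"
  note X = T_H_witt[OF f] T_H_homogeneous[OF f] and Y = T_H_witt[OF g] T_H_homogeneous[OF g]
  note h = act_\<Lambda>[OF X(1) g(1)] act_homogeneous[OF X g]
  show ?thesis
  proof (rule witt_eqI[OF bracket_W(1)[OF X Y] T_H_witt[OF h]])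
    fix k assume k: "k \<in> Y\<^sub>n"
    define j where "j = ?d k"
    define s where "s = tau n j"
    have 1: "?l (bracket n ?X ?Y) k = lam_scale (sg (s * \<eta>)) (act n ?X (der n j g))
      - lam_scale (sg ((\<theta> + 1) * (\<eta> + 1))) (lam_scale (sg (s * \<theta>)) (act n ?Y (der n j f)))"
      unfolding lookup_bracket[OF X(2) Y(2)] lookup_T_H[OF f(2)] lookup_T_H[OF g(2)] j_def s_def
      by (simp only: k if_True act_scale)
    have 2: "?l (T_H n (act n ?X g)) k = lam_scale (sg (s * (\<theta> + 1 + \<eta>)))
      ((\<Sum>i\<in>Y\<^sub>n. der n j (?l ?X i) \<cdot> der n i g) + lam_scale (sg (s * (\<theta> + 1))) (act n ?X (der n j g)))"
      unfolding lookup_T_H[OF h(2)] der_act[OF X g(1)] j_def s_def by (simp only: k if_True)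
    have "act n ?Y (der n j f) = (\<Sum>i\<in>Y\<^sub>n. ?l ?Y (?d i) \<cdot> der n (?d i) (der n j f))"
      unfolding act_def by (rule sum_dual_index[symmetric])
    also have "\<dots> = (\<Sum>i\<in>Y\<^sub>n. lam_scale (sg (\<theta> * \<eta> + \<theta> + \<eta> + s + s * \<eta>)) (der n j (?l ?X i) \<cdot> der n i g))"
    proof (rule sum.cong[OF refl])
      fix i assume i: "i \<in> Y\<^sub>n"
      define r where "r = tau n i"
      have d: "der n (?d i) (der n j f) = lam_scale (sg ((r + 1) * s)) (der n j (der n (?d i) f))"
        using der_commute[OF finite_keys_Lam[OF f(1)], of n "?d i" j] unfolding tau_dual[OF i] r_def s_def .
      have "lam_homogeneous (\<theta> + tau n (?d i) + s) (der n j (der n (?d i) f))"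
        unfolding s_def by (intro der_homogeneous finite_keys_Lam[of _ n t] der_Lam f)
      then have "der n i g \<cdot> der n j (der n (?d i) f) =
          lam_scale (sg ((\<theta> + (r + 1) + s) * (\<eta> + r))) (der n j (der n (?d i) f) \<cdot> der n i g)"
        unfolding tau_dual[OF i] r_def by (intro mult_commute der_Lam f g der_homogeneous finite_keys_Lam[of _ n t])
      then have c: "der n i g \<cdot> der n (?d i) (der n j f) =
          lam_scale (sg ((r + 1) * s)) (lam_scale (sg ((\<theta> + (r + 1) + s) * (\<eta> + r))) (der n j (der n (?d i) f) \<cdot> der n i g))"
        unfolding d mult_simps by simp
      have Yi: "?l ?Y (?d i) = lam_scale (sg (r * \<eta>)) (der n i g)"
        unfolding lookup_T_H[OF g(2)] dual_index_dual[OF i] r_def by (simp only: dual_index_in[OF i] if_True)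
      have Xi: "?l ?X i = lam_scale (sg ((r + 1) * \<theta>)) (der n (?d i) f)"
        unfolding lookup_T_H[OF f(2)] tau_dual[OF i] r_def by (simp only: i if_True)
      show "?l ?Y (?d i) \<cdot> der n (?d i) (der n j f) =
        lam_scale (sg (\<theta> * \<eta> + \<theta> + \<eta> + s + s * \<eta>)) (der n j (?l ?X i) \<cdot> der n i g)"
        unfolding Yi Xi mult_simps der_simps c
        using bit_cases[of r] bit_cases[of s] bit_cases[of \<theta>] bit_cases[of \<eta>] by (elim disjE) simp_all
    qed
    finally have 3: "act n ?Y (der n j f) = lam_scale (sg (\<theta> * \<eta> + \<theta> + \<eta> + s + s * \<eta>)) (\<Sum>i\<in>Y\<^sub>n. der n j (?l ?X i) \<cdot> der n i g)"
      by (simp only: lam.scale_sum_right)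
    show "?l (bracket n ?X ?Y) k = ?l (T_H n (act n ?X g)) k"
      unfolding 1 2 3
      using bit_cases[of s] bit_cases[of \<theta>] bit_cases[of \<eta>] by (elim disjE) simp_all
  qed
qed

lemma divergence_part:
  assumes "X \<in> W" "wit_homogeneous n a X"
  shows "divergence n X \<in> \<Lambda>" "lam_homogeneous a (divergence n X)"
proof -
  show "divergence n X \<in> \<Lambda>"
    unfolding divergence_homogeneous[OF assms(2)] by (intro Lam_closed der_Lam witt_Lam[OF assms(1)])
  show "lam_homogeneous a (divergence n X)"
    unfolding divergence_homogeneous[OF assms(2)]
  proof (rule lam_homogeneous_closed(5))
    fix i assume "i \<in> Y\<^sub>n"
    then have "lam_homogeneous (a + tau n i + tau n i) (der n i (Poly_Mapping.lookup X i))"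
      using assms(2) unfolding wit_homogeneous_def
      by (intro der_homogeneous finite_keys_Lam[of _ n t] witt_Lam[OF assms(1)]) blast
    then show "lam_homogeneous a (lam_scale (sg (tau n i * (a + tau n i))) (der n i (Poly_Mapping.lookup X i)))"
      unfolding tau_double by (rule lam_homogeneous_closed(4))
  qed
qed

text \<open>
  The terms \<open>D\<^sub>j(X\<^sub>i) D\<^sub>i(Y\<^sub>j)\<close> that are not covered by the right-hand side are supersymmetric in \<open>X\<close> and
  \<open>Y\<close>, as exchanging the summation indices shows, so they cancel.
\<close>

lemma divergence_bracket:
  assumes X: "X \<in> W" "wit_homogeneous n a X" and Y: "Y \<in> W" "wit_homogeneous n b Y"
  shows "divergence n (bracket n X Y) = act n X (divergence n Y) - lam_scale (sg (a * b)) (act n Y (divergence n X))"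
proof -
  let ?l = Poly_Mapping.lookup
  define R where "R X Y = (\<Sum>j\<in>Y\<^sub>n. \<Sum>i\<in>Y\<^sub>n. lam_scale (sg (tau n j * (a + b + tau n j))) (der n j (?l X i) \<cdot> der n i (?l Y j)))"
    for X Y :: "'f wit"
  have E: "(\<Sum>j\<in>Y\<^sub>n. lam_scale (sg (tau n j * (a + b + tau n j))) (der n j (act n X (?l Y j)))) =
      R X Y + act n X (divergence n Y)"
    if X: "X \<in> W" "wit_homogeneous n c X" and Y: "Y \<in> W" "wit_homogeneous n d Y" and cd: "c + d = a + b" for X Y c d
  proof -
    have "lam_scale (sg (tau n j * (a + b + tau n j))) (der n j (act n X (?l Y j))) =
      (\<Sum>i\<in>Y\<^sub>n. lam_scale (sg (tau n j * (a + b + tau n j))) (der n j (?l X i) \<cdot> der n i (?l Y j))) +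
      act n X (lam_scale (sg (tau n j * (d + tau n j))) (der n j (?l Y j)))" for j
      unfolding der_act[OF X witt_Lam[OF Y(1)]] cd[symmetric] lam.scale_right_distrib lam.scale_sum_right act_scale
      using bit_cases[of "tau n j"] bit_cases[of c] bit_cases[of d] by (elim disjE) simp_all
    then show ?thesis
      unfolding R_def divergence_homogeneous[OF Y(2)] act_sum by (simp only: sum.distrib)
  qed
  have R: "R X Y = lam_scale (sg (a * b)) (R Y X)"
  proof -
    have "R X Y = (\<Sum>j\<in>Y\<^sub>n. \<Sum>i\<in>Y\<^sub>n. lam_scale (sg (a * b))
      (lam_scale (sg (tau n i * (a + b + tau n i))) (der n i (?l Y j) \<cdot> der n j (?l X i))))"
      unfolding R_def
    proof (intro sum.cong refl)
      fix i j assume ij: "i \<in> Y\<^sub>n" "j \<in> Y\<^sub>n"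
      have "lam_homogeneous (a + tau n i + tau n j) (der n j (?l X i))"
        "lam_homogeneous (b + tau n j + tau n i) (der n i (?l Y j))"
        using X Y ij unfolding wit_homogeneous_def
        by (blast intro: der_homogeneous finite_keys_Lam[of _ n t] witt_Lam[OF X(1)] witt_Lam[OF Y(1)])+
      then have "der n i (?l Y j) \<cdot> der n j (?l X i) =
        lam_scale (sg ((a + tau n i + tau n j) * (b + tau n j + tau n i))) (der n j (?l X i) \<cdot> der n i (?l Y j))"
        by (intro mult_commute der_Lam witt_Lam[OF X(1)] witt_Lam[OF Y(1)])
      then show "lam_scale (sg (tau n j * (a + b + tau n j))) (der n j (?l X i) \<cdot> der n i (?l Y j)) =
        lam_scale (sg (a * b)) (lam_scale (sg (tau n i * (a + b + tau n i))) (der n i (?l Y j) \<cdot> der n j (?l X i)))"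
        using bit_cases[of "tau n j"] bit_cases[of "tau n i"] bit_cases[of a] bit_cases[of b] by (elim disjE) simp_all
    qed
    then show ?thesis unfolding R_def by (subst sum.swap) (simp only: lam.scale_sum_right)
  qed
  have "divergence n (bracket n X Y) =
      (\<Sum>j\<in>Y\<^sub>n. lam_scale (sg (tau n j * (a + b + tau n j))) (der n j (act n X (?l Y j)))) -
      lam_scale (sg (a * b)) (\<Sum>j\<in>Y\<^sub>n. lam_scale (sg (tau n j * (a + b + tau n j))) (der n j (act n Y (?l X j))))"
    unfolding divergence_homogeneous[OF bracket_W(2)[OF X Y]] lookup_bracket[OF X(2) Y(2)]
    by (simp add: der_simps lam.scale_right_diff_distrib sum_subtractf lam.scale_sum_right mult.commute[of "sg (a * b)"]
      del: bit_not_zero_iff bit_not_one_iff)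
  then show ?thesis
    unfolding E[OF X Y refl] E[OF Y X add.commute] R by (simp only: lam.scale_right_distrib add_diff_add diff_self add_0_left) 
qed

section \<open>The chain of subalgebras leading to \<open>SHO\<close>\<close>

lemma lam_homogeneous_both: "lam_homogeneous a f \<Longrightarrow> lam_homogeneous (a + 1) f \<Longrightarrow> f = (0 :: 'f lam)"
  unfolding lam_homogeneous_def keys_eq_empty[symmetric]
  using bit_cases[of a] by (elim disjE) fastforce+

lemma homogeneous_components_zero:
  fixes f g :: "'f lam"
  assumes "lam_homogeneous 0 f" "lam_homogeneous 1 g" "f + g = 0"
  shows "f = 0" "g = 0"
proof -
  have "f = - g" using assms(3) by (simp add: eq_neg_iff_add_eq_0)
  then have "lam_homogeneous 1 f"
    using lam_homogeneous_closed(4)[OF assms(2), of "- 1"] by simp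
  then show "f = 0" using lam_homogeneous_both[of 0 f] assms(1) by simp
  then show "g = 0" using assms(3) by simp
qed

definition graded_subalgebra :: "'f wit set \<Rightarrow> bool" where
  "graded_subalgebra V \<longleftrightarrow> wit.subspace V \<and> V \<subseteq> W \<and>
     (\<forall>X\<in>V. \<exists>Y\<in>V. \<exists>Z\<in>V. wit_homogeneous n 0 Y \<and> wit_homogeneous n 1 Z \<and> X = Y + Z) \<and>
     (\<forall>X\<in>V. \<forall>Y\<in>V. bracket n X Y \<in> V)"

lemma lie_superalgebra_sub_superalgebra:
  assumes "graded_subalgebra V"
  shows "lie_superalgebra (sub_superalgebra n V)"
proof -
  have V: "wit.subspace V" "V \<subseteq> W"
    and dec: "\<And>X. X \<in> V \<Longrightarrow> \<exists>Y\<in>V. \<exists>Z\<in>V. wit_homogeneous n 0 Y \<and> wit_homogeneous n 1 Z \<and> X = Y + Z"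
    and closed: "\<And>X Y. X \<in> V \<Longrightarrow> Y \<in> V \<Longrightarrow> bracket n X Y \<in> V"
    using assms unfolding graded_subalgebra_def by blast+
  have zero: "X = 0" if X: "X \<in> V" "wit_homogeneous n 0 X" "wit_homogeneous n 1 X" for X
  proof (rule witt_eqI)
    show "X \<in> W" "0 \<in> W" using V X(1) wit.subspace_0[OF V(1)] by blast+
    fix i assume "i \<in> Y\<^sub>n"
    then have "lam_homogeneous (tau n i) (Poly_Mapping.lookup X i)" "lam_homogeneous (tau n i + 1) (Poly_Mapping.lookup X i)"
      using X(2,3) unfolding wit_homogeneous_def by (auto simp only: add_0_left add.commute)
    then show "Poly_Mapping.lookup X i = Poly_Mapping.lookup 0 i"
      using lam_homogeneous_both by (simp only: lookup_zero)
  qed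
  have parts: "wit.subspace {X \<in> V. wit_homogeneous n \<theta> X}" for \<theta>
    using wit.subspace_inter[OF V(1) subspace_wit_homogeneous[of n \<theta>]] by (simp only: Int_def mem_Collect_eq)
  have [simp]: "sspace (sub_superalgebra n V) = V" "sscale (sub_superalgebra n V) = wit_scale"
    "sbracket (sub_superalgebra n V) = bracket n"
    "spart (sub_superalgebra n V) \<theta> = {X \<in> V. wit_homogeneous n \<theta> X}" for \<theta>
    by (simp_all only: sub_superalgebra_def superalgebra.simps)
  show ?thesis
  proof (intro lie_superalgebra.intro lie_superalgebra_axioms.intro; (simp only: superalgebra.simps)?)
    show "vector_space (sscale (sub_superalgebra n V))" by (simp add: wit.vector_space_axioms)
  next
    show "module.subspace (sscale (sub_superalgebra n V)) (sspace (sub_superalgebra n V))" by (simp add: V)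
  next
    show "module.subspace (sscale (sub_superalgebra n V)) (spart (sub_superalgebra n V) \<theta>)" for \<theta> by (simp add: parts)
  next
    show "spart (sub_superalgebra n V) \<theta> \<subseteq> sspace (sub_superalgebra n V)" for \<theta> by auto
  next
    show "\<exists>y\<in>spart (sub_superalgebra n V) 0. \<exists>z\<in>spart (sub_superalgebra n V) 1. x = y + z"
      if "x \<in> sspace (sub_superalgebra n V)" for x
      using dec[of x] that by auto
  next
    show "spart (sub_superalgebra n V) 0 \<inter> spart (sub_superalgebra n V) 1 \<subseteq> {0}" using zero by auto
  next
    show "sbracket (sub_superalgebra n V) x y \<in> spart (sub_superalgebra n V) (a + b)"
      if "x \<in> spart (sub_superalgebra n V) a" "y \<in> spart (sub_superalgebra n V) b" for x y a b
      using that closed[of x y] bracket_W(2)[of x a y b] V(2)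
      by (simp add: subset_iff del: bit_not_zero_iff bit_not_one_iff)
  next
    show "sbracket (sub_superalgebra n V) x y = - sscale (sub_superalgebra n V) (sg (a * b)) (sbracket (sub_superalgebra n V) y x)"
      if "x \<in> spart (sub_superalgebra n V) a" "y \<in> spart (sub_superalgebra n V) b" for x y a b
    proof -
      have "x \<in> W" "wit_homogeneous n a x" "y \<in> W" "wit_homogeneous n b y" using that V(2) by auto
      from bracket_skew[OF this] show ?thesis by simp
    qed
  next
    show "sbracket (sub_superalgebra n V) x (sbracket (sub_superalgebra n V) y z) =
        sbracket (sub_superalgebra n V) (sbracket (sub_superalgebra n V) x y) z +
        sscale (sub_superalgebra n V) (sg (a * b)) (sbracket (sub_superalgebra n V) y (sbracket (sub_superalgebra n V) x z))"
      if "x \<in> spart (sub_superalgebra n V) a" "y \<in> spart (sub_superalgebra n V) b" "z \<in> spart (sub_superalgebra n V) c" for x y z a b c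
    proof -
      have "x \<in> W" "wit_homogeneous n a x" "y \<in> W" "wit_homogeneous n b y" "z \<in> W" "wit_homogeneous n c z"
        using that V(2) by auto
      from bracket_jacobi[OF this] show ?thesis by simp
    qed
  qed (simp_all add: bracket_add_left bracket_add_right bracket_scale_left bracket_scale_right)
qed

text \<open>
  Inside the Lie superalgebra \<open>V\<close> the span of all brackets is a graded ideal, in particular a graded
  subalgebra. Applied twice to \<open>SHO'\<close>, this reaches \<open>SHO\<close>.
\<close>

lemma graded_subalgebra_bracket_span:
  assumes "graded_subalgebra V"
  shows "graded_subalgebra (bracket_span n V)" and "bracket_span n V \<subseteq> V"
proof -
  interpret L: lie_superalgebra "sub_superalgebra n V"
    by (rule lie_superalgebra_sub_superalgebra[OF assms])
  have [simp]: "sspace (sub_superalgebra n V) = V" "sscale (sub_superalgebra n V) = wit_scale"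
    "sbracket (sub_superalgebra n V) = bracket n"
    "spart (sub_superalgebra n V) \<theta> = {X \<in> V. wit_homogeneous n \<theta> X}" for \<theta>
    by (simp_all only: sub_superalgebra_def superalgebra.simps)
  have "graded_ideal (sub_superalgebra n V) (bracket_span n V)"
    using L.graded_ideal_derived by (simp add: bracket_span_def)
  then have I: "bracket_span n V \<subseteq> V" "wit.subspace (bracket_span n V)"
    "\<forall>X\<in>bracket_span n V. \<exists>Y\<in>bracket_span n V. \<exists>Z\<in>bracket_span n V. wit_homogeneous n 0 Y \<and> wit_homogeneous n 1 Z \<and> X = Y + Z"
    "\<forall>X\<in>V. \<forall>Y\<in>bracket_span n V. bracket n X Y \<in> bracket_span n V"
    unfolding graded_ideal_def by (simp_all, blast)
  show "bracket_span n V \<subseteq> V" by (rule I(1))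
  show "graded_subalgebra (bracket_span n V)"
    unfolding graded_subalgebra_def using I assms unfolding graded_subalgebra_def by blast
qed

lemma HO_eq: "HO n t = T_H n ` \<Lambda>"
  unfolding HO_def by (intro wit.span_eq_iff[THEN iffD2] T_H.subspace_image subspace_Lam)

lemma SHO'_components:
  fixes X :: "'f wit"
  assumes "X \<in> SHO' n t"
  obtains f where "f \<in> \<Lambda>" "X = T_H n f" "divergence n (T_H n (lam_part 0 f)) = 0" "divergence n (T_H n (lam_part 1 f)) = 0"
proof -
  obtain f where f: "f \<in> \<Lambda>" "X = T_H n f" "divergence n X = 0"
    using assms unfolding SHO'_def HO_eq by blast
  have h: "lam_homogeneous (\<theta> + 1) (divergence n (T_H n (lam_part \<theta> f)))" for \<theta>
  proof -
    note F = lam_part_Lam[OF f(1), of \<theta>] lam_part_homogeneous[of \<theta> f]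
    show ?thesis by (rule divergence_part(2)[OF T_H_witt[OF F] T_H_homogeneous[OF F]])
  qed
  have "divergence n (T_H n (lam_part 1 f)) + divergence n (T_H n (lam_part 0 f)) = 0"
    using f(3) unfolding f(2) divergence_add[symmetric] T_H.add[symmetric] add.commute[of "lam_part 1 f"] lam_part_sum .
  from homogeneous_components_zero[OF _ _ this] h[of 0] h[of 1]
  have "divergence n (T_H n (lam_part 0 f)) = 0" "divergence n (T_H n (lam_part 1 f)) = 0"
    by simp_all
  with f that show ?thesis by blast
qed

text \<open>
  Since \<open>T\<^sub>H\<close> reverses parity and the divergence preserves it, the homogeneous parts of a
  divergence-free \<open>T\<^sub>H(f)\<close> are divergence-free; closure under the bracket then follows from
  \<open>T_H_bracket\<close> and \<open>divergence_bracket\<close>.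
\<close>

lemma graded_subalgebra_SHO': "graded_subalgebra (SHO' n t :: 'f wit set)"
  unfolding graded_subalgebra_def
proof (intro conjI ballI)
  have HO: "wit.subspace (HO n t :: 'f wit set)" unfolding HO_def by (rule wit.subspace_span)
  have div0: "divergence n (0 :: 'f wit) = 0" using divergence_scale[of n 0 0] by simp
  show sub: "wit.subspace (SHO' n t :: 'f wit set)"
    using wit.subspace_0[OF HO] wit.subspace_add[OF HO] wit.subspace_scale[OF HO]
    by (intro wit.subspaceI) (simp_all add: SHO'_def divergence_add divergence_scale div0)
  have mem: "T_H n (lam_part \<theta> f) \<in> SHO' n t"
    if "f \<in> \<Lambda>" "divergence n (T_H n (lam_part \<theta> f)) = 0" for f \<theta>
    using that unfolding SHO'_def HO_eq by (simp add: lam_part_Lam)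
  have split: "T_H n f = T_H n (lam_part 1 f) + T_H n (lam_part 0 f)" for f :: "'f lam"
    unfolding T_H.add[symmetric] add.commute[of "lam_part 1 f"] lam_part_sum ..
  show "(SHO' n t :: 'f wit set) \<subseteq> W"
  proof
    fix X :: "'f wit" assume "X \<in> SHO' n t"
    then obtain f where f: "f \<in> \<Lambda>" "X = T_H n f" unfolding SHO'_def HO_eq by blast
    show "X \<in> W"
      unfolding f(2) split[of f]
      by (intro wit.subspace_add[OF subspace_witt] T_H_witt[OF lam_part_Lam lam_part_homogeneous] f)
  qed
  fix X :: "'f wit" assume "X \<in> SHO' n t"
  then obtain f where f: "f \<in> \<Lambda>" "X = T_H n f" "divergence n (T_H n (lam_part 0 f)) = 0" "divergence n (T_H n (lam_part 1 f)) = 0"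
    by (rule SHO'_components)
  have hom: "wit_homogeneous n (\<theta> + 1) (T_H n (lam_part \<theta> f))" if "f \<in> \<Lambda>" for \<theta> f
    by (intro T_H_homogeneous[OF lam_part_Lam lam_part_homogeneous] that)
  show "\<exists>Y\<in>SHO' n t. \<exists>Z\<in>SHO' n t. wit_homogeneous n 0 Y \<and> wit_homogeneous n 1 Z \<and> X = Y + Z"
    using hom[OF f(1), of 1] hom[OF f(1), of 0] f(2) split[of f] mem[OF f(1,4)] mem[OF f(1,3)] by auto
  fix Y :: "'f wit" assume "Y \<in> SHO' n t"
  then obtain g where g: "g \<in> \<Lambda>" "Y = T_H n g" "divergence n (T_H n (lam_part 0 g)) = 0" "divergence n (T_H n (lam_part 1 g)) = 0"
    by (rule SHO'_components)
  have b: "bracket n (T_H n (lam_part \<theta> f)) (T_H n (lam_part \<eta> g)) \<in> SHO' n t" for \<theta> \<eta>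
  proof -
    have df: "divergence n (T_H n (lam_part \<theta> f)) = 0" and dg: "divergence n (T_H n (lam_part \<eta> g)) = 0"
      using f g bit_cases[of \<theta>] bit_cases[of \<eta>] by auto
    note F = lam_part_Lam[OF f(1), of \<theta>] lam_part_homogeneous[of \<theta> f]
    note G = lam_part_Lam[OF g(1), of \<eta>] lam_part_homogeneous[of \<eta> g]
    have "act n X 0 = 0" for X :: "'f wit" using act_scale[of n X 0 0] by simp
    then have "divergence n (bracket n (T_H n (lam_part \<theta> f)) (T_H n (lam_part \<eta> g))) = 0"
      unfolding divergence_bracket[OF T_H_witt[OF F] T_H_homogeneous[OF F] T_H_witt[OF G] T_H_homogeneous[OF G]] df dg
      by (simp only: lam.scale_zero_right diff_self)
    moreover have "bracket n (T_H n (lam_part \<theta> f)) (T_H n (lam_part \<eta> g)) \<in> HO n t"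
      unfolding HO_eq T_H_bracket[OF F G] by (intro imageI act_\<Lambda> T_H_witt[OF F] G)
    ultimately show ?thesis unfolding SHO'_def by blast
  qed
  show "bracket n X Y \<in> SHO' n t"
    unfolding f(2) g(2) split[of f] split[of g] bracket_add_left bracket_add_right
    by (intro wit.subspace_add[OF sub] b)
qed

lemma finite_exponents: "finite (exponents p n t)"
proof -
  let ?H = "PiE {1..n} (\<lambda>i. {..p ^ t i - 1})"
  let ?G = "\<lambda>h :: nat \<Rightarrow> nat. \<Sum>i\<in>{1..n}. Poly_Mapping.single i (h i)"
  have "exponents p n t \<subseteq> ?G ` ?H"
  proof
    fix \<alpha> assume \<alpha>: "\<alpha> \<in> exponents p n t"
    have "\<alpha> = ?G (restrict (Poly_Mapping.lookup \<alpha>) {1..n})"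
    proof (rule poly_mapping_eqI)
      fix k
      have "Poly_Mapping.lookup \<alpha> k = 0" if "k \<notin> {1..n}" using \<alpha> that by (auto simp: exponents_def in_keys_iff)
      then show "Poly_Mapping.lookup \<alpha> k = Poly_Mapping.lookup (?G (restrict (Poly_Mapping.lookup \<alpha>) {1..n})) k"
        by (cases "k \<in> {1..n}") (simp_all add: lookup_sum lookup_single when_def)
    qed
    moreover have "restrict (Poly_Mapping.lookup \<alpha>) {1..n} \<in> ?H" using \<alpha> by (auto simp: exponents_def)
    ultimately show "\<alpha> \<in> ?G ` ?H" by (rule image_eqI)
  qed
  moreover have "finite ?H" by (intro finite_PiE) auto
  ultimately show ?thesis by (meson finite_imageI finite_subset)
qed

lemma HO_finite_dimensional: "\<exists>B. finite B \<and> HO n t \<subseteq> wit.span (B :: 'f wit set)"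
proof -
  let ?M = "exponents CHAR('f) n t \<times> Pow {n+1..2*n}"
  let ?B = "(\<lambda>m. T_H n (Poly_Mapping.single m (1::'f))) ` ?M"
  have "T_H n f \<in> wit.span ?B" if "f \<in> \<Lambda>" for f
  proof -
    have "T_H n f = (\<Sum>m\<in>Poly_Mapping.keys f. wit_scale (Poly_Mapping.lookup f m) (T_H n (Poly_Mapping.single m 1)))"
      by (subst lin_ext_single_1[symmetric]) (simp only: lin_ext_def T_H.sum T_H.scale)
    also have "\<dots> \<in> wit.span ?B"
      using that by (intro wit.span_sum wit.span_scale wit.span_base imageI) (auto simp: Lam_def)
    finally show ?thesis .
  qed
  then have "HO n t \<subseteq> wit.span ?B" unfolding HO_eq by blast
  moreover have "finite ?B" by (intro finite_imageI finite_cartesian_product finite_exponents) simp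
  ultimately show ?thesis by blast
qed

lemma SHO_lie_superalgebra: "lie_superalgebra (SHO n t :: ('f, 'f wit) superalgebra)"
  unfolding SHO_eq SHO_bar_def
  by (intro lie_superalgebra_sub_superalgebra graded_subalgebra_bracket_span graded_subalgebra_SHO')

lemma SHO_finite_dimensional: "\<exists>B. finite B \<and> sspace (SHO n t) \<subseteq> wit.span (B :: 'f wit set)"
proof -
  note B = graded_subalgebra_bracket_span[OF graded_subalgebra_SHO']
  have "sspace (SHO n t) \<subseteq> (SHO' n t :: 'f wit set)"
    unfolding SHO_eq SHO_bar_def sub_superalgebra_def superalgebra.simps
    using B(2) graded_subalgebra_bracket_span(2)[OF B(1)] by blast
  also have "\<dots> \<subseteq> HO n t" by (auto simp: SHO'_def)
  finally show ?thesis using HO_finite_dimensional by blast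
qed

end

theorem theorem4p8:
  fixes n :: nat and t :: "nat \<Rightarrow> nat"
  assumes "CHAR('f::alg_closed_field) > 2"
    and "n \<ge> 2"
    and "\<forall>i\<in>{1..n}. t i > 0"
    and "simple_superalgebra (SHO n t :: ('f, 'f wit) superalgebra)"
  shows "BDer (SHO n t :: ('f, 'f wit) superalgebra) = IBDer (SHO n t)"
proof -
  interpret witt_superalgebra n t "TYPE('f)"
    using assms(1) by unfold_locales (simp add: prime_CHAR_semidom)
  interpret SHO: lie_superalgebra "SHO n t :: ('f, 'f wit) superalgebra"
    by (rule SHO_lie_superalgebra)
  have scale: "sscale (SHO n t :: ('f, 'f wit) superalgebra) = wit_scale"
    by (simp add: SHO_def Let_def)
  obtain B :: "'f wit set" where B: "finite B" "sspace (SHO n t) \<subseteq> wit.span B"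
    using SHO_finite_dimensional by blast
  have "(of_nat 2 :: 'f) \<noteq> 0"
    unfolding of_nat_eq_0_iff_char_dvd using assms(1) by (auto dest: dvd_imp_le)
  then have char: "(2::'f) \<noteq> 0" by simp
  have roots: "\<exists>r. poly p r = 0" if "degree p > 0" for p :: "'f poly"
    using that by (rule alg_closed_imp_poly_has_root)
  show ?thesis
    using B(2) by (intro SHO.BDer_eq_IBDer[OF char roots B(1)] assms(4)) (simp_all only: scale)
qed

end
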